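(* Let $n\geq 1$ and let $\mathfrak{a}\subseteq\mathbb{C}[x_1,\ldots,x_n]$ be a nonzero monomial ideal, with Bernstein-Sato polynomial $b_{\mathfrak{a}}(s)$ and Newton polyhedron $P_{\mathfrak{a}}$. Then the set of classes in $\mathbb{Q}/\mathbb{Z}$ of the roots of $b_{\mathfrak{a}}(s)$ is equal to $$\bigcup_{Q}\Big\langle \tfrac{1}{m_Q}\Big\rangle,$$ where $Q$ runs over the facets of $P_{\mathfrak{a}}$ that are not contained in coordinate hyperplanes $\{x_i=0\}$, $1\le i\le n$, and $\langle \frac{1}{m_Q}\rangle$ denotes the subgroup of $\mathbb{Q}/\mathbb{Z}$ generated by the class of $\frac{1}{m_Q}$.
   Context: **Monomial data.** For $u\in\mathbb{Z}_{\geq 0}^n$ write $x^u=x_1^{u_1}\cdots x_n^{u_n}$. For a nonzero monomial ideal $\mathfrak{a}$ (an ideal generated by monomials) put $\Gamma_{\mathfrak{a}}=\{u\in\mathbb{Z}_{\ge 0}^n\mid x^u\in\mathfrak{a}\}$. The Newton polyhedron $P_{\mathfrak{a}}$ is the convex hull of $\Gamma_{\mathfrak{a}}$ in $\mathbb{R}_{\ge 0}^n$. A facet of $P_{\mathfrak{a}}$ is a maximal-dimensional proper face. **The integers $m_Q$.** If a facet $Q$ of $P_{\mathfrak{a}}$ is not contained in any coordinate hyperplane, its affine span does not contain the origin, and there is a unique linear function $L_Q$ on $\mathbb{R}^n$ such that $L_Q=1$ on $Q$; it has rational coefficients. Let $m_Q$ be the smallest positive integer such that $m_QL_Q$ has integral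 coefficients. **Bernstein-Sato polynomial.** Let $\mathcal{D}=\mathbb{C}[x_1,\ldots,x_n]\langle\partial_{x_1},\ldots,\partial_{x_n}\rangle$ be the Weyl algebra. Let $f_1,\ldots,f_r$ be nonzero generators of $\mathfrak{a}$ (for example monomials), and let $s_1,\ldots,s_r$ be independent variables. The ring $\mathcal{D}$ acts naturally on $$\mathbb{C}[x_1,\ldots,x_n]\Big[\prod_i f_i^{-1},s_1,\ldots,s_r\Big]\prod_i f_i^{s_i},$$ with $\partial_{x_k}\prod_i f_i^{s_i}=\sum_i s_i\frac{\partial f_i}{\partial x_k}f_i^{-1}\prod_j f_j^{s_j}$. Let $t_i$ be the $\mathcal{D}$-linear invertible operator on this module induced by $s_i\mapsto s_i+1$, $s_j\mapsto s_j$ for $j\ne i$ (so $t_i(h(x,\ldots,s_i,\ldots)\prod_j f_j^{s_j})=h(x,\ldots,s_i+1,\ldots)\,f_i\prod_j f_j^{s_j}$). Put $s_{i,j}=s_it_i^{-1}t_j$ and $s=\sum_i s_i$. The Bernstein-Sato polynomial $b_{\mathfrak{a}}(s)=b_f(s)$ is the monic polynomial in one variable of smallest degree such that $$b_f(s)\prod_i f_i^{s_i}=\sum_{k=1}^r P_kt_k\prod_i f_i^{s_i}$$ for some $P_k$ in the ring generated by $\mathcal{D}$ and the $s_{i,j}$ ($1\le i,j\le r$). Equivalently, it is the monic polynomial of smallest degree such that $b_f(\sum_i s_i)\prod_i f_i^{s_i}$ belongs to the $\mathcal{D}[s_1,\ldots,s_r]$-submodule generated by the elements $$\prod_{i:\,c_i<0}\binom{s_i}{-c_i}\cdot\prod_{i=1}^r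 f_i^{s_i+c_i},$$ where $(c_1,\ldots,c_r)$ runs over the elements of $\mathbb{Z}^r$ with $\sum_i c_i=1$, and $\binom{s_i}{m}=s_i(s_i-1)\cdots(s_i-m+1)/m!$. It is known that $b_{\mathfrak{a}}$ depends only on $\mathfrak{a}$, not on the choice of generators, and that its roots are negative rational numbers. *)

theory Defs
  imports
    "HOL-Analysis.Analysis"
    "HOL-Library.Poly_Mapping"
    "HOL-Computational_Algebra.Polynomial"
    "HOL-Computational_Algebra.Fraction_Field"
    "HOL-Algebra.Generated_Groups"
begin

section \<open>Polynomials, rational functions and partial derivatives\<close>

text \<open>
  The variables $x_1,\dots,x_n$ are indexed by a finite type \<open>'n\<close>. The linear order that is
  asked of \<open>'n\<close> below only serves to obtain, from the library, that \<open>'n cpoly\<close> is an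
  integral domain; no definition depends on it.
\<close>

type_synonym 'n cpoly = "('n \<Rightarrow>\<^sub>0 nat) \<Rightarrow>\<^sub>0 complex"
type_synonym 'n crat = "'n cpoly fract"

definition xmonom :: "('n \<Rightarrow>\<^sub>0 nat) \<Rightarrow> 'n cpoly" where
  "xmonom u = Poly_Mapping.single u 1"

definition mpderiv :: "'n \<Rightarrow> 'n cpoly \<Rightarrow> 'n cpoly" where
  "mpderiv k p = (\<Sum>u\<in>Poly_Mapping.keys p.
     Poly_Mapping.single (u - Poly_Mapping.single k 1)
       (of_nat (Poly_Mapping.lookup u k) * Poly_Mapping.lookup p u))"

lemma mpderiv_superset:
  assumes "finite A" "Poly_Mapping.keys p \<subseteq> A"
  shows "mpderiv k p = (\<Sum>u\<in>A. Poly_Mapping.single (u - Poly_Mapping.single k 1)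
       (of_nat (Poly_Mapping.lookup u k) * Poly_Mapping.lookup p u))"
  unfolding mpderiv_def
  by (rule sum.mono_neutral_left) (use assms in \<open>auto simp: in_keys_iff\<close>)

lemma mpderiv_zero [simp]: "mpderiv k 0 = 0"
  by (simp add: mpderiv_def)

lemma mpderiv_add: "mpderiv k (p + q) = mpderiv k p + mpderiv k q"
proof -
  let ?A = "Poly_Mapping.keys p \<union> Poly_Mapping.keys q"
  have "Poly_Mapping.keys (p + q) \<subseteq> ?A" by (rule Poly_Mapping.keys_add)
  then show ?thesis
    by (simp add: mpderiv_superset[of ?A] lookup_add distrib_left single_add sum.distrib)
qed

lemma mpderiv_sum: "mpderiv k (sum f A) = (\<Sum>a\<in>A. mpderiv k (f a))"
  by (induction A rule: infinite_finite_induct) (auto simp: mpderiv_add)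

lemma mpderiv_single:
  "mpderiv k (Poly_Mapping.single u c) =
     Poly_Mapping.single (u - Poly_Mapping.single k 1) (of_nat (Poly_Mapping.lookup u k) * c)"
  by (subst mpderiv_superset[of "{u}"]) auto

lemma cpoly_eq_sum_single:
  "p = (\<Sum>u\<in>Poly_Mapping.keys p. Poly_Mapping.single u (Poly_Mapping.lookup p u))"
  for p :: "'n cpoly"
proof (rule poly_mapping_eqI)
  fix v
  show "Poly_Mapping.lookup p v = Poly_Mapping.lookup
      (\<Sum>u\<in>Poly_Mapping.keys p. Poly_Mapping.single u (Poly_Mapping.lookup p u)) v"
    by (simp add: lookup_sum lookup_single when_def in_keys_iff)
qed

lemma mpderiv_mult_single:
  "mpderiv k (Poly_Mapping.single u a * Poly_Mapping.single v b) =
     mpderiv k (Poly_Mapping.single u a) * Poly_Mapping.single v b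
     + Poly_Mapping.single u a * mpderiv k (Poly_Mapping.single v b)"
proof -
  define e where "e = (Poly_Mapping.single k 1 :: 'a \<Rightarrow>\<^sub>0 nat)"
  have shift: "w - e + z = w + z - e" if "Poly_Mapping.lookup w k \<noteq> 0" for w z :: "'a \<Rightarrow>\<^sub>0 nat"
    by (rule poly_mapping_eqI)
       (use that in \<open>auto simp: e_def lookup_add lookup_minus lookup_single when_def\<close>)
  have 1: "Poly_Mapping.single (u - e + v) (of_nat (Poly_Mapping.lookup u k) * a * b)
      = Poly_Mapping.single (u + v - e) (of_nat (Poly_Mapping.lookup u k) * a * b)"
    by (cases "Poly_Mapping.lookup u k = 0") (auto simp: shift)
  have 2: "Poly_Mapping.single (u + (v - e)) (a * (of_nat (Poly_Mapping.lookup v k) * b))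
      = Poly_Mapping.single (u + v - e) (a * (of_nat (Poly_Mapping.lookup v k) * b))"
    using shift[of v u] by (cases "Poly_Mapping.lookup v k = 0") (auto simp: add.commute)
  show ?thesis
    by (simp only: mult_single mpderiv_single e_def[symmetric] 1 2 single_add[symmetric])
       (simp add: lookup_add algebra_simps)
qed

lemma mpderiv_mult: "mpderiv k (p * q) = mpderiv k p * q + p * mpderiv k q"
proof -
  let ?s = "\<lambda>p u. Poly_Mapping.single u (Poly_Mapping.lookup p u) :: 'a cpoly"
  let ?P = "Poly_Mapping.keys p" and ?Q = "Poly_Mapping.keys q"
  have "p * q = (\<Sum>u\<in>?P. \<Sum>v\<in>?Q. ?s p u * ?s q v)"
    by (subst cpoly_eq_sum_single[of p], subst cpoly_eq_sum_single[of q]) (rule sum_product)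
  then have "mpderiv k (p * q) =
      (\<Sum>u\<in>?P. \<Sum>v\<in>?Q. mpderiv k (?s p u) * ?s q v + ?s p u * mpderiv k (?s q v))"
    by (simp add: mpderiv_sum mpderiv_mult_single)
  also have "\<dots> = mpderiv k (\<Sum>u\<in>?P. ?s p u) * (\<Sum>v\<in>?Q. ?s q v)
      + (\<Sum>u\<in>?P. ?s p u) * mpderiv k (\<Sum>v\<in>?Q. ?s q v)"
    by (simp add: mpderiv_sum sum_product sum.distrib)
  finally show ?thesis
    by (simp flip: cpoly_eq_sum_single)
qed

lift_definition rat_deriv :: "'n::linorder \<Rightarrow> 'n crat \<Rightarrow> 'n crat"
  is "\<lambda>k (p, q). (mpderiv k p * q - p * mpderiv k q, q * q)"
proof (clarsimp simp: fractrel_def)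
  fix k :: 'n and p q p' q' :: "'n cpoly"
  assume nz: "q \<noteq> 0" "q' \<noteq> 0" and eq: "p * q' = p' * q"
  have "mpderiv k p * q' + p * mpderiv k q' = mpderiv k p' * q + p' * mpderiv k q"
    using arg_cong[OF eq, of "mpderiv k"] by (simp only: mpderiv_mult)
  then have d: "mpderiv k p * q' = mpderiv k p' * q + p' * mpderiv k q - p * mpderiv k q'"
    by (simp add: algebra_simps)
  have "(mpderiv k p * q - p * mpderiv k q) * (q' * q')
      = (mpderiv k p * q') * q * q' - (p * q') * mpderiv k q * q'"
    by (simp add: algebra_simps)
  also have "\<dots> = mpderiv k p' * q * q * q' + (p' * q) * mpderiv k q * q' - (p * q') * mpderiv k q' * q
        - (p * q') * mpderiv k q * q'"
    unfolding d by (simp add: algebra_simps)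
  also have "\<dots> = (mpderiv k p' * q' - p' * mpderiv k q') * (q * q)"
    unfolding eq by (simp add: algebra_simps)
  finally show "(mpderiv k p * q - p * mpderiv k q) * (q' * q')
      = (mpderiv k p' * q' - p' * mpderiv k q') * (q * q)" .
qed


section \<open>Monomial ideals and their Newton polyhedra\<close>

definition ideal_gen :: "'n cpoly set \<Rightarrow> 'n cpoly set" where
  "ideal_gen = module.span (*)"

definition monomial_ideal :: "'n cpoly set \<Rightarrow> bool" where
  "monomial_ideal \<aa> \<longleftrightarrow> (\<exists>U. \<aa> = ideal_gen (xmonom ` U))"

definition exponents :: "'n cpoly set \<Rightarrow> (real ^ 'n::finite) set" where
  "exponents \<aa> = {\<chi> i. real (Poly_Mapping.lookup u i) | u. xmonom u \<in> \<aa>}"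

definition newton_polyhedron :: "'n cpoly set \<Rightarrow> (real ^ 'n::finite) set" where
  "newton_polyhedron \<aa> = convex hull exponents \<aa>"

definition in_coordinate_hyperplane :: "(real ^ 'n::finite) set \<Rightarrow> bool" where
  "in_coordinate_hyperplane Q \<longleftrightarrow> (\<exists>i. Q \<subseteq> {u. u $ i = 0})"

text \<open>The coefficients of a linear form are its values on the standard basis vectors.\<close>

definition facet_form :: "(real ^ 'n::finite) set \<Rightarrow> real ^ 'n \<Rightarrow> real" where
  "facet_form Q = (THE L. linear L \<and> (\<forall>u\<in>Q. L u = 1))"

definition facet_denom :: "(real ^ 'n::finite) set \<Rightarrow> nat" where
  "facet_denom Q = (LEAST m. 0 < m \<and> (\<forall>i. of_nat m * facet_form Q (axis i 1) \<in> \<int>))"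


section \<open>The Bernstein-Sato polynomial\<close>

text \<open>
  The module $\mathbb{C}[x][\prod_i f_i^{-1}, s_1,\dots,s_r]\prod_i f_i^{s_i}$ is free of rank one,
  and an element $h \prod_i f_i^{s_i}$ is represented by its coefficient \<open>h\<close>. So
  $\prod_i f_i^{s_i}$ is \<open>1\<close>. The coefficients are taken in $\mathbb{C}(x)[s_0,s_1,\dots]$: all
  operators below for a list \<open>fs\<close> of length \<open>r\<close> preserve the subring
  $\mathbb{C}[x][\prod_i f_i^{-1}, s_0,\dots,s_{r-1}]$, and are only applied to elements of it.
\<close>

type_synonym 'n fs_module = "(nat \<Rightarrow>\<^sub>0 nat) \<Rightarrow>\<^sub>0 'n crat"

definition rat_const :: "'n::linorder crat \<Rightarrow> 'n fs_module" where
  "rat_const c = Poly_Mapping.single 0 c"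

definition poly_const :: "'n::linorder cpoly \<Rightarrow> 'n fs_module" where
  "poly_const p = rat_const (Fract p 1)"

definition complex_const :: "complex \<Rightarrow> 'n::linorder fs_module" where
  "complex_const c = poly_const (Poly_Mapping.single 0 c)"

definition s_var :: "nat \<Rightarrow> 'n::linorder fs_module" where
  "s_var i = Poly_Mapping.single (Poly_Mapping.single i 1) 1"

text \<open>The substitution $s_i \mapsto s_i + c$, with all other $s_j$ fixed:\<close>

definition s_shift :: "nat \<Rightarrow> int \<Rightarrow> 'n::linorder fs_module \<Rightarrow> 'n fs_module" where
  "s_shift i c h = (\<Sum>m\<in>Poly_Mapping.keys h. rat_const (Poly_Mapping.lookup h m) *
     (\<Prod>j\<in>Poly_Mapping.keys m.
        (if j = i then s_var j + of_int c else s_var j) ^ Poly_Mapping.lookup m j))"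

lemma s_shift_superset:
  assumes "finite A" "Poly_Mapping.keys h \<subseteq> A"
  shows "s_shift i c h = (\<Sum>m\<in>A. rat_const (Poly_Mapping.lookup h m) *
     (\<Prod>j\<in>Poly_Mapping.keys m.
        (if j = i then s_var j + of_int c else s_var j) ^ Poly_Mapping.lookup m j))"
  unfolding s_shift_def
  by (rule sum.mono_neutral_left) (use assms in \<open>auto simp: in_keys_iff rat_const_def\<close>)

lemma s_shift_add: "s_shift i c (p + q) = s_shift i c p + s_shift i c q"
proof -
  let ?A = "Poly_Mapping.keys p \<union> Poly_Mapping.keys q"
  have "Poly_Mapping.keys (p + q) \<subseteq> ?A" by (rule Poly_Mapping.keys_add)
  then show ?thesis
    by (simp add: s_shift_superset[of ?A] lookup_add distrib_right rat_const_def single_add sum.distrib)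
qed

lemma s_shift_sum: "s_shift i c (sum f A) = (\<Sum>a\<in>A. s_shift i c (f a))"
  by (induction A rule: infinite_finite_induct) (auto simp: s_shift_add, auto simp: s_shift_def)

lemma s_shift_single:
  assumes "finite B" "Poly_Mapping.keys m \<subseteq> B"
  shows "s_shift i c (Poly_Mapping.single m a) = rat_const a * (\<Prod>j\<in>B.
        (if j = i then s_var j + of_int c else s_var j) ^ Poly_Mapping.lookup m j)"
proof -
  have "s_shift i c (Poly_Mapping.single m a) = rat_const a * (\<Prod>j\<in>Poly_Mapping.keys m.
        (if j = i then s_var j + of_int c else s_var j) ^ Poly_Mapping.lookup m j)"
    by (subst s_shift_superset[of "{m}"]) auto
  also have "(\<Prod>j\<in>Poly_Mapping.keys m.
        (if j = i then s_var j + of_int c else s_var j :: 'a fs_module) ^ Poly_Mapping.lookup m j)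
      = (\<Prod>j\<in>B. (if j = i then s_var j + of_int c else s_var j) ^ Poly_Mapping.lookup m j)"
    by (rule prod.mono_neutral_left) (use assms in \<open>auto simp: in_keys_iff\<close>)
  finally show ?thesis .
qed

lemma s_shift_mult_single:
  "s_shift i c (Poly_Mapping.single m a * Poly_Mapping.single m' a') =
     s_shift i c (Poly_Mapping.single m a) * s_shift i c (Poly_Mapping.single m' a')"
proof -
  let ?B = "Poly_Mapping.keys m \<union> Poly_Mapping.keys m'"
  have "Poly_Mapping.keys (m + m') \<subseteq> ?B" by (rule Poly_Mapping.keys_add)
  moreover have "rat_const (a * a') = rat_const a * rat_const a'"
    by (simp add: rat_const_def mult_single)
  ultimately show ?thesis
    by (simp add: mult_single s_shift_single[of ?B] lookup_add power_add prod.distrib mult_ac)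
qed

lemma fs_module_eq_sum_single:
  "p = (\<Sum>u\<in>Poly_Mapping.keys p. Poly_Mapping.single u (Poly_Mapping.lookup p u))"
  for p :: "('n::linorder) fs_module"
  by (rule poly_mapping_eqI) (simp add: lookup_sum lookup_single when_def in_keys_iff)

lemma s_shift_mult: "s_shift i c (p * q) = s_shift i c p * s_shift i c q"
proof -
  let ?s = "\<lambda>p u. Poly_Mapping.single u (Poly_Mapping.lookup p u) :: 'a fs_module"
  let ?P = "Poly_Mapping.keys p" and ?Q = "Poly_Mapping.keys q"
  have "p * q = (\<Sum>u\<in>?P. \<Sum>v\<in>?Q. ?s p u * ?s q v)"
    by (subst fs_module_eq_sum_single[of p], subst fs_module_eq_sum_single[of q]) (rule sum_product)
  then have "s_shift i c (p * q) = s_shift i c (\<Sum>u\<in>?P. ?s p u) * s_shift i c (\<Sum>v\<in>?Q. ?s q v)"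
    by (simp add: s_shift_sum s_shift_mult_single sum_product)
  then show ?thesis
    by (simp flip: fs_module_eq_sum_single)
qed

lemma s_shift_rat_const [simp]: "s_shift i c (rat_const a) = rat_const a"
  by (simp add: rat_const_def s_shift_single[of "{}"])

lemma one_fs_module: "(1 :: 'n::linorder fs_module) = rat_const 1"
  by (simp add: rat_const_def)

lemma s_shift_one [simp]: "s_shift i c 1 = 1"
  by (simp add: one_fs_module)

lemma s_shift_of_int [simp]: "s_shift i c (of_int d) = of_int d"
proof -
  have "of_int d = (rat_const (of_int d) :: 'a fs_module)"
    by (simp add: rat_const_def)
  then show ?thesis by simp
qed

lemma s_shift_s_var:
  "s_shift i c (s_var j) = (if j = i then s_var j + of_int c else s_var j)"
  unfolding s_var_def
  by (subst s_shift_single[of "{j}"]) (auto simp: s_var_def rat_const_def)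

lemma s_shift_prod: "s_shift i c (prod f A) = (\<Prod>a\<in>A. s_shift i c (f a))"
  by (induction A rule: infinite_finite_induct) (auto simp: s_shift_mult)

lemma s_shift_power: "s_shift i c (p ^ k) = s_shift i c p ^ k"
  by (induction k) (auto simp: s_shift_mult)

lemma s_shift_id: "s_shift i 0 h = h"
proof -
  have *: "Poly_Mapping.single m a = rat_const a *
      (\<Prod>j\<in>Poly_Mapping.keys m. s_var j ^ Poly_Mapping.lookup m j)" for m and a :: "'a crat"
  proof -
    have p: "(s_var j :: 'a fs_module) ^ k = Poly_Mapping.single (Poly_Mapping.single j k) 1" for j k
      by (induction k) (auto simp: s_var_def mult_single simp flip: single_add)
    have "(\<Prod>j\<in>A. s_var j ^ Poly_Mapping.lookup m j :: 'a fs_module) = 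
       Poly_Mapping.single (\<Sum>j\<in>A. Poly_Mapping.single j (Poly_Mapping.lookup m j)) 1" for A
      by (induction A rule: infinite_finite_induct) (auto simp: p mult_single)
    moreover have "(\<Sum>j\<in>Poly_Mapping.keys m. Poly_Mapping.single j (Poly_Mapping.lookup m j)) = m"
      by (rule poly_mapping_eqI) (simp add: lookup_sum lookup_single when_def in_keys_iff)
    ultimately show ?thesis by (simp add: rat_const_def mult_single)
  qed
  have "(if j = i then s_var j + of_int 0 else s_var j :: 'a fs_module) = s_var j" for j
    by simp
  then have "s_shift i 0 h =
      (\<Sum>m\<in>Poly_Mapping.keys h. Poly_Mapping.single m (Poly_Mapping.lookup h m))"
    unfolding s_shift_def by (simp only: *)
  then show ?thesis
    by (simp only: fs_module_eq_sum_single[symmetric])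
qed

lemma s_shift_s_shift: "s_shift i c (s_shift i d h) = s_shift i (c + d) h"
proof -
  have *: "s_shift i c (if j = i then s_var j + of_int d else s_var j :: 'a fs_module) =
      (if j = i then s_var j + of_int (c + d) else s_var j)" for j
    by (simp add: s_shift_s_var s_shift_add add_ac)
  show ?thesis
    unfolding s_shift_def[of i d] s_shift_def[of i "c + d"]
    by (simp only: s_shift_sum s_shift_mult s_shift_prod s_shift_power s_shift_rat_const *)
qed

definition mult_op :: "'n::linorder cpoly \<Rightarrow> 'n fs_module \<Rightarrow> 'n fs_module" where
  "mult_op p h = poly_const p * h"

definition deriv_op :: "'n::linorder cpoly list \<Rightarrow> 'n \<Rightarrow> 'n fs_module \<Rightarrow> 'n fs_module" where
  "deriv_op fs k h = Poly_Mapping.map (rat_deriv k) h +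
     (\<Sum>i<length fs. s_var i * rat_const (Fract (mpderiv k (fs ! i)) (fs ! i))) * h"

definition t_op :: "'n::linorder cpoly list \<Rightarrow> nat \<Rightarrow> 'n fs_module \<Rightarrow> 'n fs_module" where
  "t_op fs i h = s_shift i 1 h * poly_const (fs ! i)"

definition t_inv_op :: "'n::linorder cpoly list \<Rightarrow> nat \<Rightarrow> 'n fs_module \<Rightarrow> 'n fs_module" where
  "t_inv_op fs i h = s_shift i (-1) h * rat_const (Fract 1 (fs ! i))"

lemma t_op_inverse:
  assumes "i < length fs" "0 \<notin> set fs"
  shows "t_inv_op fs i (t_op fs i h) = h" "t_op fs i (t_inv_op fs i h) = h"
proof -
  have "fs ! i \<noteq> 0" using assms nth_mem by metis
  then have "Fract (fs ! i) (fs ! i) = 1"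
    by (simp add: One_fract_def eq_fract)
  then have "poly_const (fs ! i) * rat_const (Fract 1 (fs ! i)) = 1"
    by (simp add: poly_const_def rat_const_def mult_single)
  then show "t_inv_op fs i (t_op fs i h) = h" "t_op fs i (t_inv_op fs i h) = h"
    by (simp_all add: t_inv_op_def t_op_def s_shift_mult s_shift_s_shift s_shift_id poly_const_def
        mult.assoc) (simp_all add: mult.commute)
qed

definition s_op :: "'n::linorder cpoly list \<Rightarrow> nat \<Rightarrow> nat \<Rightarrow> 'n fs_module \<Rightarrow> 'n fs_module" where
  "s_op fs i j h = s_var i * t_inv_op fs i (t_op fs j h)"

inductive_set op_ring :: "('m::ab_group_add \<Rightarrow> 'm) set \<Rightarrow> ('m \<Rightarrow> 'm) set"
  for G :: "('m \<Rightarrow> 'm) set" where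
  gen: "P \<in> G \<Longrightarrow> P \<in> op_ring G"
| one: "id \<in> op_ring G"
| add: "P \<in> op_ring G \<Longrightarrow> P' \<in> op_ring G \<Longrightarrow> (\<lambda>h. P h + P' h) \<in> op_ring G"
| neg: "P \<in> op_ring G \<Longrightarrow> (\<lambda>h. - P h) \<in> op_ring G"
| mul: "P \<in> op_ring G \<Longrightarrow> P' \<in> op_ring G \<Longrightarrow> P \<circ> P' \<in> op_ring G"

definition weyl_ops :: "'n::linorder cpoly list \<Rightarrow> ('n fs_module \<Rightarrow> 'n fs_module) set" where
  "weyl_ops fs = op_ring (range mult_op \<union> range (deriv_op fs))"

definition bs_ops :: "'n::linorder cpoly list \<Rightarrow> ('n fs_module \<Rightarrow> 'n fs_module) set" where
  "bs_ops fs = op_ring (weyl_ops fs \<union> {s_op fs i j | i j. i < length fs \<and> j < length fs})"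

definition bs_equation :: "'n::linorder cpoly list \<Rightarrow> complex poly \<Rightarrow> bool" where
  "bs_equation fs b \<longleftrightarrow>
     (\<exists>P. (\<forall>k<length fs. P k \<in> bs_ops fs) \<and>
        poly (map_poly complex_const b) (\<Sum>i<length fs. s_var i) * 1 =
        (\<Sum>k<length fs. P k (t_op fs k 1)))"

definition bernstein_sato_poly :: "'n::linorder cpoly list \<Rightarrow> complex poly" where
  "bernstein_sato_poly fs =
     (THE b. lead_coeff b = 1 \<and> bs_equation fs b \<and>
        (\<forall>c. lead_coeff c = 1 \<and> bs_equation fs c \<longrightarrow> degree b \<le> degree c))"


section \<open>The group of rational numbers modulo the integers\<close>

definition rat_group :: "rat monoid" where
  "rat_group = \<lparr>carrier = UNIV, monoid.mult = (+), one = 0\<rparr>"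

definition QZ :: "rat set monoid" where
  "QZ = rat_group Mod \<int>"

definition QZ_class :: "rat \<Rightarrow> rat set" where
  "QZ_class q = \<int> #>\<^bsub>rat_group\<^esub> q"

end

theory Submission
  imports Defs
begin

text \<open>
  Let \<open>f\<^sub>0, \<dots>\<close> be the given generators of \<open>\<aa>\<close>. The proof has an algebraic half, which turns the
  functional equation into a statement about one ideal of polynomials in the \<open>s\<^sub>j\<close>, and a
  polyhedral half, which reads off the zeros of that ideal modulo the integers.

  The functional equation does not depend on the generators. Put \<open>N = \<complex>[x, \<tau>\<^sub>0, \<tau>\<^sub>1, \<dots>]\<close> and let \<open>q \<in> N\<close> stand for
  \<open>q exp (- \<Sum> f\<^sub>i \<tau>\<^sub>i)\<close>, the Fourier transform in \<open>t\<close> of a combination of derivatives of the delta function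
  \<open>\<delta> (t - f)\<close>. Here \<open>t\<^sub>i\<close> is \<open>- \<partial>/\<partial>\<tau>\<^sub>i\<close> and \<open>\<Sum> s\<^sub>i\<close> is \<open>- \<Sum> \<tau>\<^sub>i t\<^sub>i\<close>. The Mellin transform
  \<open>\<tau>\<^sup>\<nu> \<mapsto> (-1)\<^bsup>|\<nu>|\<^esup> [s]\<^sub>\<nu> / f\<^sup>\<nu>\<close>, with \<open>[s]\<^sub>\<nu>\<close> the product of the falling factorials, embeds \<open>N\<close> into
  \<open>\<complex>(x)[s]\<close>, and \<open>b\<close> satisfies the functional equation iff
  \<open>b (- \<Sum> \<tau>\<^sub>i t\<^sub>i) 1\<close> lies in the \<open>D\<close>-module generated by all \<open>m \<tau>\<^sup>\<nu>\<close> with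
  \<open>m \<in> \<aa>\<^bsup>|\<nu>| + 1\<^esup>\<close> (\<open>bs_equation_iff_vfilt\<close>). If \<open>g\<^sub>j = \<Sum> p\<^sub>j\<^sub>i f\<^sub>i\<close>, then the substitution \<open>\<tau>\<^sub>i \<mapsto> \<Sum> p\<^sub>j\<^sub>i \<tau>\<^sub>j\<close>
  takes \<open>\<Sum> f\<^sub>i \<tau>\<^sub>i\<close> to \<open>\<Sum> g\<^sub>j \<tau>\<^sub>j\<close>, so it carries the condition for \<open>f\<close> to the condition for \<open>g\<close>
  (\<open>b_act_vfilt_independent\<close>). Hence the generators may be taken to be monomials \<open>x\<^bsup>a(j)\<^esup>\<close>.

  For monomials let \<open>l\<^sub>i(s) = \<Sum> a(j)\<^sub>i s\<^sub>j\<close>. For an integer vector \<open>c\<close> with \<open>\<Sum> c\<^sub>j = 1\<close> let \<open>G\<^sub>c\<close> be the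
  product of the factors \<open>v - s\<^sub>j\<close> for \<open>0 \<le> v < - c\<^sub>j\<close> and \<open>l\<^sub>i(s) + w\<close> for \<open>1 \<le> w \<le> l\<^sub>i(c)\<close>. If all \<open>G\<^sub>c\<close>
  vanish at a point \<open>s\<close>, then \<open>\<Sum> s\<^sub>j\<close> is a root of every \<open>b\<close> that satisfies the functional equation: a functional
  on \<open>N\<close>, built from the point, kills the \<open>D\<close>-module above (\<open>root_point_imp_root\<close>). Conversely
  the \<open>G\<^sub>c\<close> satisfy the functional equation in place of \<open>b\<close>. As they are products of linear
  forms, some product of factors \<open>\<Sum> s\<^sub>j - \<alpha>\<close> also does, as soon as for finitely many \<open>c\<close> every choice of
  one factor of each \<open>G\<^sub>c\<close> forces \<open>\<Sum> s\<^sub>j\<close> to be one of the numbers \<open>\<alpha>\<close>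
  (\<open>bs_equation_from_directions\<close>).

  The linear forms \<open>L\<^sub>Q\<close> of the facets \<open>Q\<close> outside the coordinate hyperplanes are the vertices of the dual polyhedron
  \<open>{\<mu> \<ge> 0 | \<mu> \<bullet> a(j) \<ge> 1 for all j}\<close> (\<open>facet_denoms_eq\<close>). Let \<open>J\<close> and \<open>I\<close> be the sets of indices \<open>j\<close> and
  \<open>i\<close> that occur in a choice of factors. By Farkas' lemma, either some \<open>c\<close> has \<open>\<Sum> c\<^sub>j = 1\<close>, \<open>c\<^sub>j \<ge> 0\<close> on \<open>J\<close>
  and \<open>l\<^sub>i(c) \<le> 0\<close> on \<open>I\<close>, and then no factor of \<open>G\<^sub>c\<close> has its index in \<open>J\<close> or \<open>I\<close>; or there is a vertex \<open>\<mu>\<close> that is zero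
  off \<open>I\<close> and has \<open>\<mu> \<bullet> a(j) = 1\<close> off \<open>J\<close>, and then
  \<open>\<Sum> s\<^sub>j = \<Sum> \<mu>\<^sub>i l\<^sub>i(s) - \<Sum> (\<mu> \<bullet> a(j) - 1) s\<^sub>j\<close> involves only quantities with chosen integral values,
  so it lies in \<open>(1/m) \<int>\<close> for the denominator \<open>m\<close> of \<open>\<mu>\<close>. This bounds the roots. To attain
  every class in \<open>(1/m) \<int>\<close> modulo \<open>\<int>\<close>, start with a point \<open>s\<close> for which \<open>\<Sum> s\<^sub>j\<close> is in that class and that has integral
  \<open>l\<^sub>i(s) < 0\<close> where \<open>\<mu>\<^sub>i > 0\<close> and \<open>s\<^sub>j = 0\<close> where \<open>\<mu> \<bullet> a(j) > 1\<close>, and add an integer vector that keeps the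
  signs and maximises \<open>\<Sum> s\<^sub>j\<close>, which the displayed formula bounds above by 0. By maximality all \<open>G\<^sub>c\<close>
  vanish at the result (\<open>dual_vertex_root_point\<close>).
\<close>

section \<open>Polynomials: induction, substitution, differentiation\<close>

definition Cst :: "'c \<Rightarrow> ('v \<Rightarrow>\<^sub>0 nat) \<Rightarrow>\<^sub>0 'c::comm_ring_1" where
  "Cst c = Poly_Mapping.single 0 c"

definition Var :: "'v \<Rightarrow> ('v \<Rightarrow>\<^sub>0 nat) \<Rightarrow>\<^sub>0 'c::comm_ring_1" where
  "Var v = Poly_Mapping.single (Poly_Mapping.single v 1) 1"

lemma Cst_simps [simp]: "Cst 0 = 0" "Cst 1 = 1"
  by (simp_all add: Cst_def)

lemma Cst_add: "Cst (a + b) = Cst a + Cst b"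
  and Cst_mult: "Cst (a * b) = Cst a * Cst b"
  and Cst_uminus: "Cst (- a) = - Cst a"
  by (simp_all add: Cst_def single_add mult_single single_uminus)

lemma Cst_diff: "Cst (a - b) = Cst a - Cst b"
  using Cst_add[of a "- b"] by (simp add: Cst_uminus)

lemma Cst_sum: "Cst (sum f A) = (\<Sum>a\<in>A. Cst (f a))"
  by (induction A rule: infinite_finite_induct) (auto simp: Cst_add)

lemma Cst_of_nat [simp]: "Cst (of_nat n) = of_nat n"
  by (simp add: Cst_def)

lemma Cst_Var_mult_single:
  "Cst c * Poly_Mapping.single m a = Poly_Mapping.single m (c * a)"
  "Var v * Poly_Mapping.single m a = Poly_Mapping.single (Poly_Mapping.single v 1 + m) a"
  by (simp_all add: Cst_def Var_def mult_single)

lemma monomial_induct [case_names zero add_var]: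
  fixes m :: "'v \<Rightarrow>\<^sub>0 nat"
  assumes "P 0" and "\<And>v m. P m \<Longrightarrow> P (Poly_Mapping.single v 1 + m)"
  shows "P m"
proof (induction m rule: update_induct)
  case const
  then show ?case by (fact assms(1))
next
  case (update m v n)
  have "Poly_Mapping.update v n m = Poly_Mapping.single v n + m" for n
    using \<open>v \<notin> Poly_Mapping.keys m\<close>
    by (intro poly_mapping_eqI) (auto simp: lookup_update lookup_add lookup_single when_def in_keys_iff)
  moreover have "P (Poly_Mapping.single v n + m)" for n
  proof (induction n)
    case (Suc n)
    have "Poly_Mapping.single v (Suc n) + m = Poly_Mapping.single v 1 + (Poly_Mapping.single v n + m)"
      by (simp add: add.assoc[symmetric] single_add[symmetric])
    then show ?case using assms(2)[OF Suc, of v] by simp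
  qed (use update in simp)
  ultimately show ?case by simp
qed

lemma mpoly_eq_sum_single:
  "p = (\<Sum>u\<in>Poly_Mapping.keys p. Poly_Mapping.single u (Poly_Mapping.lookup p u))"
  for p :: "'m \<Rightarrow>\<^sub>0 'c::comm_monoid_add"
  by (rule poly_mapping_eqI) (simp add: lookup_sum lookup_single when_def in_keys_iff)

lemma mpoly_induct_single [case_names zero single add]:
  fixes p :: "'m \<Rightarrow>\<^sub>0 'c::comm_monoid_add"
  assumes "P 0" "\<And>m c. P (Poly_Mapping.single m c)" "\<And>p q. P p \<Longrightarrow> P q \<Longrightarrow> P (p + q)"
  shows "P p"
proof -
  have "P (\<Sum>u\<in>A. Poly_Mapping.single u (Poly_Mapping.lookup p u))" for A
    by (induction A rule: infinite_finite_induct) (use assms in auto)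
  then show ?thesis by (metis mpoly_eq_sum_single)
qed

lemma mpoly_induct [case_names Cst Var add]:
  fixes p :: "('v \<Rightarrow>\<^sub>0 nat) \<Rightarrow>\<^sub>0 'c::comm_ring_1"
  assumes "\<And>c. P (Cst c)" "\<And>v p. P p \<Longrightarrow> P (Var v * p)" "\<And>p q. P p \<Longrightarrow> P q \<Longrightarrow> P (p + q)"
  shows "P p"
proof (induction p rule: mpoly_induct_single)
  case zero
  show ?case using assms(1)[of 0] by simp
next
  case (single m c)
  show ?case
  proof (induction m rule: monomial_induct)
    case zero
    show ?case using assms(1)[of c] by (simp add: Cst_def)
  next
    case (add_var v m)
    show ?case using assms(2)[OF add_var, of v] by (simp add: Cst_Var_mult_single)
  qed
qed (fact assms(3))

text \<open>
  With a linear map \<open>\<kappa>\<close> on the coefficients, this one construction covers substitution, the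
  Mellin transform and the functionals that detect roots.
\<close>

definition lin_ext :: "('c \<Rightarrow> 'a) \<Rightarrow> ('m \<Rightarrow> 'a) \<Rightarrow> ('m \<Rightarrow>\<^sub>0 'c::zero) \<Rightarrow> 'a::comm_ring_1" where
  "lin_ext \<kappa> M p = (\<Sum>m\<in>Poly_Mapping.keys p. \<kappa> (Poly_Mapping.lookup p m) * M m)"

locale additive_coeff =
  fixes \<kappa> :: "'c::comm_ring_1 \<Rightarrow> 'a::comm_ring_1"
  assumes coeff_add: "\<kappa> (a + b) = \<kappa> a + \<kappa> b"
begin

lemma coeff_zero [simp]: "\<kappa> 0 = 0"
  using coeff_add[of 0 0] by simp

lemma lin_ext_superset:
  assumes "finite A" "Poly_Mapping.keys p \<subseteq> A"
  shows "lin_ext \<kappa> M p = (\<Sum>m\<in>A. \<kappa> (Poly_Mapping.lookup p m) * M m)"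
  unfolding lin_ext_def
  by (rule sum.mono_neutral_left) (use assms in \<open>auto simp: in_keys_iff\<close>)

lemma lin_ext_zero [simp]: "lin_ext \<kappa> M 0 = 0"
  by (simp add: lin_ext_def)

lemma lin_ext_add: "lin_ext \<kappa> M (p + q) = lin_ext \<kappa> M p + lin_ext \<kappa> M q"
proof -
  let ?A = "Poly_Mapping.keys p \<union> Poly_Mapping.keys q"
  have "Poly_Mapping.keys (p + q) \<subseteq> ?A" by (rule Poly_Mapping.keys_add)
  then show ?thesis
    by (simp add: lin_ext_superset[of ?A] lookup_add distrib_right coeff_add sum.distrib)
qed

lemma lin_ext_single: "lin_ext \<kappa> M (Poly_Mapping.single m c) = \<kappa> c * M m"
  by (subst lin_ext_superset[of "{m}"]) auto

end

definition poly_subst :: "('c \<Rightarrow> 'a) \<Rightarrow> ('v \<Rightarrow> 'a) \<Rightarrow> (('v \<Rightarrow>\<^sub>0 nat) \<Rightarrow>\<^sub>0 'c::comm_ring_1) \<Rightarrow> 'a::comm_ring_1"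
  where "poly_subst \<kappa> \<sigma> =
    lin_ext \<kappa> (\<lambda>m. \<Prod>v\<in>Poly_Mapping.keys m. \<sigma> v ^ Poly_Mapping.lookup m v)"

lemma monomial_prod_superset:
  fixes \<sigma> :: "'v \<Rightarrow> 'a::comm_monoid_mult"
  assumes "finite B" "Poly_Mapping.keys m \<subseteq> B"
  shows "(\<Prod>v\<in>Poly_Mapping.keys m. \<sigma> v ^ Poly_Mapping.lookup m v) =
    (\<Prod>v\<in>B. \<sigma> v ^ Poly_Mapping.lookup m v)"
  by (rule prod.mono_neutral_left) (use assms in \<open>auto simp: in_keys_iff\<close>)

lemma monomial_prod_add:
  fixes \<sigma> :: "'v \<Rightarrow> 'a::comm_monoid_mult"
  shows "(\<Prod>v\<in>Poly_Mapping.keys (m + n). \<sigma> v ^ Poly_Mapping.lookup (m + n) v) =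
    (\<Prod>v\<in>Poly_Mapping.keys m. \<sigma> v ^ Poly_Mapping.lookup m v) *
    (\<Prod>v\<in>Poly_Mapping.keys n. \<sigma> v ^ Poly_Mapping.lookup n v)"
proof -
  let ?B = "Poly_Mapping.keys m \<union> Poly_Mapping.keys n"
  have B: "Poly_Mapping.keys (m + n) \<subseteq> ?B" by (rule Poly_Mapping.keys_add)
  show ?thesis
    unfolding monomial_prod_superset[of ?B "m + n" \<sigma>, OF _ B, simplified]
      monomial_prod_superset[of ?B m \<sigma>, simplified] monomial_prod_superset[of ?B n \<sigma>, simplified]
    by (simp add: lookup_add power_add prod.distrib)
qed

locale coeff_hom = additive_coeff +
  assumes coeff_mult: "\<kappa> (a * b) = \<kappa> a * \<kappa> b"
    and coeff_one [simp]: "\<kappa> 1 = 1"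
begin

lemma poly_subst_zero [simp]: "poly_subst \<kappa> \<sigma> 0 = 0"
  and poly_subst_add: "poly_subst \<kappa> \<sigma> (p + q) = poly_subst \<kappa> \<sigma> p + poly_subst \<kappa> \<sigma> q"
  by (simp_all add: poly_subst_def lin_ext_add)

lemma poly_subst_Cst [simp]: "poly_subst \<kappa> \<sigma> (Cst c) = \<kappa> c"
  by (simp add: poly_subst_def Cst_def lin_ext_single)

lemma poly_subst_Var [simp]: "poly_subst \<kappa> \<sigma> (Var v) = \<sigma> v"
  by (simp add: poly_subst_def Var_def lin_ext_single)

lemma poly_subst_mult: "poly_subst \<kappa> \<sigma> (p * q) = poly_subst \<kappa> \<sigma> p * poly_subst \<kappa> \<sigma> q"
proof (induction p rule: mpoly_induct_single)
  case (single m c)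
  show ?case
  proof (induction q rule: mpoly_induct_single)
    case (single n d)
    then show ?case
      by (simp add: poly_subst_def mult_single lin_ext_single monomial_prod_add coeff_mult mult_ac)
  qed (simp_all add: poly_subst_add distrib_left)
qed (simp_all add: poly_subst_add distrib_right)

lemma poly_subst_one [simp]: "poly_subst \<kappa> \<sigma> 1 = 1"
  using poly_subst_Cst[of \<sigma> 1] by simp

lemma poly_subst_uminus: "poly_subst \<kappa> \<sigma> (- p) = - poly_subst \<kappa> \<sigma> p"
  using poly_subst_add[of \<sigma> p "- p"] by (simp add: minus_unique)

lemma poly_subst_diff: "poly_subst \<kappa> \<sigma> (p - q) = poly_subst \<kappa> \<sigma> p - poly_subst \<kappa> \<sigma> q"
  using poly_subst_add[of \<sigma> p "- q"] by (simp add: poly_subst_uminus)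

lemma poly_subst_sum: "poly_subst \<kappa> \<sigma> (sum f A) = (\<Sum>a\<in>A. poly_subst \<kappa> \<sigma> (f a))"
  by (induction A rule: infinite_finite_induct) (auto simp: poly_subst_add)

lemma poly_subst_prod: "poly_subst \<kappa> \<sigma> (prod f A) = (\<Prod>a\<in>A. poly_subst \<kappa> \<sigma> (f a))"
  by (induction A rule: infinite_finite_induct) (auto simp: poly_subst_mult)

lemma poly_subst_prod_list: "poly_subst \<kappa> \<sigma> (prod_list xs) = prod_list (map (poly_subst \<kappa> \<sigma>) xs)"
  by (induction xs) (auto simp: poly_subst_mult)

lemma poly_subst_of_nat [simp]: "poly_subst \<kappa> \<sigma> (of_nat n) = of_nat n"
  by (induction n) (auto simp: poly_subst_add)

end

interpretation Cst: coeff_hom "Cst :: complex \<Rightarrow> 'v cpoly"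
  by unfold_locales (simp_all add: Cst_add Cst_mult)

lemma mpderiv_Cst [simp]: "mpderiv k (Cst c) = 0"
  by (simp add: Cst_def mpderiv_single)

lemma mpderiv_one [simp]: "mpderiv k 1 = 0"
  using mpderiv_Cst[of k 1] by simp

lemma mpderiv_Var: "mpderiv k (Var v) = (if k = v then 1 else 0)"
  by (auto simp: Var_def mpderiv_single lookup_single when_def)

lemma mpderiv_uminus: "mpderiv k (- p) = - mpderiv k p"
  using mpderiv_add[of k p "- p"] by (simp add: minus_unique)

lemma mpderiv_diff: "mpderiv k (p - q) = mpderiv k p - mpderiv k q"
  using mpderiv_add[of k p "- q"] by (simp add: mpderiv_uminus)

lemma mpderiv_commute: "mpderiv k (mpderiv l p) = mpderiv l (mpderiv k p)"
  by (induction p rule: mpoly_induct) (auto simp: mpderiv_mult mpderiv_add mpderiv_Var)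

section \<open>Powers of an ideal\<close>

interpretation ring_self: module "(*) :: 'a::comm_ring_1 \<Rightarrow> 'a \<Rightarrow> 'a"
  by unfold_locales (simp_all add: algebra_simps)

declare ring_self.scale_scale [simp del]

lemma ideal_gen_eq_span: "ideal_gen X = ring_self.span X"
  by (simp add: ideal_gen_def)

lemma ideal_gen_set_obtain:
  assumes "a \<in> ideal_gen (set fs)"
  obtains p where "a = (\<Sum>i<length fs. p i * fs ! i)"
proof -
  have "\<exists>p. a = (\<Sum>i<length fs. p i * fs ! i)"
    using assms unfolding ideal_gen_eq_span
  proof (induction rule: ring_self.span_induct_alt)
    case base
    show ?case by (rule exI[of _ "\<lambda>_. 0"]) simp
  next
    case (step c x y)
    then obtain j p where j: "j < length fs" "x = fs ! j" and p: "y = (\<Sum>i<length fs. p i * fs ! i)"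
      by (metis in_set_conv_nth)
    have "c * x = (\<Sum>i<length fs. (if i = j then c else 0) * fs ! i)"
      using j by (simp add: if_distrib[of "\<lambda>x. x * _"] cong: if_cong)
    then have "c * x + y = (\<Sum>i<length fs. ((if i = j then c else 0) + p i) * fs ! i)"
      by (simp add: p distrib_right sum.distrib)
    then show ?case by (intro exI[of _ "\<lambda>i. (if i = j then c else 0) + p i"])
  qed
  with that show thesis by blast
qed

primrec ideal_power :: "'a::comm_ring_1 set \<Rightarrow> nat \<Rightarrow> 'a set" where
  "ideal_power I 0 = UNIV"
| "ideal_power I (Suc k) = ring_self.span {a * b | a b. a \<in> I \<and> b \<in> ideal_power I k}"

declare ideal_power.simps(2) [simp del]

lemma subspace_ideal_power: "ring_self.subspace (ideal_power I k)"
  by (cases k) (auto simp: ideal_power.simps(2) ring_self.subspace_def[of UNIV])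

lemma ideal_power_mult:
  "a \<in> I \<Longrightarrow> b \<in> ideal_power I k \<Longrightarrow> a * b \<in> ideal_power I (Suc k)"
  by (auto simp: ideal_power.simps(2) intro: ring_self.span_base)

lemma ideal_power_mult_left: "m \<in> ideal_power I k \<Longrightarrow> a * m \<in> ideal_power I k"
  by (simp add: subspace_ideal_power ring_self.subspace_scale)


section \<open>The module of delta functions along the graph\<close>

type_synonym 'n tpoly = "('n + nat) cpoly"

abbreviation tau :: "nat \<Rightarrow> 'n tpoly" where
  "tau j \<equiv> Var (Inr j)"

text \<open>
  The \<open>x\<^sub>k\<close> and the \<open>\<tau>\<^sub>j\<close> are put on the same footing, as variables \<open>Inl k\<close> and \<open>Inr j\<close>, so that
  one partial derivative serves for both.
\<close>

definition xlift :: "'n cpoly \<Rightarrow> 'n tpoly" where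
  "xlift = poly_subst Cst (\<lambda>k. Var (Inl k))"

lemma xlift_simps [simp]: "xlift 0 = 0" "xlift 1 = 1" "xlift (Cst c) = Cst c"
    "xlift (Var k) = Var (Inl k)"
  and xlift_add: "xlift (p + q) = xlift p + xlift q"
  and xlift_mult: "xlift (p * q) = xlift p * xlift q"
  and xlift_uminus: "xlift (- p) = - xlift p"
  and xlift_sum: "xlift (sum f A) = (\<Sum>a\<in>A. xlift (f a))"
  by (simp_all add: xlift_def Cst.poly_subst_add Cst.poly_subst_mult Cst.poly_subst_sum
      Cst.poly_subst_uminus)

lemma mpderiv_xlift [simp]: "mpderiv (Inl k) (xlift p) = xlift (mpderiv k p)"
  "mpderiv (Inr j) (xlift p) = 0"
  by (induction p rule: mpoly_induct)
     (auto simp: xlift_add xlift_mult mpderiv_add mpderiv_mult mpderiv_Var)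

definition tmon :: "nat list \<Rightarrow> 'n tpoly" where
  "tmon js = prod_list (map tau js)"

lemma tmon_simps [simp]: "tmon [] = 1" "tmon (j # js) = tau j * tmon js"
    "tmon (is @ js) = tmon is * tmon js"
  by (simp_all add: tmon_def)

text \<open>
  The element \<open>q\<close> stands for \<open>q exp (- \<Sum> f\<^sub>i \<tau>\<^sub>i)\<close>. On such expressions \<open>nabla fs k\<close> is the partial derivative
  in \<open>x\<^sub>k\<close>, \<open>t_act fs i\<close> is \<open>- \<partial>/\<partial>\<tau>\<^sub>i\<close>, and \<open>s_act\<close> is \<open>- \<Sum> \<tau>\<^sub>i t\<^sub>i\<close>, which corresponds to \<open>\<Sum> s\<^sub>i\<close>.
\<close>

definition nabla :: "'n cpoly list \<Rightarrow> 'n \<Rightarrow> 'n tpoly \<Rightarrow> 'n tpoly" where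
  "nabla fs k q = mpderiv (Inl k) q - (\<Sum>i<length fs. xlift (mpderiv k (fs ! i)) * tau i) * q"

definition t_act :: "'n cpoly list \<Rightarrow> nat \<Rightarrow> 'n tpoly \<Rightarrow> 'n tpoly" where
  "t_act fs i q = xlift (fs ! i) * q - mpderiv (Inr i) q"

definition s_act :: "'n cpoly list \<Rightarrow> 'n tpoly \<Rightarrow> 'n tpoly" where
  "s_act fs q = - (\<Sum>i<length fs. tau i * t_act fs i q)"

definition b_act :: "'n cpoly list \<Rightarrow> complex poly \<Rightarrow> 'n tpoly" where
  "b_act fs b = (\<Sum>n\<le>degree b. Cst (coeff b n) * (s_act fs ^^ n) 1)"

lemma nabla_add: "nabla fs k (p + q) = nabla fs k p + nabla fs k q"
  by (simp add: nabla_def mpderiv_add distrib_left)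

lemma nabla_xlift_mult:
  "nabla fs k (xlift p * q) = xlift (mpderiv k p) * q + xlift p * nabla fs k q"
  by (simp add: nabla_def mpderiv_mult right_diff_distrib mult.left_commute)

lemma nabla_tau_mult: "nabla fs k (tau j * q) = tau j * nabla fs k q"
  by (simp add: nabla_def mpderiv_mult mpderiv_Var right_diff_distrib mult.left_commute)

lemma t_act_add: "t_act fs i (p + q) = t_act fs i p + t_act fs i q"
  by (simp add: t_act_def mpderiv_add algebra_simps)

lemma nabla_t_act:
  assumes "i < length fs"
  shows "nabla fs k (t_act fs i q) = t_act fs i (nabla fs k q)"
proof -
  define G where "G = (\<Sum>i<length fs. xlift (mpderiv k (fs ! i)) * tau i)"
  have "mpderiv (Inr i) G = xlift (mpderiv k (fs ! i))"
    using assms by (simp add: G_def mpderiv_sum mpderiv_mult mpderiv_Var if_distrib cong: if_cong)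
  then show ?thesis
    unfolding nabla_def t_act_def G_def[symmetric]
    by (simp add: mpderiv_mult mpderiv_diff mpderiv_commute[of "Inl k" "Inr i"] distrib_left
        right_diff_distrib mult_ac)
qed

text \<open>
  The elements of weight at least \<open>k\<close>: an element of the ideal has weight 1, each \<open>\<tau>\<^sub>j\<close> has weight -1.
  The set depends on the generators only through the ideal \<open>I\<close> and the number of the \<open>\<tau>\<^sub>j\<close>.
\<close>

inductive_set weight_span :: "'n cpoly set \<Rightarrow> nat \<Rightarrow> nat \<Rightarrow> 'n tpoly set"
  for I :: "'n cpoly set" and r k :: nat where
  base: "m \<in> ideal_power I (length js + k) \<Longrightarrow> set js \<subseteq> {..<r} \<Longrightarrow>
     xlift m * tmon js \<in> weight_span I r k"
| add: "p \<in> weight_span I r k \<Longrightarrow> q \<in> weight_span I r k \<Longrightarrow> p + q \<in> weight_span I r k"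

lemma weight_span_zero [simp]: "0 \<in> weight_span I r k"
  using weight_span.base[of 0 I "[]" k r]
  by (simp add: subspace_ideal_power ring_self.subspace_0)

lemma weight_span_sum:
  "(\<And>a. a \<in> A \<Longrightarrow> f a \<in> weight_span I r k) \<Longrightarrow> sum f A \<in> weight_span I r k"
  by (induction A rule: infinite_finite_induct) (auto intro: weight_span.add)

lemma weight_span_xlift_mult: "q \<in> weight_span I r k \<Longrightarrow> xlift p * q \<in> weight_span I r k"
proof (induction rule: weight_span.induct)
  case (base m js)
  then have "xlift (p * m) * tmon js \<in> weight_span I r k"
    by (intro weight_span.base ideal_power_mult_left)
  then show ?case by (simp only: xlift_mult mult.assoc)
qed (auto simp: distrib_left intro: weight_span.add)

lemma weight_span_tau_mult:
  assumes "q \<in> weight_span I r (Suc k)" "j < r"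
  shows "tau j * q \<in> weight_span I r k"
  using assms(1)
proof (induction rule: weight_span.induct)
  case (base m js)
  then show ?case
    using weight_span.base[of m I "j # js" k r] assms(2) by (simp add: mult_ac)
qed (auto simp: distrib_left intro: weight_span.add)

text \<open>
  The derivative is exhibited as a sum of monomials of degree one less, because both the weight and
  the degree have to be followed.
\<close>

lemma deriv_tmon_obtain:
  obtains kss where "mpderiv (Inr i) (tmon js :: 'n tpoly) = sum_list (map tmon kss)"
    "\<And>ks. ks \<in> set kss \<Longrightarrow> Suc (length ks) = length js \<and> set ks \<subseteq> set js"
proof -
  have "\<exists>kss. mpderiv (Inr i) (tmon js :: 'n tpoly) = sum_list (map tmon kss) \<and>
      (\<forall>ks\<in>set kss. Suc (length ks) = length js \<and> set ks \<subseteq> set js)"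
  proof (induction js)
    case (Cons j js)
    then obtain kss where kss: "mpderiv (Inr i) (tmon js :: 'n tpoly) = sum_list (map tmon kss)"
      "\<forall>ks\<in>set kss. Suc (length ks) = length js \<and> set ks \<subseteq> set js" by blast
    have "(tau j :: 'n tpoly) * sum_list (map tmon kss) = sum_list (map tmon (map ((#) j) kss))"
      by (induction kss) (auto simp: distrib_left)
    then show ?case using kss
      by (intro exI[of _ "(if i = j then [js] else []) @ map ((#) j) kss"])
         (auto simp: mpderiv_mult mpderiv_Var)
  qed (auto intro: exI[of _ "[]"])
  with that show thesis by blast
qed

lemma weight_span_deriv_tmon:
  fixes m :: "'n cpoly"
  assumes "m \<in> ideal_power I (length js + k)" and "set js \<subseteq> {..<r}"
  shows "xlift m * mpderiv (Inr i) (tmon js) \<in> weight_span I r (Suc k)"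
proof -
  obtain kss where kss: "mpderiv (Inr i) (tmon js :: 'n tpoly) = sum_list (map tmon kss)"
    "\<And>ks. ks \<in> set kss \<Longrightarrow> Suc (length ks) = length js \<and> set ks \<subseteq> set js"
    using deriv_tmon_obtain by blast
  have "xlift m * tmon ks \<in> weight_span I r (Suc k)" if "ks \<in> set kss" for ks
  proof (rule weight_span.base)
    have "length ks + Suc k = length js + k" using kss(2)[OF that] by simp
    then show "m \<in> ideal_power I (length ks + Suc k)" using assms(1) by (simp only:)
  qed (use kss(2)[OF that] assms(2) in auto)
  then show ?thesis
    unfolding kss(1) by (induction kss) (auto simp: distrib_left intro: weight_span.add)
qed

lemma weight_span_uminus: "q \<in> weight_span I r k \<Longrightarrow> - q \<in> weight_span I r k"
  using weight_span_xlift_mult[of q I r k "- 1"] by (simp add: xlift_uminus)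

lemma weight_span_t_act:
  assumes "q \<in> weight_span (ideal_gen (set fs)) r k" "i < length fs"
  shows "t_act fs i q \<in> weight_span (ideal_gen (set fs)) r (Suc k)"
  using assms(1)
proof (induction rule: weight_span.induct)
  case (base m js)
  have "fs ! i \<in> ideal_gen (set fs)"
    using assms(2) by (simp add: ideal_gen_eq_span ring_self.span_base)
  then have "fs ! i * m \<in> ideal_power (ideal_gen (set fs)) (length js + Suc k)"
    using ideal_power_mult base by fastforce
  then have "xlift (fs ! i * m) * tmon js \<in> weight_span (ideal_gen (set fs)) r (Suc k)"
    using base by (intro weight_span.base)
  moreover have "- (xlift m * mpderiv (Inr i) (tmon js)) \<in> weight_span (ideal_gen (set fs)) r (Suc k)"
    using weight_span_deriv_tmon base by (intro weight_span_uminus)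
  ultimately have "xlift (fs ! i * m) * tmon js + - (xlift m * mpderiv (Inr i) (tmon js))
      \<in> weight_span (ideal_gen (set fs)) r (Suc k)"
    by (rule weight_span.add)
  then show ?case by (simp add: t_act_def mpderiv_mult xlift_mult algebra_simps)
qed (auto simp: t_act_add intro: weight_span.add)

text \<open>
  The \<open>D\<close>-module generated by the elements of weight at least \<open>k\<close>, a piece of the V-filtration along \<open>t = 0\<close>.
  Closure under multiplication by polynomials in \<open>x\<close> is a consequence of the Leibniz rule
  (\<open>vfilt_xlift_mult\<close>), so that the induction principle only has the derivations to consider.
\<close>

inductive_set vfilt :: "'n cpoly list \<Rightarrow> nat \<Rightarrow> 'n tpoly set"
  for fs :: "'n cpoly list" and k :: nat where
  base: "q \<in> weight_span (ideal_gen (set fs)) (length fs) k \<Longrightarrow> q \<in> vfilt fs k"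
| add: "p \<in> vfilt fs k \<Longrightarrow> q \<in> vfilt fs k \<Longrightarrow> p + q \<in> vfilt fs k"
| nabla: "q \<in> vfilt fs k \<Longrightarrow> nabla fs l q \<in> vfilt fs k"

lemma vfilt_zero [simp]: "0 \<in> vfilt fs k"
  by (rule vfilt.base) simp

lemma vfilt_sum: "(\<And>a. a \<in> A \<Longrightarrow> f a \<in> vfilt fs k) \<Longrightarrow> sum f A \<in> vfilt fs k"
  by (induction A rule: infinite_finite_induct) (auto intro: vfilt.add)

lemma vfilt_xlift_mult: "q \<in> vfilt fs k \<Longrightarrow> xlift p * q \<in> vfilt fs k"
proof (induction arbitrary: p rule: vfilt.induct)
  case (nabla q l)
  have "xlift p * nabla fs l q = nabla fs l (xlift p * q) + xlift (- mpderiv l p) * q"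
    by (simp add: nabla_xlift_mult xlift_uminus)
  with nabla show ?case by (auto intro: vfilt.add vfilt.nabla)
qed (auto simp: distrib_left intro: vfilt.base vfilt.add weight_span_xlift_mult)

lemma vfilt_uminus: "q \<in> vfilt fs k \<Longrightarrow> - q \<in> vfilt fs k"
  using vfilt_xlift_mult[of q fs k "- 1"] by (simp add: xlift_uminus)

lemma vfilt_tau_mult: "q \<in> vfilt fs (Suc k) \<Longrightarrow> j < length fs \<Longrightarrow> tau j * q \<in> vfilt fs k"
  by (induction rule: vfilt.induct)
     (auto simp: distrib_left nabla_tau_mult[symmetric] intro: vfilt.intros weight_span_tau_mult)

lemma vfilt_t_act: "q \<in> vfilt fs k \<Longrightarrow> i < length fs \<Longrightarrow> t_act fs i q \<in> vfilt fs (Suc k)"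
  by (induction rule: vfilt.induct)
     (auto simp: t_act_add nabla_t_act[symmetric] intro: vfilt.intros weight_span_t_act)


section \<open>Independence of the generators\<close>

text \<open>
  The substitution \<open>\<tau>\<^sub>i \<mapsto> \<Sum>\<^sub>j p\<^sub>j\<^sub>i \<tau>\<^sub>j\<close> takes \<open>\<Sum> f\<^sub>i \<tau>\<^sub>i\<close> to \<open>\<Sum> g\<^sub>j \<tau>\<^sub>j\<close>, hence \<open>q exp (- \<Sum> f\<^sub>i \<tau>\<^sub>i)\<close> to an expression
  of the same kind for \<open>g\<close>. It commutes with \<open>\<Sum> s\<^sub>i\<close>, and with the derivations in \<open>x\<close> up to terms in which some
  \<open>\<tau>\<^sub>j t\<^sub>i\<close> occurs, which has weight 0.
\<close>

locale change_of_generators =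
  fixes fs gs :: "'n cpoly list" and p :: "nat \<Rightarrow> nat \<Rightarrow> 'n cpoly"
  assumes generators: "j < length gs \<Longrightarrow> gs ! j = (\<Sum>i<length fs. p j i * fs ! i)"
    and same_ideal: "ideal_gen (set fs) = ideal_gen (set gs)"
begin

text \<open>
  The \<open>\<tau>\<^sub>i\<close> beyond the list of generators go to 0, so that the chain rule holds on all of \<open>N\<close> with a finite sum.
\<close>

definition new_tau :: "nat \<Rightarrow> 'n tpoly" where
  "new_tau i = (if i < length fs then \<Sum>j<length gs. xlift (p j i) * tau j else 0)"

definition change :: "'n tpoly \<Rightarrow> 'n tpoly" where
  "change = poly_subst Cst (case_sum (\<lambda>k. Var (Inl k)) new_tau)"

lemma change_simps [simp]: "change 0 = 0" "change 1 = 1" "change (Cst c) = Cst c"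
    "change (Var (Inl k)) = Var (Inl k)" "change (tau i) = new_tau i"
  and change_add: "change (q + q') = change q + change q'"
  and change_mult: "change (q * q') = change q * change q'"
  and change_uminus: "change (- q) = - change q"
  and change_diff: "change (q - q') = change q - change q'"
  and change_sum: "change (sum h A) = (\<Sum>a\<in>A. change (h a))"
  by (simp_all add: change_def Cst.poly_subst_add Cst.poly_subst_mult Cst.poly_subst_sum
      Cst.poly_subst_diff Cst.poly_subst_uminus)

lemma change_xlift [simp]: "change (xlift q) = xlift q"
  by (induction q rule: mpoly_induct) (auto simp: xlift_add xlift_mult change_add change_mult)

text \<open>
  The chain rule. As \<open>x\<close> is kept, a derivative in \<open>x\<close> has an additional direct term.
\<close>

lemma mpderiv_change:
  "mpderiv v (change q) = (case v of Inl k \<Rightarrow> change (mpderiv v q) | Inr j \<Rightarrow> 0) +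
     (\<Sum>i<length fs. change (mpderiv (Inr i) q) * mpderiv v (new_tau i))"
proof (induction q rule: mpoly_induct)
  case (Var u q)
  have "change (mpderiv (Inr i) (Var u * q)) = (if u = Inr i then change q else 0)
      + change (Var u) * change (mpderiv (Inr i) q)" for i
    by (auto simp: mpderiv_mult mpderiv_Var change_add change_mult)
  then have 1: "(\<Sum>i<length fs. change (mpderiv (Inr i) (Var u * q)) * mpderiv v (new_tau i)) =
      (\<Sum>i<length fs. (if u = Inr i then change q else 0) * mpderiv v (new_tau i))
      + change (Var u) * (\<Sum>i<length fs. change (mpderiv (Inr i) q) * mpderiv v (new_tau i))"
    by (simp add: distrib_right sum.distrib sum_distrib_left mult.assoc)
  have 2: "(\<Sum>i<length fs. (if u = Inr i then change q else 0) * mpderiv v (new_tau i)) =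
      (case u of Inl k \<Rightarrow> 0 | Inr i \<Rightarrow> change q * mpderiv v (new_tau i))"
    by (cases u) (auto simp: new_tau_def if_distrib[of "\<lambda>x. x * _"] cong: if_cong)
  have 3: "mpderiv v (change (Var u * q)) = mpderiv v (change (Var u)) * change q
      + change (Var u) * mpderiv v (change q)"
    by (simp add: change_mult mpderiv_mult)
  show ?case
    unfolding 1 2 3 Var
    by (cases v; cases u) (auto simp: mpderiv_mult mpderiv_Var change_mult change_add algebra_simps)
qed (auto simp: mpderiv_add change_add distrib_right sum.distrib split: sum.split)

lemma mpderiv_tau_change:
  assumes "j < length gs"
  shows "mpderiv (Inr j) (change q) = (\<Sum>i<length fs. xlift (p j i) * change (mpderiv (Inr i) q))"
proof -
  have "mpderiv (Inr j) (new_tau i) = xlift (p j i)" if "i < length fs" for i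
    using that assms
    by (simp add: new_tau_def mpderiv_sum mpderiv_mult mpderiv_Var if_distrib cong: if_cong)
  then show ?thesis by (simp add: mpderiv_change mult.commute)
qed

lemma sum_new_tau: "(\<Sum>i<length fs. new_tau i * h i) =
    (\<Sum>j<length gs. tau j * (\<Sum>i<length fs. xlift (p j i) * h i))"
  unfolding new_tau_def sum_distrib_left
  by (subst sum.swap) (simp add: sum_distrib_right sum_distrib_left mult_ac)

text \<open>
  On \<open>N\<close>, \<open>- \<Sum> \<tau>\<^sub>i t\<^sub>i\<close> is the Euler field in \<open>\<tau>\<close> minus multiplication by \<open>\<Sum> f\<^sub>i \<tau>\<^sub>i\<close>, and both parts are
  respected by a linear substitution in \<open>\<tau>\<close> that matches \<open>f\<close> with \<open>g\<close>.
\<close>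

lemma change_s_act: "change (s_act fs q) = s_act gs (change q)"
proof -
  have "(\<Sum>i<length fs. new_tau i * change (t_act fs i q)) =
      (\<Sum>j<length gs. tau j * (\<Sum>i<length fs. xlift (p j i) * change (t_act fs i q)))"
    by (rule sum_new_tau)
  also have "\<dots> = (\<Sum>j<length gs. tau j * t_act gs j (change q))"
  proof (intro sum.cong arg_cong[of _ _ "(*) _"])
    fix j assume "j \<in> {..<length gs}"
    then show "(\<Sum>i<length fs. xlift (p j i) * change (t_act fs i q)) = t_act gs j (change q)"
      by (simp add: t_act_def change_diff change_mult mpderiv_tau_change generators xlift_sum
          xlift_mult right_diff_distrib sum_subtractf sum_distrib_right mult.assoc)
  qed simp
  finally show ?thesis by (simp add: s_act_def change_uminus change_sum change_mult)
qed

lemma change_b_act: "change (b_act fs b) = b_act gs b"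
proof -
  have "change ((s_act fs ^^ n) 1) = (s_act gs ^^ n) 1" for n
    by (induction n) (auto simp: change_s_act)
  then show ?thesis by (simp add: b_act_def change_sum change_mult)
qed

text \<open>
  The correction comes from the \<open>x\<close>-dependence of the coefficients \<open>p\<^sub>j\<^sub>i\<close>.
\<close>

lemma change_nabla:
  "change (nabla fs k q) = nabla gs k (change q)
     + (\<Sum>i<length fs. (\<Sum>j<length gs. xlift (mpderiv k (p j i)) * tau j) * change (t_act fs i q))"
proof -
  let ?e = "\<lambda>i. \<Sum>j<length gs. xlift (mpderiv k (p j i)) * tau j"
  have new: "mpderiv (Inl k) (new_tau i) = ?e i" if "i < length fs" for i
    using that by (simp add: new_tau_def mpderiv_sum mpderiv_mult mpderiv_Var)
  have "(\<Sum>j<length gs. xlift (mpderiv k (gs ! j)) * tau j) =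
      (\<Sum>j<length gs. \<Sum>i<length fs. (xlift (mpderiv k (p j i)) * xlift (fs ! i)
         + xlift (p j i) * xlift (mpderiv k (fs ! i))) * tau j)"
    by (simp add: generators mpderiv_sum mpderiv_mult xlift_sum xlift_add xlift_mult sum_distrib_right)
  also have "\<dots> = (\<Sum>i<length fs. \<Sum>j<length gs. (xlift (mpderiv k (p j i)) * xlift (fs ! i)
         + xlift (p j i) * xlift (mpderiv k (fs ! i))) * tau j)"
    by (rule sum.swap)
  also have "\<dots> = (\<Sum>i<length fs. ?e i * xlift (fs ! i) + xlift (mpderiv k (fs ! i)) * new_tau i)"
    by (intro sum.cong)
       (auto simp: new_tau_def distrib_left distrib_right sum.distrib sum_distrib_left
         sum_distrib_right mult_ac)
  finally have G: "(\<Sum>j<length gs. xlift (mpderiv k (gs ! j)) * tau j) =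
      (\<Sum>i<length fs. ?e i * xlift (fs ! i)) + (\<Sum>i<length fs. xlift (mpderiv k (fs ! i)) * new_tau i)"
    by (simp add: sum.distrib)
  have "mpderiv (Inl k) (change q) =
      change (mpderiv (Inl k) q) + (\<Sum>i<length fs. ?e i * change (mpderiv (Inr i) q))"
    by (simp add: mpderiv_change new mult.commute)
  then show ?thesis
    unfolding nabla_def G
    by (simp add: change_diff change_mult change_sum t_act_def algebra_simps sum_distrib_left
        sum_distrib_right sum.distrib sum_subtractf)
qed

lemma change_weight_span_monomial:
  assumes "m \<in> ideal_power I (length is + length js + k)" "set is \<subseteq> {..<length gs}"
  shows "xlift m * tmon is * prod_list (map new_tau js) \<in> weight_span I (length gs) k"
  using assms
proof (induction js arbitrary: m "is")
  case Nil
  then show ?case by (simp add: weight_span.base)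
next
  case (Cons i js)
  have "xlift m * tmon is * prod_list (map new_tau (i # js)) =
     (if i < length fs then \<Sum>j<length gs. xlift (p j i * m) * tmon (j # is) * prod_list (map new_tau js)
      else 0)"
    by (simp add: new_tau_def sum_distrib_left sum_distrib_right xlift_mult mult_ac)
  moreover have "xlift (p j i * m) * tmon (j # is) * prod_list (map new_tau js)
      \<in> weight_span I (length gs) k" if "j < length gs" for j
    using Cons.prems that by (intro Cons.IH ideal_power_mult_left) auto
  ultimately show ?case by (auto intro: weight_span_sum)
qed

lemma change_weight_span: "q \<in> weight_span I r k \<Longrightarrow> change q \<in> weight_span I (length gs) k"
proof (induction rule: weight_span.induct)
  case (base m js)
  have "change (tmon js) = prod_list (map new_tau js)"
    by (induction js) (auto simp: change_mult)
  with change_weight_span_monomial[of m I "[]" js k] base show ?case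
    by (simp add: change_mult)
qed (auto simp: change_add intro: weight_span.add)

text \<open>
  The correction term of \<open>change_nabla\<close> contains \<open>t\<^sub>i q\<close>, one step deeper in the filtration, followed by a
  multiplication by \<open>\<tau>\<^sub>j\<close>, which leads back. Hence the induction is over all iterated images under the \<open>t\<^sub>i\<close> at once.
\<close>

lemma change_vfilt_t_act:
  assumes "q \<in> vfilt fs k" "set is \<subseteq> {..<length fs}"
  shows "change (foldr (t_act fs) is q) \<in> vfilt gs (k + length is)"
  using assms
proof (induction arbitrary: "is" rule: vfilt.induct)
  case (base q)
  from base(2) have "foldr (t_act fs) is q \<in> weight_span (ideal_gen (set fs)) (length fs) (k + length is)"
    using base(1) by (induction "is") (auto intro: weight_span_t_act)
  then show ?case
    using change_weight_span same_ideal by (metis vfilt.base)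
next
  case (add q q')
  have "foldr (t_act fs) is (q + q') = foldr (t_act fs) is q + foldr (t_act fs) is q'"
    by (induction "is") (auto simp: t_act_add)
  with add show ?case by (auto simp: change_add intro: vfilt.add)
next
  case (nabla q l)
  have "foldr (t_act fs) is (nabla fs l q) = nabla fs l (foldr (t_act fs) is q)"
    using nabla.prems by (induction "is") (auto simp: nabla_t_act)
  moreover have "change (t_act fs i (foldr (t_act fs) is q)) \<in> vfilt gs (Suc (k + length is))"
    if "i < length fs" for i
    using nabla.IH[of "i # is"] nabla.prems that by simp
  then have "(\<Sum>i<length fs. \<Sum>j<length gs. xlift (mpderiv l (p j i)) *
      (tau j * change (t_act fs i (foldr (t_act fs) is q)))) \<in> vfilt gs (k + length is)"
    by (intro vfilt_sum vfilt_xlift_mult vfilt_tau_mult) auto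
  ultimately show ?case
    using nabla.IH[OF nabla.prems]
    by (auto simp: change_nabla sum_distrib_right mult.assoc intro!: vfilt.add vfilt.nabla)
qed

end

theorem b_act_vfilt_independent:
  assumes "ideal_gen (set fs) = ideal_gen (set gs)" "b_act fs b \<in> vfilt fs k"
  shows "b_act gs b \<in> vfilt gs k"
proof -
  have "\<exists>p. gs ! j = (\<Sum>i<length fs. p i * fs ! i)" if "j < length gs" for j
  proof -
    have "gs ! j \<in> ideal_gen (set fs)"
      using that unfolding assms(1) by (simp add: ideal_gen_eq_span ring_self.span_base)
    then show ?thesis by (metis ideal_gen_set_obtain)
  qed
  then obtain p where "\<And>j. j < length gs \<Longrightarrow> gs ! j = (\<Sum>i<length fs. p j i * fs ! i)"
    by metis
  then interpret change_of_generators fs gs p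
    using assms(1) by unfold_locales
  show ?thesis
    using change_vfilt_t_act[OF assms(2), of "[]"] by (simp add: change_b_act)
qed

section \<open>The Mellin transform\<close>

lemma rat_const_eq_Cst: "rat_const = Cst"
  and s_var_eq_Var: "s_var = Var"
  by (auto simp: rat_const_def Cst_def s_var_def Var_def)

interpretation poly_const: coeff_hom "poly_const :: 'n::linorder cpoly \<Rightarrow> 'n fs_module"
proof
  fix a b :: "'n cpoly"
  show "poly_const (a + b) = poly_const a + poly_const b"
    by (simp add: poly_const_def rat_const_def flip: single_add)
qed (simp_all add: poly_const_def rat_const_def mult_single flip: One_fract_def)

lemma complex_const_eq: "complex_const c = poly_const (Cst c)"
  by (simp add: complex_const_def Cst_def)

interpretation complex_const: coeff_hom "complex_const :: complex \<Rightarrow> 'n::linorder fs_module"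
  by unfold_locales
     (simp_all add: complex_const_eq Cst_add Cst_mult poly_const.coeff_add poly_const.coeff_mult)

lemma single_eq_zero: "Poly_Mapping.single m c = 0 \<longleftrightarrow> c = 0"
  by (metis lookup_single_eq lookup_zero single_zero)

lemma poly_const_eq_zero: "poly_const p = 0 \<longleftrightarrow> p = 0"
  unfolding poly_const_def rat_const_def single_eq_zero Zero_fract_def by (simp add: eq_fract)

lemma complex_const_eq_zero: "complex_const c = 0 \<longleftrightarrow> c = 0"
  by (simp add: complex_const_eq poly_const_eq_zero Cst_def single_eq_zero)

lemma s_shift_poly_const [simp]: "s_shift j c (poly_const p) = poly_const p"
  and s_shift_complex_const [simp]: "s_shift j c (complex_const z) = complex_const z"
  by (simp_all add: poly_const_def complex_const_def)

lemma s_shift_zero [simp]: "s_shift j c 0 = 0"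
  using s_shift_of_int[of j c 0] by simp

lemma s_shift_uminus: "s_shift j c (- h) = - s_shift j c h"
  using s_shift_add[of j c h "- h"] by (simp add: minus_unique)

lemma s_shift_diff: "s_shift j c (g - h) = s_shift j c g - s_shift j c h"
  using s_shift_add[of j c g "- h"] by (simp add: s_shift_uminus)

lemma s_shift_of_nat [simp]: "s_shift j c (of_nat n) = of_nat n"
  using s_shift_of_int[of j c "int n"] by (simp only: of_int_of_nat_eq)

lemma rat_deriv_Fract:
  "q \<noteq> 0 \<Longrightarrow> rat_deriv k (Fract p q) = Fract (mpderiv k p * q - p * mpderiv k q) (q * q)"
  by (simp add: Fract_def rat_deriv.abs_eq fractrel_def)

lemma rat_deriv_add: "rat_deriv k (a + b) = rat_deriv k a + rat_deriv k b"
proof (cases a; cases b)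
  fix p q p' q' :: "'a cpoly"
  assume "a = Fract p q" "q \<noteq> 0" "b = Fract p' q'" "q' \<noteq> 0"
  then show ?thesis
    by (simp add: rat_deriv_Fract mpderiv_add mpderiv_mult eq_fract algebra_simps)
qed

lemma rat_deriv_mult: "rat_deriv k (a * b) = rat_deriv k a * b + a * rat_deriv k b"
proof (cases a; cases b)
  fix p q p' q' :: "'a cpoly"
  assume "a = Fract p q" "q \<noteq> 0" "b = Fract p' q'" "q' \<noteq> 0"
  then show ?thesis
    by (simp add: rat_deriv_Fract mpderiv_mult eq_fract algebra_simps)
qed

lemma rat_deriv_zero [simp]: "rat_deriv k 0 = 0"
  using rat_deriv_add[of k 0 0] by (metis add.right_neutral add_left_cancel)

lemma rat_deriv_Fract_one: "rat_deriv k (Fract p 1) = Fract (mpderiv k p) 1"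
  by (simp add: rat_deriv_Fract)

lemma rat_deriv_inverse:
  "q \<noteq> 0 \<Longrightarrow> rat_deriv k (Fract 1 q) = - (Fract (mpderiv k q) q * Fract 1 q)"
  by (simp add: rat_deriv_Fract)

definition coeff_deriv :: "'n::linorder \<Rightarrow> 'n fs_module \<Rightarrow> 'n fs_module" where
  "coeff_deriv k h = Poly_Mapping.map (rat_deriv k) h"

lemma coeff_deriv_add: "coeff_deriv k (g + h) = coeff_deriv k g + coeff_deriv k h"
  by (rule poly_mapping_eqI)
     (auto simp: coeff_deriv_def map.rep_eq lookup_add rat_deriv_add when_def
        simp flip: rat_deriv_add)

lemma coeff_deriv_single:
  "coeff_deriv k (Poly_Mapping.single m c) = Poly_Mapping.single m (rat_deriv k c)"
  by (simp add: coeff_deriv_def)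

lemma coeff_deriv_zero [simp]: "coeff_deriv k 0 = 0"
  using coeff_deriv_add[of k 0 0] by (metis add.right_neutral add_left_cancel)

lemma coeff_deriv_uminus: "coeff_deriv k (- h) = - coeff_deriv k h"
  using coeff_deriv_add[of k h "- h"] by (simp add: minus_unique)

lemma coeff_deriv_mult:
  "coeff_deriv k (g * h) = coeff_deriv k g * h + g * coeff_deriv k h"
proof (induction g rule: mpoly_induct_single)
  case (single m c)
  show ?case
    by (induction h rule: mpoly_induct_single)
       (auto simp: mult_single coeff_deriv_single coeff_deriv_add rat_deriv_mult single_add
         distrib_left)
qed (auto simp: coeff_deriv_add distrib_right)

lemma coeff_deriv_s_var [simp]: "coeff_deriv k (s_var j) = 0"
  using rat_deriv_Fract_one[of k 1]
  by (simp add: s_var_def coeff_deriv_single flip: One_fract_def Zero_fract_def)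

lemma coeff_deriv_rat_const [simp]: "coeff_deriv k (rat_const c) = rat_const (rat_deriv k c)"
  by (simp add: rat_const_def coeff_deriv_single)

lemma coeff_deriv_poly_const [simp]: "coeff_deriv k (poly_const p) = poly_const (mpderiv k p)"
  by (simp add: poly_const_def rat_deriv_Fract_one)

lemma coeff_deriv_complex_const [simp]: "coeff_deriv k (complex_const c) = 0"
  by (simp add: complex_const_eq)

lemma coeff_deriv_one [simp]: "coeff_deriv k 1 = 0"
  using coeff_deriv_complex_const[of k 1] by simp

lemma coeff_deriv_of_int [simp]: "coeff_deriv k (of_int c) = 0"
proof -
  have nat: "coeff_deriv k (of_nat n) = 0" for n
    by (induction n) (auto simp: coeff_deriv_add)
  show ?thesis
    by (cases c rule: int_cases2) (simp_all add: nat coeff_deriv_uminus)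
qed

lemma coeff_deriv_s_shift: "coeff_deriv k (s_shift j c h) = s_shift j c (coeff_deriv k h)"
proof (induction h rule: mpoly_induct)
  case (Cst c)
  then show ?case by (simp flip: rat_const_eq_Cst)
next
  case (Var i h)
  have "coeff_deriv k (s_shift j c (s_var i)) = 0"
    by (simp add: s_shift_s_var coeff_deriv_add del: of_int_1 of_int_minus of_int_numeral)
  with Var show ?case
    by (simp add: s_shift_mult coeff_deriv_mult flip: s_var_eq_Var)
qed (auto simp: s_shift_add coeff_deriv_add)

text \<open>
  \<open>tau_op F j\<close> is \<open>- s\<^sub>j t\<^sub>j\<^sup>-\<^sup>1\<close> and \<open>shift_op F j\<close> is \<open>t\<^sub>j\<close>, for an arbitrary sequence \<open>F\<close> of generators. They are the
  images of \<open>\<tau>\<^sub>j\<close> and of \<open>F\<^sub>j - \<partial>/\<partial>\<tau>\<^sub>j\<close> under the Mellin transform.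
\<close>

definition tau_op :: "(nat \<Rightarrow> 'n::linorder cpoly) \<Rightarrow> nat \<Rightarrow> 'n fs_module \<Rightarrow> 'n fs_module" where
  "tau_op F j h = - s_var j * (s_shift j (-1) h * rat_const (Fract 1 (F j)))"

definition shift_op :: "(nat \<Rightarrow> 'n::linorder cpoly) \<Rightarrow> nat \<Rightarrow> 'n fs_module \<Rightarrow> 'n fs_module" where
  "shift_op F j h = s_shift j 1 h * poly_const (F j)"

text \<open>
  The image of \<open>\<tau>\<^sub>j\<^sup>n\<close>, that is \<open>(-1)\<^sup>n s\<^sub>j (s\<^sub>j - 1) \<cdots> (s\<^sub>j - n + 1) / F\<^sub>j\<^sup>n\<close>.
\<close>

definition fall :: "(nat \<Rightarrow> 'n::linorder cpoly) \<Rightarrow> nat \<Rightarrow> nat \<Rightarrow> 'n fs_module" where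
  "fall F j n = (\<Prod>a<n. (of_nat a - s_var j) * rat_const (Fract 1 (F j)))"

definition mellin_monomial ::
    "(nat \<Rightarrow> 'n::linorder cpoly) \<Rightarrow> ('n + nat \<Rightarrow>\<^sub>0 nat) \<Rightarrow> 'n fs_module" where
  "mellin_monomial F m = (\<Prod>v\<in>Poly_Mapping.keys m. case v of
     Inl k \<Rightarrow> poly_const (Var k) ^ Poly_Mapping.lookup m v
   | Inr j \<Rightarrow> fall F j (Poly_Mapping.lookup m v))"

definition mellin :: "(nat \<Rightarrow> 'n::linorder cpoly) \<Rightarrow> 'n tpoly \<Rightarrow> 'n fs_module" where
  "mellin F = lin_ext complex_const (mellin_monomial F)"

lemma mellin_zero [simp]: "mellin F 0 = 0"
  and mellin_add: "mellin F (p + q) = mellin F p + mellin F q"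
  by (simp_all add: mellin_def complex_const.lin_ext_add)

lemma mellin_uminus: "mellin F (- p) = - mellin F p"
  using mellin_add[of F p "- p"] by (simp add: minus_unique)

lemma mellin_diff: "mellin F (p - q) = mellin F p - mellin F q"
  using mellin_add[of F p "- q"] by (simp add: mellin_uminus)

lemma mellin_sum: "mellin F (sum f A) = (\<Sum>a\<in>A. mellin F (f a))"
  by (induction A rule: infinite_finite_induct) (auto simp: mellin_add)

lemma mellin_Cst [simp]: "mellin F (Cst c) = complex_const c"
  by (simp add: mellin_def Cst_def complex_const.lin_ext_single mellin_monomial_def)

lemma mellin_one [simp]: "mellin F 1 = 1"
  using mellin_Cst[of F 1] by simp

lemma tau_op_add: "tau_op F j (g + h) = tau_op F j g + tau_op F j h"
  by (simp add: tau_op_def s_shift_add algebra_simps)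

lemma tau_op_zero [simp]: "tau_op F j 0 = 0"
  by (simp add: tau_op_def)

lemma tau_op_const_mult: "tau_op F j (poly_const p * h) = poly_const p * tau_op F j h"
  by (simp add: tau_op_def s_shift_mult algebra_simps)

lemma tau_op_fall_mult:
  fixes F :: "nat \<Rightarrow> 'n::linorder cpoly"
  assumes "s_shift j (-1) h = h"
  shows "tau_op F j (fall F j n * h) = fall F j (Suc n) * h"
proof -
  have "s_shift j (-1) (of_nat a - s_var j :: 'n fs_module) = of_nat (Suc a) - s_var j" for a
    by (simp add: s_shift_diff s_shift_s_var)
  then have "s_shift j (-1) (fall F j n) =
      (\<Prod>a<n. (of_nat (Suc a) - s_var j) * rat_const (Fract 1 (F j)))"
    by (simp add: fall_def s_shift_prod s_shift_mult)
  then show ?thesis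
    using assms by (simp add: tau_op_def s_shift_mult fall_def prod.lessThan_Suc_shift
        del: prod.lessThan_Suc)
qed

lemma shift_op_const_mult: "shift_op F j (poly_const p * h) = poly_const p * shift_op F j h"
  by (simp add: shift_op_def s_shift_mult mult.assoc)

text \<open>
  Separates the variable \<open>v\<close> from the others, whose contribution \<open>h\<close> is not affected by shifts of the \<open>s\<^sub>j\<close> that
  belongs to \<open>v\<close>.
\<close>

lemma mellin_monomial_split:
  fixes F :: "nat \<Rightarrow> 'n::linorder cpoly"
  obtains h where "\<And>n. mellin_monomial F (Poly_Mapping.single v n + m) = (case v of
       Inl k \<Rightarrow> poly_const (Var k) ^ (n + Poly_Mapping.lookup m v)
     | Inr j \<Rightarrow> fall F j (n + Poly_Mapping.lookup m v)) * h"
    "\<And>j c. v = Inr j \<Longrightarrow> s_shift j c h = h"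
proof
  let ?f = "\<lambda>m v. case v of Inl k \<Rightarrow> poly_const (Var k) ^ Poly_Mapping.lookup m v
   | Inr j \<Rightarrow> fall F j (Poly_Mapping.lookup m v)"
  define h where "h = (\<Prod>u\<in>Poly_Mapping.keys m - {v}. ?f m u)"
  show "s_shift j c h = h" if "v = Inr j" for j c
  proof -
    have "s_shift j c (of_nat a - s_var i :: 'n fs_module) = of_nat a - s_var i" if "i \<noteq> j" for a i
      using that by (simp add: s_shift_diff s_shift_s_var)
    then have "s_shift j c (?f m u) = ?f m u" if "u \<noteq> Inr j" for u
      using that by (cases u) (simp_all add: s_shift_power fall_def s_shift_prod s_shift_mult)
    then show ?thesis
      unfolding h_def s_shift_prod using that by (intro prod.cong) auto
  qed
  fix n
  let ?m = "Poly_Mapping.single v n + m"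
  have "mellin_monomial F ?m = (\<Prod>u\<in>insert v (Poly_Mapping.keys m - {v}). ?f ?m u)"
    unfolding mellin_monomial_def
    by (rule prod.mono_neutral_left)
       (auto simp: in_keys_iff lookup_add lookup_single when_def fall_def
         split: sum.split if_splits)
  also have "\<dots> = ?f ?m v * (\<Prod>u\<in>Poly_Mapping.keys m - {v}. ?f ?m u)"
    by (rule prod.insert) auto
  also have "(\<Prod>u\<in>Poly_Mapping.keys m - {v}. ?f ?m u) = h"
    unfolding h_def
    by (rule prod.cong) (auto simp: lookup_add lookup_single when_def split: sum.split)
  finally show "mellin_monomial F ?m = (case v of
       Inl k \<Rightarrow> poly_const (Var k) ^ (n + Poly_Mapping.lookup m v)
     | Inr j \<Rightarrow> fall F j (n + Poly_Mapping.lookup m v)) * h"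
    by (cases v) (simp_all add: lookup_add)
qed

lemma mellin_Var_mult:
  "mellin F (Var v * q) = (case v of Inl k \<Rightarrow> poly_const (Var k) | Inr j \<Rightarrow> 1)
     * (case v of Inl k \<Rightarrow> mellin F q | Inr j \<Rightarrow> tau_op F j (mellin F q))"
proof (induction q rule: mpoly_induct_single)
  case (single m c)
  obtain h where h: "\<And>n. mellin_monomial F (Poly_Mapping.single v n + m) = (case v of
       Inl k \<Rightarrow> poly_const (Var k) ^ (n + Poly_Mapping.lookup m v)
     | Inr j \<Rightarrow> fall F j (n + Poly_Mapping.lookup m v)) * h"
    "\<And>j c. v = Inr j \<Longrightarrow> s_shift j c h = h"
    by (rule mellin_monomial_split[of F v m]) blast
  have M: "mellin F (Poly_Mapping.single n c) = poly_const (Cst c) * mellin_monomial F n" for n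
    by (simp add: mellin_def complex_const.lin_ext_single complex_const_eq)
  show ?case
  proof (cases v)
    case (Inl k)
    then show ?thesis
      using h(1)[of 0] h(1)[of 1] unfolding Inl Cst_Var_mult_single M by (simp add: mult_ac)
  next
    case (Inr j)
    then show ?thesis
      using h(1)[of 0] h(1)[of 1] h(2) unfolding Inr Cst_Var_mult_single M
      by (simp add: tau_op_const_mult tau_op_fall_mult)
  qed
qed (auto simp: mellin_add distrib_left tau_op_add split: sum.split)

lemma mellin_Var_simps [simp]:
  "mellin F (Var (Inl k) * q) = poly_const (Var k) * mellin F q"
  "mellin F (tau j * q) = tau_op F j (mellin F q)"
  by (simp_all add: mellin_Var_mult)

lemma mellin_Cst_mult: "mellin F (Cst c * q) = complex_const c * mellin F q"
  by (induction q rule: mpoly_induct_single)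
     (simp_all add: Cst_Var_mult_single mellin_def complex_const.lin_ext_single
      complex_const.lin_ext_add complex_const.coeff_mult distrib_left)

lemma mellin_xlift_mult: "mellin F (xlift p * q) = poly_const p * mellin F q"
  by (induction p rule: mpoly_induct)
     (simp_all add: mellin_Cst_mult complex_const_eq xlift_mult xlift_add mult.assoc
      poly_const.coeff_add poly_const.coeff_mult distrib_right mellin_add)

lemma mellin_xlift [simp]: "mellin F (xlift p) = poly_const p"
  using mellin_xlift_mult[of F p 1] by simp

lemma poly_const_times_inverse: "p \<noteq> 0 \<Longrightarrow> poly_const p * rat_const (Fract 1 p) = 1"
proof -
  assume "p \<noteq> 0"
  then have "Fract p p = 1" by (simp add: One_fract_def eq_fract)
  then show ?thesis by (simp add: poly_const_def rat_const_def mult_single)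
qed

lemma shift_op_tau_op:
  assumes "F j \<noteq> 0"
  shows "shift_op F j (tau_op F i h) = tau_op F i (shift_op F j h) - (if i = j then h else 0)"
proof (cases "i = j")
  case True
  have *: "poly_const (F j) * rat_const (Fract 1 (F j)) = 1"
    using assms by (rule poly_const_times_inverse)
  have "shift_op F j (tau_op F j h) = - (s_var j + 1) * h * (poly_const (F j) * rat_const (Fract 1 (F j)))"
    by (simp add: shift_op_def tau_op_def s_shift_mult s_shift_uminus s_shift_s_var s_shift_s_shift
        s_shift_id algebra_simps)
  moreover have "tau_op F j (shift_op F j h) = - s_var j * h * (poly_const (F j) * rat_const (Fract 1 (F j)))"
    by (simp add: shift_op_def tau_op_def s_shift_mult s_shift_s_shift s_shift_id mult_ac)
  ultimately show ?thesis
    using True unfolding * by (simp add: distrib_right right_diff_distrib mult.commute)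
next
  case False
  have "s_shift j 1 (s_shift i (-1) h) = s_shift i (-1) (s_shift j 1 h)"
  proof (induction h rule: mpoly_induct)
    case (Cst c)
    then show ?case by (simp flip: rat_const_eq_Cst)
  next
    case (Var l h)
    have "s_shift j 1 (s_shift i (-1) (s_var l)) = s_shift i (-1) (s_shift j 1 (s_var l :: 'a fs_module))"
      using False by (auto simp: s_shift_s_var s_shift_add s_shift_uminus s_shift_diff)
    with Var show ?case by (simp add: s_shift_mult flip: s_var_eq_Var)
  qed (simp add: s_shift_add)
  with False show ?thesis
    by (simp add: shift_op_def tau_op_def s_shift_mult s_shift_uminus s_shift_s_var mult_ac)
qed

lemma shift_op_mellin:
  assumes "F j \<noteq> 0"
  shows "shift_op F j (mellin F q) = mellin F (xlift (F j) * q - mpderiv (Inr j) q)"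
proof (induction q rule: mpoly_induct)
  case (Cst c)
  then show ?case by (simp add: mellin_xlift_mult shift_op_def)
next
  case (Var v q)
  show ?case
  proof (cases v)
    case (Inl k)
    have "xlift (F j) * (Var v * q) - mpderiv (Inr j) (Var v * q)
        = Var (Inl k) * (xlift (F j) * q - mpderiv (Inr j) q)"
      by (simp add: Inl mpderiv_mult mpderiv_Var right_diff_distrib mult.left_commute)
    then show ?thesis
      using Var by (simp add: Inl shift_op_const_mult)
  next
    case (Inr i)
    have "xlift (F j) * (Var v * q) - mpderiv (Inr j) (Var v * q)
        = tau i * (xlift (F j) * q - mpderiv (Inr j) q) - (if i = j then q else 0)"
      by (simp add: Inr mpderiv_mult mpderiv_Var right_diff_distrib mult.left_commute)
    then show ?thesis
      using Var assms by (simp add: Inr shift_op_tau_op mellin_diff)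
  qed
qed (simp add: mellin_add shift_op_def s_shift_add distrib_left distrib_right mpderiv_add mellin_diff)

lemma lookup_mpderiv: "Poly_Mapping.lookup (mpderiv v q) m =
    of_nat (Suc (Poly_Mapping.lookup m v)) * Poly_Mapping.lookup q (Poly_Mapping.single v 1 + m)"
proof (induction q rule: mpoly_induct_single)
  case (single n c)
  show ?case
  proof (cases "Poly_Mapping.lookup n v = 0")
    case True
    then have "n \<noteq> Poly_Mapping.single v 1 + m"
      by (auto simp: lookup_add)
    with True show ?thesis by (simp add: mpderiv_single lookup_single when_def)
  next
    case False
    then have "n = Poly_Mapping.single v 1 + (n - Poly_Mapping.single v 1)"
      by (intro poly_mapping_eqI) (auto simp: lookup_add lookup_minus lookup_single when_def)
    then have "n - Poly_Mapping.single v 1 = m \<longleftrightarrow> n = Poly_Mapping.single v 1 + m"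
      by (metis add_diff_cancel_left')
    then show ?thesis by (auto simp: mpderiv_single lookup_single when_def lookup_add)
  qed
qed (simp_all add: mpderiv_add lookup_add distrib_left)

definition total_degree :: "('v \<Rightarrow>\<^sub>0 nat) \<Rightarrow> nat" where
  "total_degree m = (\<Sum>v\<in>Poly_Mapping.keys m. Poly_Mapping.lookup m v)"

lemma total_degree_add_var: "total_degree (Poly_Mapping.single v 1 + m) = Suc (total_degree m)"
proof -
  let ?m = "Poly_Mapping.single v 1 + m"
  have *: "total_degree n = (\<Sum>u\<in>insert v (Poly_Mapping.keys m). Poly_Mapping.lookup n u)"
    if "n = m \<or> n = ?m" for n
    unfolding total_degree_def using that
    by (intro sum.mono_neutral_left) (auto simp: in_keys_iff lookup_add lookup_single when_def split: if_splits)
  show ?thesis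
    by (subst (1 2) *) (simp_all add: lookup_add sum.distrib lookup_single when_def)
qed

text \<open>
  In characteristic 0, a polynomial with vanishing derivatives in all \<open>\<tau>\<^sub>j\<close> only involves \<open>x\<close>.
\<close>

lemma tau_free_obtain:
  assumes "\<And>j. mpderiv (Inr j) q = 0"
  obtains p where "q = xlift p"
proof -
  have free: "Poly_Mapping.lookup m (Inr j) = 0" if "m \<in> Poly_Mapping.keys q" for m j
  proof (rule ccontr)
    assume *: "Poly_Mapping.lookup m (Inr j) \<noteq> 0"
    define n where "n = m - Poly_Mapping.single (Inr j) 1"
    have "m = Poly_Mapping.single (Inr j) 1 + n"
      unfolding n_def using * by (intro poly_mapping_eqI)
        (auto simp: lookup_add lookup_minus lookup_single when_def)
    then have "Poly_Mapping.lookup (mpderiv (Inr j) q) n \<noteq> 0"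
      using that unfolding lookup_mpderiv by (simp add: in_keys_iff del: of_nat_Suc)
    with assms show False by simp
  qed
  have "\<exists>p. Poly_Mapping.single m c = xlift p"
    if "\<And>j. Poly_Mapping.lookup m (Inr j) = 0" for m and c :: complex
    using that
  proof (induction m rule: monomial_induct)
    case zero
    show ?case by (metis Cst_def xlift_simps(3))
  next
    case (add_var v m)
    obtain k where v: "v = Inl k"
    proof (cases v)
      case (Inr j)
      with add_var.prems[of j] show thesis by (simp add: lookup_add)
    qed blast
    obtain p where "Poly_Mapping.single m c = xlift p"
      using add_var by (auto simp: lookup_add)
    then have "Poly_Mapping.single (Poly_Mapping.single v 1 + m) c = xlift (Var k * p)"
      by (simp only: v xlift_mult xlift_simps Cst_Var_mult_single(2)[symmetric])
    then show ?case by blast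
  qed
  then have "\<forall>m\<in>Poly_Mapping.keys q. \<exists>p. Poly_Mapping.single m (Poly_Mapping.lookup q m) = xlift p"
    using free by blast
  then obtain P where "\<And>m. m \<in> Poly_Mapping.keys q \<Longrightarrow>
      Poly_Mapping.single m (Poly_Mapping.lookup q m) = xlift (P m)" by metis
  then have "q = xlift (\<Sum>m\<in>Poly_Mapping.keys q. P m)"
    using mpoly_eq_sum_single[of q] by (simp add: xlift_sum)
  with that show thesis .
qed

text \<open>
  The kernel of the Mellin transform is stable under \<open>\<partial>/\<partial>\<tau>\<^sub>j\<close>, which is the difference of \<open>F\<^sub>j\<close> and \<open>t\<^sub>j\<close>. A nonzero
  element of the kernel could be differentiated down to a nonzero polynomial in \<open>x\<close> alone, but on those the
  transform is the inclusion.
\<close>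

lemma mellin_eq_zero:
  assumes F: "\<And>j. F j \<noteq> 0" and "mellin F q = 0"
  shows "q = 0"
proof -
  have "q = 0" if "\<And>m. m \<in> Poly_Mapping.keys q \<Longrightarrow> total_degree m < n" "mellin F q = 0" for n
    using that
  proof (induction n arbitrary: q)
    case 0
    then show ?case by (metis all_not_in_conv keys_eq_empty less_nat_zero_code)
  next
    case (Suc n)
    have "mpderiv (Inr j) q = 0" for j
    proof (rule Suc.IH)
      have "shift_op F j (mellin F q) = mellin F (xlift (F j) * q) - mellin F (mpderiv (Inr j) q)"
        using F by (simp add: shift_op_mellin mellin_diff)
      then show "mellin F (mpderiv (Inr j) q) = 0"
        using Suc.prems(2) by (simp add: shift_op_def mellin_xlift_mult)
      show "total_degree m < n" if "m \<in> Poly_Mapping.keys (mpderiv (Inr j) q)" for m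
      proof -
        have "Poly_Mapping.single (Inr j) 1 + m \<in> Poly_Mapping.keys q"
          using that by (auto simp: in_keys_iff lookup_mpderiv)
        from Suc.prems(1)[OF this] show ?thesis by (simp only: total_degree_add_var)
      qed
    qed
    then obtain p where "q = xlift p" using tau_free_obtain by blast
    with Suc.prems(2) show ?case by (simp add: poly_const_eq_zero)
  qed
  moreover obtain n where "\<And>m. m \<in> Poly_Mapping.keys q \<Longrightarrow> total_degree m < n"
    using finite_imp_Sup_less[of "total_degree ` Poly_Mapping.keys q"]
    by (metis finite_imageI finite_keys finite_nat_set_iff_bounded imageI)
  ultimately show ?thesis using assms(2) by blast
qed

section \<open>The functional equation as membership in the filtration\<close>

text \<open>
  The Mellin transform is defined for a sequence of nonzero polynomials, hence the padding by 1.
\<close>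

definition pad :: "'n cpoly list \<Rightarrow> nat \<Rightarrow> 'n cpoly" where
  "pad fs j = (if j < length fs then fs ! j else 1)"

lemma pad_nonzero: "0 \<notin> set fs \<Longrightarrow> pad fs j \<noteq> 0"
  by (auto simp: pad_def dest: nth_mem)

lemma t_op_mellin:
  assumes "0 \<notin> set fs" "j < length fs"
  shows "t_op fs j (mellin (pad fs) q) = mellin (pad fs) (t_act fs j q)"
  using shift_op_mellin[of "pad fs" j q, OF pad_nonzero[OF assms(1)]] assms(2)
  by (simp add: t_op_def shift_op_def t_act_def pad_def)

lemma tau_op_eq:
  assumes "i < length fs"
  shows "tau_op (pad fs) i h = - (s_var i * t_inv_op fs i h)"
  using assms by (simp add: tau_op_def t_inv_op_def pad_def)

lemma s_op_mellin:
  assumes "0 \<notin> set fs" "i < length fs" "j < length fs"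
  shows "s_op fs i j (mellin (pad fs) q) = - mellin (pad fs) (tau i * t_act fs j q)"
  using assms by (simp add: s_op_def t_op_mellin tau_op_eq)

lemma mellin_s_act:
  assumes "0 \<notin> set fs"
  shows "mellin (pad fs) (s_act fs q) = (\<Sum>i<length fs. s_var i) * mellin (pad fs) q"
proof -
  have "mellin (pad fs) (s_act fs q) = (\<Sum>i<length fs. s_op fs i i (mellin (pad fs) q))"
    using assms by (simp add: s_act_def mellin_uminus mellin_sum s_op_mellin sum_negf)
  also have "\<dots> = (\<Sum>i<length fs. s_var i * mellin (pad fs) q)"
    using assms by (intro sum.cong) (auto simp: s_op_def t_op_inverse)
  finally show ?thesis by (simp add: sum_distrib_right)
qed

lemma mellin_b_act:
  assumes "0 \<notin> set fs"
  shows "mellin (pad fs) (b_act fs b) = poly (map_poly complex_const b) (\<Sum>i<length fs. s_var i)"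
proof -
  have "mellin (pad fs) ((s_act fs ^^ n) 1) = (\<Sum>i<length fs. s_var i) ^ n" for n
    by (induction n) (auto simp: mellin_s_act[OF assms])
  moreover have "degree (map_poly complex_const b :: 'a fs_module poly) = degree b"
    by (intro degree_map_poly) (simp add: complex_const_eq_zero)
  ultimately show ?thesis
    by (simp add: b_act_def mellin_sum mellin_Cst_mult poly_altdef coeff_map_poly)
qed

lemma deriv_op_eq: "deriv_op fs k h = coeff_deriv k h +
     (\<Sum>i<length fs. s_var i * rat_const (Fract (mpderiv k (fs ! i)) (fs ! i))) * h"
  by (simp add: deriv_op_def coeff_deriv_def)

lemma deriv_op_add: "deriv_op fs k (g + h) = deriv_op fs k g + deriv_op fs k h"
  by (simp add: deriv_op_eq coeff_deriv_add distrib_left)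

lemma deriv_op_poly_const_mult:
  "deriv_op fs k (poly_const p * h) = poly_const (mpderiv k p) * h + poly_const p * deriv_op fs k h"
  by (simp add: deriv_op_eq coeff_deriv_mult distrib_left mult.left_commute)

text \<open>
  Commuting the two operators produces one term on either side: the shift \<open>s\<^sub>j \<mapsto> s\<^sub>j - 1\<close> of the logarithmic derivative of \<open>\<Prod> f\<^sub>i\<close> to the power \<open>s\<^sub>i\<close>, and the derivative
  of \<open>1 / f\<^sub>j\<close>, contribute the same multiple.
\<close>

lemma deriv_op_tau_op:
  fixes fs :: "'n::linorder cpoly list"
  assumes "0 \<notin> set fs"
  shows "deriv_op fs k (tau_op (pad fs) j h) = tau_op (pad fs) j (deriv_op fs k h)"
proof -
  define G :: "'n fs_module" where
    "G = (\<Sum>i<length fs. s_var i * rat_const (Fract (mpderiv k (fs ! i)) (fs ! i)))"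
  define u :: "'n fs_module" where "u = rat_const (Fract 1 (pad fs j))"
  define c :: "'n fs_module" where "c = rat_const (Fract (mpderiv k (pad fs j)) (pad fs j))"
  have nz: "pad fs j \<noteq> 0" using assms by (rule pad_nonzero)
  have u: "coeff_deriv k u = - (c * u)"
    by (simp add: u_def c_def rat_deriv_inverse[OF nz])
       (simp add: rat_const_def mult_single flip: single_uminus)
  have c0: "c = 0" if "\<not> j < length fs"
    using that by (simp add: c_def pad_def rat_const_def flip: Zero_fract_def)
  have "s_shift j (-1) G = (\<Sum>i<length fs. s_var i * rat_const (Fract (mpderiv k (fs ! i)) (fs ! i))
      - (if i = j then c else 0))"
    unfolding G_def s_shift_sum
    by (intro sum.cong) (auto simp: s_shift_mult s_shift_s_var c_def pad_def left_diff_distrib)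
  also have "\<dots> = G - c"
    using c0 by (auto simp: sum_subtractf G_def)
  finally have G: "s_shift j (-1) G = G - c" .
  show ?thesis
    unfolding deriv_op_eq G_def[symmetric] tau_op_def u_def[symmetric]
    by (simp add: coeff_deriv_mult coeff_deriv_uminus coeff_deriv_s_shift u s_shift_add s_shift_mult G
        algebra_simps)
qed

lemma deriv_op_mellin:
  assumes "0 \<notin> set fs"
  shows "deriv_op fs k (mellin (pad fs) q) = mellin (pad fs) (nabla fs k q)"
proof (induction q rule: mpoly_induct)
  case (Cst c)
  have "mellin (pad fs) (xlift (mpderiv k (fs ! i)) * tau i * Cst c) =
      - (s_var i * rat_const (Fract (mpderiv k (fs ! i)) (fs ! i)) * complex_const c)"
    if "i < length fs" for i
  proof -
    have "poly_const (mpderiv k (fs ! i)) * rat_const (Fract 1 (fs ! i))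
        = rat_const (Fract (mpderiv k (fs ! i)) (fs ! i))"
      by (simp add: poly_const_def rat_const_def mult_single)
    then show ?thesis
      using that
      by (simp only: mult.assoc mellin_xlift_mult mellin_Var_simps mellin_Cst tau_op_def
          s_shift_complex_const pad_def if_True) (simp add: mult_ac)
  qed
  then show ?case
    by (simp add: deriv_op_eq nabla_def mellin_uminus sum_distrib_right mellin_sum sum_negf)
next
  case (Var v q)
  show ?case
  proof (cases v)
    case (Inl l)
    have "nabla fs k (Var v * q) = xlift (mpderiv k (Var l)) * q + xlift (Var l) * nabla fs k q"
      unfolding nabla_xlift_mult[symmetric] by (simp add: Inl)
    then show ?thesis
      using Var by (simp only: mellin_add mellin_xlift_mult Inl mellin_Var_simps
          deriv_op_poly_const_mult)
  next
    case (Inr j)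
    then show ?thesis
      using Var assms by (simp add: nabla_tau_mult deriv_op_tau_op)
  qed
qed (simp add: deriv_op_add nabla_add mellin_add)

lemma op_ring_additive:
  assumes "P \<in> op_ring G" "\<And>Q x y. Q \<in> G \<Longrightarrow> Q (x + y) = Q x + Q y"
  shows "P (x + y) = P x + P y"
  using assms(1) by (induction arbitrary: x y rule: op_ring.induct) (simp_all add: assms(2))

lemma weyl_ops_additive: "P \<in> weyl_ops fs \<Longrightarrow> P (x + y) = P x + P y"
  unfolding weyl_ops_def
  by (erule op_ring_additive) (auto simp: mult_op_def deriv_op_add distrib_left)

lemma bs_ops_additive: "P \<in> bs_ops fs \<Longrightarrow> P (x + y) = P x + P y"
  unfolding bs_ops_def
  by (erule op_ring_additive)
     (auto simp: weyl_ops_additive s_op_def t_op_def t_inv_op_def s_shift_add algebra_simps)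

lemma bs_ops_sum:
  assumes "P \<in> bs_ops fs"
  shows "P (sum f A) = (\<Sum>a\<in>A. P (f a))"
proof -
  have "P 0 = 0" using bs_ops_additive[OF assms, of 0 0] by (metis add.right_neutral add_left_cancel)
  then show ?thesis
    by (induction A rule: infinite_finite_induct) (auto simp: bs_ops_additive[OF assms])
qed

lemma mult_op_in_bs_ops: "mult_op p \<in> bs_ops fs"
  and deriv_op_in_bs_ops: "deriv_op fs k \<in> bs_ops fs"
  and s_op_in_bs_ops: "i < length fs \<Longrightarrow> j < length fs \<Longrightarrow> s_op fs i j \<in> bs_ops fs"
  unfolding bs_ops_def weyl_ops_def by (auto intro!: op_ring.gen)

text \<open>
  All right-hand sides of the functional equation.
\<close>

definition bs_module :: "'n::linorder cpoly list \<Rightarrow> 'n fs_module set" where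
  "bs_module fs = {\<Sum>k<length fs. P k (t_op fs k 1) | P. \<forall>k<length fs. P k \<in> bs_ops fs}"

lemma bs_equation_iff_bs_module:
  "bs_equation fs b \<longleftrightarrow> poly (map_poly complex_const b) (\<Sum>i<length fs. s_var i) \<in> bs_module fs"
  by (auto simp: bs_equation_def bs_module_def)

lemma bs_module_add:
  assumes "x \<in> bs_module fs" "y \<in> bs_module fs"
  shows "x + y \<in> bs_module fs"
proof -
  obtain P Q where "x = (\<Sum>k<length fs. P k (t_op fs k 1))" "\<forall>k<length fs. P k \<in> bs_ops fs"
    "y = (\<Sum>k<length fs. Q k (t_op fs k 1))" "\<forall>k<length fs. Q k \<in> bs_ops fs"
    using assms unfolding bs_module_def by blast
  then show ?thesis
    unfolding bs_module_def
    by (auto intro!: exI[of _ "\<lambda>k h. P k h + Q k h"] simp: sum.distrib bs_ops_def intro: op_ring.add)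
qed

lemma bs_module_op:
  assumes "x \<in> bs_module fs" "Q \<in> bs_ops fs"
  shows "Q x \<in> bs_module fs"
proof -
  obtain P where "x = (\<Sum>k<length fs. P k (t_op fs k 1))" "\<forall>k<length fs. P k \<in> bs_ops fs"
    using assms unfolding bs_module_def by blast
  then show ?thesis
    unfolding bs_module_def using assms(2)
    by (auto intro!: exI[of _ "\<lambda>k. Q \<circ> P k"] simp: bs_ops_sum bs_ops_def intro: op_ring.mul)
qed

lemma bs_module_zero [simp]: "0 \<in> bs_module fs"
proof -
  have "(\<lambda>h. id h + - id h) \<in> bs_ops fs"
    unfolding bs_ops_def by (intro op_ring.add op_ring.neg op_ring.one)
  then show ?thesis
    unfolding bs_module_def by (auto intro!: exI[of _ "\<lambda>_ h. id h + - id h"])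
qed

lemma bs_module_sum:
  "(\<And>a. a \<in> A \<Longrightarrow> f a \<in> bs_module fs) \<Longrightarrow> sum f A \<in> bs_module fs"
  by (induction A rule: infinite_finite_induct) (auto intro: bs_module_add)

lemma bs_module_uminus: "x \<in> bs_module fs \<Longrightarrow> - x \<in> bs_module fs"
proof -
  assume x: "x \<in> bs_module fs"
  have "(\<lambda>h. - id h) \<in> bs_ops fs"
    unfolding bs_ops_def by (intro op_ring.neg op_ring.one)
  from bs_module_op[OF x this] show ?thesis by simp
qed

lemma bs_module_poly_const: "x \<in> bs_module fs \<Longrightarrow> poly_const p * x \<in> bs_module fs"
  using bs_module_op[OF _ mult_op_in_bs_ops] by (simp add: mult_op_def)

lemma bs_module_t_op:
  assumes "k < length fs"
  shows "poly_const (fs ! k) \<in> bs_module fs"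
proof -
  have id: "id \<in> bs_ops fs" and zero: "(\<lambda>h. id h + - id h) \<in> bs_ops fs"
    unfolding bs_ops_def by (intro op_ring.intros)+
  have "(\<Sum>j<length fs. (if j = k then id else (\<lambda>h. id h + - id h)) (t_op fs j 1))
      = (\<Sum>j<length fs. if j = k then t_op fs j 1 else 0)"
    by (intro sum.cong) auto
  also have "\<dots> = poly_const (fs ! k)"
    using assms by (simp add: t_op_def)
  finally show ?thesis
    unfolding bs_module_def using id zero
    by (auto intro!: exI[of _ "\<lambda>j. if j = k then id else (\<lambda>h. id h + - id h)"])
qed

lemma bs_module_s_var:
  assumes "0 \<notin> set fs" "i < length fs" "x \<in> bs_module fs"
  shows "s_var i * x \<in> bs_module fs"
  using bs_module_op[OF assms(3) s_op_in_bs_ops[OF assms(2) assms(2)]] assms(1,2)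
  by (simp add: s_op_def t_op_inverse)

lemma mellin_image_op_ring:
  assumes "P \<in> op_ring G" "y \<in> vfilt fs k"
    and "\<And>Q y. Q \<in> G \<Longrightarrow> y \<in> vfilt fs k \<Longrightarrow> Q (mellin F y) \<in> mellin F ` vfilt fs k"
  shows "P (mellin F y) \<in> mellin F ` vfilt fs k"
  using assms(1,2)
proof (induction arbitrary: y rule: op_ring.induct)
  case (add P Q)
  then obtain u v where "u \<in> vfilt fs k" "P (mellin F y) = mellin F u"
    "v \<in> vfilt fs k" "Q (mellin F y) = mellin F v" by blast
  then show ?case
    by (intro image_eqI[of _ _ "u + v"]) (auto simp: mellin_add intro: vfilt.add)
next
  case (neg P)
  then obtain u where "u \<in> vfilt fs k" "P (mellin F y) = mellin F u" by blast
  then show ?case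
    by (intro image_eqI[of _ _ "- u"]) (auto simp: mellin_uminus intro: vfilt_uminus)
next
  case (mul P Q)
  then show ?case by fastforce
qed (use assms(3) in auto)

lemma bs_ops_mellin_image:
  assumes "0 \<notin> set fs" "P \<in> bs_ops fs" "y \<in> vfilt fs k"
  shows "P (mellin (pad fs) y) \<in> mellin (pad fs) ` vfilt fs k"
  using assms(2) unfolding bs_ops_def
proof (rule mellin_image_op_ring[OF _ assms(3)])
  fix Q y
  assume Q: "Q \<in> weyl_ops fs \<union> {s_op fs i j | i j. i < length fs \<and> j < length fs}"
    and y: "y \<in> vfilt fs k"
  show "Q (mellin (pad fs) y) \<in> mellin (pad fs) ` vfilt fs k"
  proof (cases "Q \<in> weyl_ops fs")
    case True
    then show ?thesis
      unfolding weyl_ops_def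
    proof (rule mellin_image_op_ring[OF _ y])
      fix Q y
      assume "Q \<in> range mult_op \<union> range (deriv_op fs)" and y: "y \<in> vfilt fs k"
      then consider p where "Q = mult_op p" | l where "Q = deriv_op fs l" by blast
      then show "Q (mellin (pad fs) y) \<in> mellin (pad fs) ` vfilt fs k"
      proof cases
        case 1
        then show ?thesis
          using vfilt_xlift_mult[OF y]
          by (intro image_eqI[of _ _ "xlift p * y"]) (simp_all add: mult_op_def mellin_xlift_mult)
      next
        case 2
        then show ?thesis
          using vfilt.nabla[OF y]
          by (intro image_eqI[of _ _ "nabla fs l y"]) (simp_all add: deriv_op_mellin[OF assms(1)])
      qed
    qed
  next
    case False
    then obtain i j where ij: "Q = s_op fs i j" "i < length fs" "j < length fs" using Q by blast
    then have "- (tau i * t_act fs j y) \<in> vfilt fs k"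
      using y by (intro vfilt_uminus vfilt_tau_mult vfilt_t_act)
    with ij show ?thesis
      by (intro image_eqI[of _ _ "- (tau i * t_act fs j y)"])
         (simp_all add: s_op_mellin[OF assms(1)] mellin_uminus)
  qed
qed

text \<open>
  Only one factor is taken out, since the other ones are used up one at a time by the induction in
  \<open>mellin_monomial_in_bs_module\<close>.
\<close>

lemma ideal_power_Suc_obtain:
  assumes "m \<in> ideal_power (ideal_gen (set fs)) (Suc k)"
  obtains p where "m = (\<Sum>i<length fs. fs ! i * p i)"
    "\<And>i. p i \<in> ideal_power (ideal_gen (set fs)) k"
proof -
  let ?P = "\<lambda>m p. m = (\<Sum>i<length fs. fs ! i * p i) \<and> (\<forall>i. p i \<in> ideal_power (ideal_gen (set fs)) k)"
  have "\<exists>p. ?P m p"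
    using assms unfolding ideal_power.simps(2)
  proof (induction rule: ring_self.span_induct_alt)
    case base
    show ?case
      by (rule exI[of _ "\<lambda>_. 0"]) (simp add: subspace_ideal_power ring_self.subspace_0)
  next
    case (step c x y)
    then obtain a b p where x: "x = a * b" "a \<in> ideal_gen (set fs)"
      "b \<in> ideal_power (ideal_gen (set fs)) k" and p: "?P y p" by blast
    obtain q where q: "a = (\<Sum>i<length fs. q i * fs ! i)"
      using x(2) ideal_gen_set_obtain by metis
    have "c * x + y = (\<Sum>i<length fs. fs ! i * (c * q i * b + p i))"
      using p by (simp add: x(1) q distrib_left sum.distrib sum_distrib_left sum_distrib_right mult_ac)
    moreover have "c * q i * b + p i \<in> ideal_power (ideal_gen (set fs)) k" for i
      using p x(3) by (intro ring_self.subspace_add subspace_ideal_power ideal_power_mult_left) auto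
    ultimately show ?case by (intro exI[of _ "\<lambda>i. c * q i * b + p i"]) simp
  qed
  with that show thesis by blast
qed

text \<open>
  Write \<open>m\<close> as a sum of \<open>f\<^sub>j m'\<close>, and \<open>\<tau>\<^sup>\<nu>\<close> as \<open>\<tau>\<^sub>i \<tau>\<^sup>\<nu>\<^sup>'\<close>. Then \<open>\<tau>\<^sub>i t\<^sub>j\<close>, which acts as \<open>- s\<^sub>i\<^sub>j\<close>, takes \<open>m' \<tau>\<^sup>\<nu>\<^sup>'\<close> to
  \<open>f\<^sub>j m' \<tau>\<^sup>\<nu>\<close> up to terms of the same kind and of lower degree in \<open>\<tau>\<close>.
\<close>

lemma mellin_monomial_in_bs_module:
  assumes "0 \<notin> set fs" "m \<in> ideal_power (ideal_gen (set fs)) (Suc (length js))"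
    "set js \<subseteq> {..<length fs}"
  shows "mellin (pad fs) (xlift m * tmon js) \<in> bs_module fs"
  using assms(2,3)
proof (induction "length js" arbitrary: m js rule: less_induct)
  case less
  show ?case
  proof (cases js)
    case Nil
    obtain p where "m = (\<Sum>i<length fs. fs ! i * p i)"
      using less.prems(1) ideal_power_Suc_obtain by metis
    then have "mellin (pad fs) (xlift m * tmon js) = (\<Sum>i<length fs. poly_const (p i) * poly_const (fs ! i))"
      by (simp add: Nil xlift_sum mellin_sum poly_const.coeff_mult mult.commute)
    then show ?thesis
      by (auto intro!: bs_module_sum bs_module_poly_const bs_module_t_op)
  next
    case (Cons i js')
    obtain p where m: "m = (\<Sum>j<length fs. fs ! j * p j)"
      and p: "\<And>j. p j \<in> ideal_power (ideal_gen (set fs)) (Suc (length js'))"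
      using less.prems(1) ideal_power_Suc_obtain[of m fs "length js"] Cons by (metis length_Cons)
    have "mellin (pad fs) (xlift (fs ! j * p j) * tmon js) \<in> bs_module fs" if j: "j < length fs" for j
    proof -
      obtain kss where kss: "mpderiv (Inr j) (tmon js' :: 'a tpoly) = sum_list (map tmon kss)"
        "\<And>ks. ks \<in> set kss \<Longrightarrow> Suc (length ks) = length js' \<and> set ks \<subseteq> set js'"
        by (rule deriv_tmon_obtain[of j js']) blast
      have "xlift (fs ! j * p j) * tmon js = tau i * t_act fs j (xlift (p j) * tmon js')
          + tau i * (xlift (p j) * mpderiv (Inr j) (tmon js'))"
        by (simp add: Cons t_act_def mpderiv_mult xlift_mult distrib_left[symmetric] mult_ac)
      then have "mellin (pad fs) (xlift (fs ! j * p j) * tmon js) =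
          - s_op fs i j (mellin (pad fs) (xlift (p j) * tmon js'))
          + mellin (pad fs) (tau i * (xlift (p j) * mpderiv (Inr j) (tmon js')))"
        using s_op_mellin[OF assms(1), of i j] j less.prems(2) Cons by (simp only: mellin_add) simp
      moreover have "s_op fs i j (mellin (pad fs) (xlift (p j) * tmon js')) \<in> bs_module fs"
        using less.prems(2) Cons j p
        by (intro bs_module_op[OF _ s_op_in_bs_ops] less.hyps) auto
      moreover have "mellin (pad fs) (tau i * (xlift (p j) * tmon ks)) \<in> bs_module fs"
        if "ks \<in> set kss" for ks
      proof -
        have "mellin (pad fs) (xlift (p j) * tmon (i # ks)) \<in> bs_module fs"
        proof (rule less.hyps)
          show "p j \<in> ideal_power (ideal_gen (set fs)) (Suc (length (i # ks)))"
            using p kss(2)[OF that] by simp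
        qed (use kss(2)[OF that] less.prems(2) Cons in auto)
        then show ?thesis by (simp add: mult.left_commute)
      qed
      then have "mellin (pad fs) (tau i * (xlift (p j) * mpderiv (Inr j) (tmon js'))) \<in> bs_module fs"
        unfolding kss(1)
        by (induction kss) (auto simp: distrib_left mellin_add tau_op_add intro: bs_module_add)
      ultimately show ?thesis by (metis bs_module_add bs_module_uminus)
    qed
    then show ?thesis
      unfolding m xlift_sum sum_distrib_right mellin_sum by (intro bs_module_sum) auto
  qed
qed

lemma mellin_vfilt_subset:
  assumes "0 \<notin> set fs" "q \<in> vfilt fs 1"
  shows "mellin (pad fs) q \<in> bs_module fs"
  using assms(2)
proof (induction rule: vfilt.induct)
  case (base q)
  then show ?case
  proof (induction rule: weight_span.induct)
    case (base m js)
    then show ?case by (intro mellin_monomial_in_bs_module assms(1)) auto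
  qed (auto simp: mellin_add intro: bs_module_add)
next
  case (nabla q l)
  then show ?case
    by (simp add: bs_module_op deriv_op_in_bs_ops flip: deriv_op_mellin[OF assms(1)])
qed (auto simp: mellin_add intro: bs_module_add)

lemma bs_module_subset_mellin:
  assumes "0 \<notin> set fs" "x \<in> bs_module fs"
  shows "x \<in> mellin (pad fs) ` vfilt fs 1"
proof -
  obtain P where x: "x = (\<Sum>k<length fs. P k (t_op fs k 1))" and P: "\<forall>k<length fs. P k \<in> bs_ops fs"
    using assms unfolding bs_module_def by blast
  have "\<exists>y\<in>vfilt fs 1. P k (t_op fs k 1) = mellin (pad fs) y" if k: "k < length fs" for k
  proof -
    have "fs ! k \<in> ideal_power (ideal_gen (set fs)) 1"
      using ideal_power_mult[of "fs ! k" "ideal_gen (set fs)" 1 0] k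
      by (simp add: ideal_gen_eq_span ring_self.span_base)
    then have "xlift (fs ! k) \<in> vfilt fs 1"
      using weight_span.base[of "fs ! k" "ideal_gen (set fs)" "[]" 1 "length fs"]
      by (auto intro: vfilt.base)
    then have "P k (mellin (pad fs) (xlift (fs ! k))) \<in> mellin (pad fs) ` vfilt fs 1"
      using bs_ops_mellin_image[OF assms(1)] P k by blast
    then show ?thesis by (auto simp: t_op_def)
  qed
  then obtain y where "\<And>k. k < length fs \<Longrightarrow> y k \<in> vfilt fs 1 \<and> P k (t_op fs k 1) = mellin (pad fs) (y k)"
    by metis
  then show ?thesis
    unfolding x by (intro image_eqI[of _ _ "\<Sum>k<length fs. y k"]) (auto simp: mellin_sum intro: vfilt_sum)
qed

text \<open>
  The ring that is generated by \<open>D\<close> and the \<open>s\<^sub>i\<^sub>j\<close> acts on \<open>N\<close>, because \<open>s\<^sub>i\<^sub>j\<close> acts as \<open>- \<tau>\<^sub>i t\<^sub>j\<close>. So the right-hand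
  sides of the functional equation are the image of \<open>vfilt fs 1\<close>, and the Mellin transform is injective.
\<close>

theorem bs_equation_iff_vfilt:
  assumes "0 \<notin> set fs"
  shows "bs_equation fs b \<longleftrightarrow> b_act fs b \<in> vfilt fs 1"
proof
  assume "bs_equation fs b"
  then have "mellin (pad fs) (b_act fs b) \<in> mellin (pad fs) ` vfilt fs 1"
    using bs_module_subset_mellin[OF assms] by (simp add: bs_equation_iff_bs_module mellin_b_act[OF assms])
  then obtain y where y: "y \<in> vfilt fs 1" "mellin (pad fs) (b_act fs b - y) = 0"
    by (auto simp: mellin_diff)
  then have "b_act fs b - y = 0"
    using mellin_eq_zero pad_nonzero[OF assms] by blast
  with y show "b_act fs b \<in> vfilt fs 1" by simp
next
  assume "b_act fs b \<in> vfilt fs 1"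
  then show "bs_equation fs b"
    using mellin_vfilt_subset[OF assms] by (simp add: bs_equation_iff_bs_module flip: mellin_b_act[OF assms])
qed

theorem bs_equation_independent:
  assumes "0 \<notin> set fs" "0 \<notin> set gs" "ideal_gen (set fs) = ideal_gen (set gs)"
  shows "bs_equation fs b \<longleftrightarrow> bs_equation gs b"
  using b_act_vfilt_independent[OF assms(3)] b_act_vfilt_independent[OF assms(3)[symmetric]] assms(1,2)
  by (auto simp: bs_equation_iff_vfilt)

section \<open>Functionals that detect roots\<close>

text \<open>
  The exponents of \<open>x\<^bsup>a(j)\<^esup>\<close>, with \<open>a(j) = 0\<close> beyond the list, so that the rules for \<open>\<tau>\<^sub>j\<close> below hold for all \<open>j\<close>.
\<close>

definition expo :: "('n \<Rightarrow>\<^sub>0 nat) list \<Rightarrow> nat \<Rightarrow> 'n \<Rightarrow> nat" where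
  "expo as j i = (if j < length as then Poly_Mapping.lookup (as ! j) i else 0)"

definition ell :: "('n \<Rightarrow>\<^sub>0 nat) list \<Rightarrow> (nat \<Rightarrow> 'a::comm_ring_1) \<Rightarrow> 'n \<Rightarrow> 'a" where
  "ell as s i = (\<Sum>j<length as. of_nat (expo as j i) * s j)"

text \<open>
  Under the Mellin transform \<open>\<tau>\<^sub>j\<close> becomes a multiple of \<open>x\<close> to the power \<open>- a(j)\<close>, so this is the exponent of \<open>x\<close> in
  the image of a monomial. Likewise \<open>tau_coeff s\<close> is the coefficient of the image, evaluated at the point \<open>s\<close>.
\<close>

definition weight :: "('n \<Rightarrow>\<^sub>0 nat) list \<Rightarrow> ('n + nat \<Rightarrow>\<^sub>0 nat) \<Rightarrow> 'n \<Rightarrow> int" where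
  "weight as m i = (\<Sum>v\<in>Poly_Mapping.keys m. int (Poly_Mapping.lookup m v) *
     (case v of Inl k \<Rightarrow> if k = i then 1 else 0 | Inr j \<Rightarrow> - int (expo as j i)))"

definition tau_coeff :: "(nat \<Rightarrow> complex) \<Rightarrow> ('n + nat \<Rightarrow>\<^sub>0 nat) \<Rightarrow> complex" where
  "tau_coeff s m = (\<Prod>v\<in>Poly_Mapping.keys m.
     case v of Inl k \<Rightarrow> 1 | Inr j \<Rightarrow> \<Prod>a<Poly_Mapping.lookup m v. of_nat a - s j)"

text \<open>
  The coefficient of \<open>x\<^sup>w\<close> in the Mellin transform for the monomial generators, evaluated at \<open>s\<close>.
\<close>

definition theta ::
    "('n \<Rightarrow>\<^sub>0 nat) list \<Rightarrow> (nat \<Rightarrow> complex) \<Rightarrow> ('n \<Rightarrow> int) \<Rightarrow> 'n tpoly \<Rightarrow> complex" where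
  "theta as s w = lin_ext (\<lambda>c. c) (\<lambda>m. if weight as m = w then tau_coeff s m else 0)"

interpretation id_coeff: additive_coeff "\<lambda>c :: complex. c"
  by unfold_locales simp

declare id_coeff.coeff_zero [simp del]

lemma theta_zero [simp]: "theta as s w 0 = 0"
  and theta_add: "theta as s w (p + q) = theta as s w p + theta as s w q"
  and theta_single: "theta as s w (Poly_Mapping.single m c) =
    c * (if weight as m = w then tau_coeff s m else 0)"
  by (simp_all add: theta_def id_coeff.lin_ext_add id_coeff.lin_ext_single)

lemma theta_uminus: "theta as s w (- p) = - theta as s w p"
  using theta_add[of as s w p "- p"] by (simp add: minus_unique)

lemma theta_sum: "theta as s w (sum f A) = (\<Sum>a\<in>A. theta as s w (f a))"
  by (induction A rule: infinite_finite_induct) (auto simp: theta_add)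

lemma theta_Cst: "theta as s w (Cst c) = (if w = (\<lambda>_. 0) then c else 0)"
  by (auto simp: Cst_def theta_single weight_def tau_coeff_def fun_eq_iff)

lemma theta_Cst_mult: "theta as s w (Cst c * q) = c * theta as s w q"
  by (induction q rule: mpoly_induct_single)
     (simp_all add: Cst_Var_mult_single theta_single theta_add distrib_left)

lemma weight_add_var: "weight as (Poly_Mapping.single v 1 + m) i =
    (case v of Inl k \<Rightarrow> if k = i then 1 else 0 | Inr j \<Rightarrow> - int (expo as j i)) + weight as m i"
proof -
  let ?x = "\<lambda>v. case v of Inl k \<Rightarrow> if k = i then 1 else 0 | Inr j \<Rightarrow> - int (expo as j i)"
  let ?m = "Poly_Mapping.single v 1 + m"
  have *: "weight as n i = (\<Sum>u\<in>insert v (Poly_Mapping.keys m). int (Poly_Mapping.lookup n u) * ?x u)"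
    if "n = m \<or> n = ?m" for n
    unfolding weight_def using that
    by (intro sum.mono_neutral_left) (auto simp: in_keys_iff lookup_add lookup_single when_def split: if_splits)
  have "int (Poly_Mapping.lookup ?m u) * ?x u =
      (if u = v then ?x v else 0) + int (Poly_Mapping.lookup m u) * ?x u" for u
    by (simp add: lookup_add lookup_single when_def distrib_right)
  then have "(\<Sum>u\<in>insert v (Poly_Mapping.keys m). int (Poly_Mapping.lookup ?m u) * ?x u) =
      ?x v + (\<Sum>u\<in>insert v (Poly_Mapping.keys m). int (Poly_Mapping.lookup m u) * ?x u)"
    by (simp only: sum.distrib) simp
  then show ?thesis using *[of m] *[of ?m] by simp
qed

lemma tau_coeff_add_var: "tau_coeff s (Poly_Mapping.single v 1 + m) =
    (case v of Inl k \<Rightarrow> tau_coeff s m | Inr j \<Rightarrow> - s j * tau_coeff (s(j := s j - 1)) m)"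
proof -
  let ?f = "\<lambda>s m v. case v of Inl k \<Rightarrow> 1 | Inr j \<Rightarrow> \<Prod>a<Poly_Mapping.lookup m v. of_nat a - s j"
  let ?m = "Poly_Mapping.single v 1 + m"
  have *: "tau_coeff s n = ?f s n v * (\<Prod>u\<in>Poly_Mapping.keys m - {v}. ?f s n u)"
    if "n = m \<or> n = ?m" for n s
  proof -
    have "tau_coeff s n = (\<Prod>u\<in>insert v (Poly_Mapping.keys m - {v}). ?f s n u)"
      unfolding tau_coeff_def using that
      by (intro prod.mono_neutral_left)
         (auto simp: in_keys_iff lookup_add lookup_single when_def split: if_splits sum.split)
    also have "\<dots> = ?f s n v * (\<Prod>u\<in>Poly_Mapping.keys m - {v}. ?f s n u)"
      by (rule prod.insert) auto
    finally show ?thesis .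
  qed
  have rest: "(\<Prod>u\<in>Poly_Mapping.keys m - {v}. ?f s ?m u) =
      (\<Prod>u\<in>Poly_Mapping.keys m - {v}. ?f s' m u)"
    if "\<And>j. v \<noteq> Inr j \<Longrightarrow> s' j = s j" for s s'
    by (intro prod.cong) (use that in \<open>auto simp: lookup_add lookup_single when_def split: sum.split\<close>)
  show ?thesis
  proof (cases v)
    case (Inl k)
    then show ?thesis
      using *[of ?m s] *[of m s] rest[of s s] by simp
  next
    case (Inr j)
    have "(\<Prod>u\<in>Poly_Mapping.keys m - {v}. ?f s ?m u) =
        (\<Prod>u\<in>Poly_Mapping.keys m - {v}. ?f (s(j := s j - 1)) m u)"
      using Inr by (intro prod.cong) (auto simp: lookup_add lookup_single when_def split: sum.split)
    moreover have "?f s ?m v = - s j * ?f (s(j := s j - 1)) m v"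
      by (simp add: Inr lookup_add prod.lessThan_Suc_shift algebra_simps del: prod.lessThan_Suc)
    ultimately show ?thesis
      using *[of ?m s] *[of m "s(j := s j - 1)"] by (simp add: Inr)
  qed
qed

lemma theta_Inl_mult: "theta as s w (Var (Inl k) * q) = theta as s (w(k := w k - 1)) q"
proof (induction q rule: mpoly_induct_single)
  case (single m c)
  have "weight as (Poly_Mapping.single (Inl k) 1 + m) = w \<longleftrightarrow> weight as m = w(k := w k - 1)"
    unfolding fun_eq_iff weight_add_var by (intro all_cong1) auto
  then show ?case
    unfolding Cst_Var_mult_single theta_single tau_coeff_add_var by simp
qed (simp_all add: theta_add distrib_left)

lemma theta_tau_mult: "theta as s w (tau j * q) =
    - s j * theta as (s(j := s j - 1)) (\<lambda>i. w i + int (expo as j i)) q"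
proof (induction q rule: mpoly_induct_single)
  case (single m c)
  have "weight as (Poly_Mapping.single (Inr j) 1 + m) = w \<longleftrightarrow>
      weight as m = (\<lambda>i. w i + int (expo as j i))"
    unfolding fun_eq_iff weight_add_var by (intro all_cong1) auto
  then show ?case
    unfolding Cst_Var_mult_single theta_single tau_coeff_add_var by simp
qed (simp_all add: theta_add algebra_simps)

lemma theta_xlift_single:
  "theta as s w (xlift (Poly_Mapping.single u c)) = (if w = (\<lambda>i. int (Poly_Mapping.lookup u i)) then c else 0)"
proof (induction u arbitrary: w rule: monomial_induct)
  case zero
  then show ?case by (simp add: theta_Cst flip: Cst_def)
next
  case (add_var v m)
  have "w(v := w v - 1) = (\<lambda>i. int (Poly_Mapping.lookup m i)) \<longleftrightarrow>
      w = (\<lambda>i. int (Poly_Mapping.lookup (Poly_Mapping.single v 1 + m) i))"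
    by (auto simp: fun_eq_iff lookup_add lookup_single when_def)
  then show ?case
    unfolding Cst_Var_mult_single(2)[symmetric] xlift_mult xlift_simps theta_Inl_mult add_var
    by simp
qed

lemma ell_upd: "j < length as \<Longrightarrow> ell as (s(j := s j - 1)) i = ell as s i - of_nat (expo as j i)"
proof -
  assume j: "j < length as"
  have "of_nat (expo as l i) * (s(j := s j - 1)) l =
      of_nat (expo as l i) * s l - (if l = j then of_nat (expo as j i) else 0)" for l
    by (simp add: algebra_simps)
  then show ?thesis using j by (simp add: ell_def sum_subtractf)
qed

text \<open>
  Multiplied by the product of the powers \<open>f\<^sub>j\<close> to \<open>s\<^sub>j\<close>, the monomial \<open>x\<^sup>w\<close> has exponent \<open>w + l(s)\<close>. So its derivative
  in \<open>x\<^sub>i\<close> has the factor \<open>w\<^sub>i + l\<^sub>i(s)\<close>, and its exponent at \<open>i\<close> is lower by one.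
\<close>

lemma theta_nabla:
  "theta as s w (nabla (map xmonom as) i q) =
     (ell as s i + of_int (w i) + 1) * theta as s (w(i := w i + 1)) q"
proof (induction q arbitrary: s w rule: mpoly_induct)
  case (Cst c)
  have 1: "theta as s w (xlift (mpderiv i (xmonom (as ! j))) * tau j * Cst c) =
     - c * (if w(i := w i + 1) = (\<lambda>_. 0) then of_nat (expo as j i) * s j else 0)"
    if j: "j < length as" for j
  proof -
    have "theta as s w (xlift (mpderiv i (xmonom (as ! j))) * tau j * Cst c) =
        theta as s w (Cst c * (tau j * xlift (mpderiv i (xmonom (as ! j)))))"
      by (simp add: mult_ac)
    also have "\<dots> = - (c * s j * theta as (s(j := s j - 1)) (\<lambda>l. w l + int (expo as j l))
        (xlift (Poly_Mapping.single (as ! j - Poly_Mapping.single i 1) (of_nat (expo as j i)))))"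
      using j by (simp add: theta_Cst_mult theta_tau_mult xmonom_def mpderiv_single expo_def)
    also have "\<dots> = - c * (if w(i := w i + 1) = (\<lambda>_. 0) then of_nat (expo as j i) * s j else 0)"
    proof (cases "expo as j i = 0")
      case False
      then have "(\<lambda>l. w l + int (expo as j l)) =
          (\<lambda>l. int (Poly_Mapping.lookup (as ! j - Poly_Mapping.single i 1) l)) \<longleftrightarrow>
          w(i := w i + 1) = (\<lambda>_. 0)"
        using j by (auto simp: fun_eq_iff expo_def lookup_minus lookup_single when_def of_nat_diff)
      then show ?thesis by (simp add: theta_xlift_single)
    qed (simp add: theta_xlift_single)
    finally show ?thesis .
  qed
  have "theta as s w (nabla (map xmonom as) i (Cst c)) =
      (\<Sum>j<length as. c * (if w(i := w i + 1) = (\<lambda>_. 0) then of_nat (expo as j i) * s j else 0))"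
    by (simp add: nabla_def theta_uminus sum_distrib_right theta_sum 1 sum_negf del: fun_upd_apply)
  also have "\<dots> = (if w(i := w i + 1) = (\<lambda>_. 0) then c * ell as s i else 0)"
    by (simp add: ell_def sum_distrib_left)
  also have "\<dots> = (ell as s i + of_int (w i) + 1) * (if w(i := w i + 1) = (\<lambda>_. 0) then c else 0)"
  proof (cases "w(i := w i + 1) = (\<lambda>_. 0)")
    case True
    then have "w i + 1 = 0" by (metis fun_upd_same)
    then have "w i = - 1" by simp
    then show ?thesis by simp
  qed simp
  finally show ?case by (simp add: theta_Cst del: fun_upd_apply)
next
  case (Var v q)
  show ?case
  proof (cases v)
    case (Inl k)
    have nab: "nabla (map xmonom as) i (Var (Inl k) * q) = (if i = k then q else 0)
        + Var (Inl k) * nabla (map xmonom as) i q"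
      using nabla_xlift_mult[of "map xmonom as" i "Var k" q] by (simp add: mpderiv_Var)
    show ?thesis
    proof (cases "i = k")
      case True
      then show ?thesis
        unfolding Inl nab theta_add theta_Inl_mult Var by (simp add: distrib_right fun_upd_same del: fun_upd_apply)
    next
      case False
      have "w(i := w i + 1, k := w k - 1) = w(k := w k - 1, i := w i + 1)"
        using False by (auto simp: fun_eq_iff)
      with False show ?thesis
        unfolding Inl nab theta_add theta_Inl_mult Var
        by (simp add: fun_upd_other del: fun_upd_apply)
    qed
  next
    case (Inr j)
    have "(\<lambda>l. (w(i := w i + 1)) l + int (expo as j l)) =
        (\<lambda>l. w l + int (expo as j l))(i := w i + int (expo as j i) + 1)"
      by (auto simp: fun_eq_iff)
    moreover have "ell as (s(j := s j - 1)) i + of_int (w i + int (expo as j i)) =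
        ell as s i + of_int (w i)"
    proof (cases "j < length as")
      case True
      then show ?thesis by (simp add: ell_upd)
    next
      case False
      then show ?thesis by (auto simp: ell_def expo_def intro!: sum.cong)
    qed
    ultimately show ?thesis
      by (simp add: Inr nabla_tau_mult theta_tau_mult Var del: fun_upd_apply)
  qed
qed (simp add: nabla_add theta_add distrib_left)

lemma s_act_add: "s_act fs (p + q) = s_act fs p + s_act fs q"
  by (simp add: s_act_def t_act_add distrib_left sum.distrib)

lemma s_act_Inl_mult: "s_act fs (Var (Inl k) * q) = Var (Inl k) * s_act fs q"
proof -
  have "t_act fs i (Var (Inl k) * q) = Var (Inl k) * t_act fs i q" for i
    by (simp add: t_act_def mpderiv_mult mpderiv_Var right_diff_distrib mult.left_commute)
  then show ?thesis by (simp add: s_act_def sum_distrib_left mult.left_commute)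
qed

lemma s_act_tau_mult:
  "s_act fs (tau j * q) = tau j * s_act fs q + (if j < length fs then tau j * q else 0)"
proof -
  have "tau i * t_act fs i (tau j * q) = tau j * (tau i * t_act fs i q) - (if i = j then tau j * q else 0)" for i
    by (simp add: t_act_def mpderiv_mult mpderiv_Var right_diff_distrib distrib_left mult_ac)
  then show ?thesis by (simp add: s_act_def sum_distrib_left sum_subtractf)
qed

lemma theta_s_act:
  "theta as s w (s_act (map xmonom as) q) = (\<Sum>j<length as. s j) * theta as s w q"
proof (induction q arbitrary: s w rule: mpoly_induct)
  case (Cst c)
  have "theta as s w (tau j * (xlift (xmonom (as ! j)) * Cst c)) = - s j * (if w = (\<lambda>_. 0) then c else 0)"
    if j: "j < length as" for j
  proof -
    have *: "(\<lambda>i. w i + int (expo as j i)) = (\<lambda>i. int (Poly_Mapping.lookup (as ! j) i)) \<longleftrightarrow>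
        w = (\<lambda>_. 0)"
      using j by (auto simp: fun_eq_iff expo_def)
    have "theta as s w (tau j * (xlift (xmonom (as ! j)) * Cst c)) =
        theta as s w (Cst c * (tau j * xlift (xmonom (as ! j))))"
      by (simp add: mult_ac)
    also have "\<dots> = - s j * (if w = (\<lambda>_. 0) then c else 0)"
      unfolding theta_Cst_mult theta_tau_mult xmonom_def theta_xlift_single * by simp
    finally show ?thesis .
  qed
  then show ?case
    by (simp add: s_act_def t_act_def theta_uminus theta_sum theta_Cst sum_distrib_right sum_negf)
next
  case (Var v q)
  show ?case
  proof (cases v)
    case (Inl k)
    then show ?thesis by (simp add: s_act_Inl_mult theta_Inl_mult Var del: fun_upd_apply)
  next
    case (Inr j)
    have "(\<Sum>l<length as. (s(j := s j - 1)) l) = (\<Sum>l<length as. s l - (if l = j then 1 else 0))"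
      by (intro sum.cong) auto
    then have "(\<Sum>l<length as. (s(j := s j - 1)) l) = (\<Sum>l<length as. s l) - (if j < length as then 1 else 0)"
      by (simp add: sum_subtractf)
    then show ?thesis
      unfolding Inr s_act_tau_mult theta_add
      by (simp only: theta_tau_mult Var if_distrib[of "theta as s w"] theta_zero length_map)
         (simp add: algebra_simps del: fun_upd_apply)
  qed
qed (simp add: s_act_add theta_add distrib_left)

lemma theta_b_act: "theta as s (\<lambda>_. 0) (b_act (map xmonom as) b) = poly b (\<Sum>j<length as. s j)"
proof -
  have "theta as s (\<lambda>_. 0) ((s_act (map xmonom as) ^^ n) 1) = (\<Sum>j<length as. s j) ^ n" for n
    using theta_Cst[of as s "\<lambda>_. 0" 1] by (induction n) (simp_all add: theta_s_act)
  then show ?thesis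
    by (simp add: b_act_def theta_sum theta_Cst_mult poly_altdef)
qed

text \<open>
  Each \<open>\<tau>\<^sub>j\<close> contributes a factor of the falling factorial of \<open>s\<^sub>j\<close>, which vanishes when the degree exceeds a natural
  number \<open>s\<^sub>j\<close>.
\<close>

lemma theta_tmon_nonzero:
  assumes "theta as s w (xlift m * tmon js) \<noteq> 0"
  shows "\<exists>u\<in>Poly_Mapping.keys m. (\<forall>i. int (Poly_Mapping.lookup u i) = w i + (\<Sum>j\<leftarrow>js. int (expo as j i))) \<and>
     (\<forall>j n. s j = of_nat n \<longrightarrow> count_list js j \<le> n)"
  using assms
proof (induction js arbitrary: s w)
  case Nil
  have "theta as s w (xlift m) =
      (\<Sum>u\<in>Poly_Mapping.keys m. theta as s w (xlift (Poly_Mapping.single u (Poly_Mapping.lookup m u))))"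
    by (subst mpoly_eq_sum_single[of m]) (simp add: xlift_sum theta_sum)
  then obtain u where "u \<in> Poly_Mapping.keys m"
      "theta as s w (xlift (Poly_Mapping.single u (Poly_Mapping.lookup m u))) \<noteq> 0"
    using Nil by (metis (no_types, lifting) tmon_simps(1) mult.right_neutral sum.neutral)
  then show ?case by (auto simp: theta_xlift_single split: if_splits)
next
  case (Cons j js)
  let ?s = "s(j := s j - 1)"
  have "theta as s w (xlift m * tmon (j # js)) =
      - s j * theta as ?s (\<lambda>i. w i + int (expo as j i)) (xlift m * tmon js)"
    by (simp add: mult.left_commute[of "xlift m"] theta_tau_mult)
  with Cons.prems have s: "s j \<noteq> 0"
    and "theta as ?s (\<lambda>i. w i + int (expo as j i)) (xlift m * tmon js) \<noteq> 0" by auto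
  from Cons.IH[OF this(2)] obtain u where u: "u \<in> Poly_Mapping.keys m"
    "\<And>i. int (Poly_Mapping.lookup u i) = w i + int (expo as j i) + (\<Sum>j\<leftarrow>js. int (expo as j i))"
    and count: "\<And>l n. ?s l = of_nat n \<Longrightarrow> count_list js l \<le> n" by auto
  have "count_list (j # js) l \<le> n" if "s l = of_nat n" for l n
  proof (cases "l = j")
    case True
    with that s obtain n' where "n = Suc n'" by (cases n) auto
    with True that count[of j n'] show ?thesis by simp
  qed (use that count[of l n] in auto)
  with u show ?case by (auto simp: algebra_simps)
qed

lemma keys_upward_closed_subspace:
  fixes P :: "('n \<Rightarrow>\<^sub>0 nat) \<Rightarrow> bool"
  assumes "\<And>u v. P u \<Longrightarrow> P (v + u)"
  shows "ring_self.subspace {p :: 'n cpoly. \<forall>u\<in>Poly_Mapping.keys p. P u}"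
proof (rule ring_self.subspaceI)
  fix p q :: "'n cpoly"
  assume "p \<in> {p. \<forall>u\<in>Poly_Mapping.keys p. P u}" "q \<in> {p. \<forall>u\<in>Poly_Mapping.keys p. P u}"
  then show "p + q \<in> {p. \<forall>u\<in>Poly_Mapping.keys p. P u}"
    using Poly_Mapping.keys_add[of p q] by blast
next
  fix c p :: "'n cpoly"
  assume "p \<in> {p. \<forall>u\<in>Poly_Mapping.keys p. P u}"
  then show "c * p \<in> {p. \<forall>u\<in>Poly_Mapping.keys p. P u}"
    using keys_mult[of c p] assms by blast
qed simp

lemma keys_monomial_ideal:
  assumes "p \<in> ideal_gen (xmonom ` U)" "u \<in> Poly_Mapping.keys p"
  shows "\<exists>a\<in>U. \<forall>i. Poly_Mapping.lookup a i \<le> Poly_Mapping.lookup u i"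
proof -
  have "ideal_gen (xmonom ` U) \<subseteq>
      {p. \<forall>u\<in>Poly_Mapping.keys p. \<exists>a\<in>U. \<forall>i. Poly_Mapping.lookup a i \<le> Poly_Mapping.lookup u i}"
    unfolding ideal_gen_eq_span
    by (intro ring_self.span_minimal keys_upward_closed_subspace)
       (auto simp: xmonom_def lookup_add intro: trans_le_add2)
  with assms show ?thesis by blast
qed

lemma keys_monomial_ideal_power:
  assumes "m \<in> ideal_power (ideal_gen (set (map xmonom as))) k" "u \<in> Poly_Mapping.keys m"
  shows "\<exists>js. length js = k \<and> set js \<subseteq> {..<length as} \<and>
    (\<forall>i. (\<Sum>j\<leftarrow>js. expo as j i) \<le> Poly_Mapping.lookup u i)"
  using assms
proof (induction k arbitrary: m u)
  case 0
  then show ?case by (intro exI[of _ "[]"]) simp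
next
  case (Suc k)
  let ?P = "\<lambda>u. \<exists>js. length js = Suc k \<and> set js \<subseteq> {..<length as} \<and>
    (\<forall>i. (\<Sum>j\<leftarrow>js. expo as j i) \<le> Poly_Mapping.lookup u i)"
  have "?P u" if ab: "a \<in> ideal_gen (set (map xmonom as))"
    "b \<in> ideal_power (ideal_gen (set (map xmonom as))) k" "u \<in> Poly_Mapping.keys (a * b)" for a b u
  proof -
    obtain x y where u: "u = x + y" "x \<in> Poly_Mapping.keys a" "y \<in> Poly_Mapping.keys b"
      using ab(3) keys_mult[of a b] by blast
    obtain l where l: "l \<in> set as" "\<forall>i. Poly_Mapping.lookup l i \<le> Poly_Mapping.lookup x i"
      using keys_monomial_ideal[of a "set as" x] ab(1) u(2) by auto
    then obtain j where j: "j < length as" "l = as ! j" by (metis in_set_conv_nth)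
    obtain js where "length js = k" "set js \<subseteq> {..<length as}"
      "\<forall>i. (\<Sum>j\<leftarrow>js. expo as j i) \<le> Poly_Mapping.lookup y i"
      using Suc.IH[OF ab(2) u(3)] by blast
    then show ?thesis
      using j l(2) u(1) by (intro exI[of _ "j # js"]) (auto simp: expo_def lookup_add intro: add_mono)
  qed
  moreover have "?P (v + u)" if "?P u" for u v
    using that by (auto simp: lookup_add intro: trans_le_add2)
  ultimately have "ideal_power (ideal_gen (set (map xmonom as))) (Suc k) \<subseteq>
      {p. \<forall>u\<in>Poly_Mapping.keys p. ?P u}"
    unfolding ideal_power.simps(2)
    by (intro ring_self.span_minimal keys_upward_closed_subspace) auto
  with Suc.prems show ?case by blast
qed

text \<open>
  The condition says that the product \<open>G\<^sub>c\<close> of the introduction vanishes at \<open>s\<close> for every integer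
  vector \<open>c\<close> with \<open>\<Sum> c\<^sub>j = 1\<close>.
\<close>

definition root_point :: "('n \<Rightarrow>\<^sub>0 nat) list \<Rightarrow> (nat \<Rightarrow> complex) \<Rightarrow> bool" where
  "root_point as s \<longleftrightarrow> \<not> (\<exists>c :: nat \<Rightarrow> int. (\<Sum>j<length as. c j) = 1 \<and>
     (\<forall>j<length as. \<forall>n. s j = of_nat n \<longrightarrow> - int n \<le> c j) \<and>
     (\<forall>i n. ell as s i = - of_nat (Suc n) \<longrightarrow> ell as c i \<le> int n))"

lemma sum_list_expo:
  assumes "set js \<subseteq> {..<length as}"
  shows "(\<Sum>j\<leftarrow>js. int (expo as j i)) = ell as (\<lambda>j. int (count_list js j)) i"
  using assms
proof (induction js)
  case (Cons j js)
  have "ell as (\<lambda>l. int (count_list (j # js) l)) i =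
      (\<Sum>l<length as. int (expo as l i) * int (count_list js l) + (if l = j then int (expo as j i) else 0))"
    unfolding ell_def by (intro sum.cong) (auto simp: distrib_left)
  with Cons show ?case by (simp add: sum.distrib ell_def)
qed (simp add: ell_def)

text \<open>
  The exponents \<open>w\<close> are followed through all derivations. At a coordinate where \<open>l\<^sub>i(s)\<close> is a
  negative integer, \<open>w\<^sub>i + l\<^sub>i(s)\<close> cannot leave the negative integers by a derivation, because \<open>theta_nabla\<close> produces
  the factor 0 at that point. On a generator \<open>m \<tau>\<^sup>\<nu>\<close> a nonzero value would provide a forbidden \<open>c = \<mu> - \<nu>\<close>, where
  \<open>f\<^sup>\<mu>\<close> with \<open>|\<mu>| = |\<nu>| + 1\<close> divides a monomial of \<open>m\<close>.
\<close>

lemma theta_vfilt: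
  assumes "root_point as s" "y \<in> vfilt (map xmonom as) 1"
    and "\<And>i n. ell as s i = - of_nat (Suc n) \<Longrightarrow> w i \<le> int n"
  shows "theta as s w y = 0"
  using assms(2,3)
proof (induction arbitrary: w rule: vfilt.induct)
  case (base q)
  then show ?case
  proof (induction rule: weight_span.induct)
    case (base m js)
    show ?case
    proof (rule ccontr)
      assume "theta as s w (xlift m * tmon js) \<noteq> 0"
      then obtain u where u: "u \<in> Poly_Mapping.keys m"
        "\<And>i. int (Poly_Mapping.lookup u i) = w i + (\<Sum>j\<leftarrow>js. int (expo as j i))"
        and count: "\<And>j n. s j = of_nat n \<Longrightarrow> count_list js j \<le> n"
        using theta_tmon_nonzero by blast
      obtain ks where ks: "length ks = length js + 1" "set ks \<subseteq> {..<length as}"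
        "\<And>i. (\<Sum>j\<leftarrow>ks. expo as j i) \<le> Poly_Mapping.lookup u i"
        using keys_monomial_ideal_power[OF _ u(1)] base by (metis length_map)
      define c where "c j = int (count_list ks j) - int (count_list js j)" for j
      have js: "set js \<subseteq> {..<length as}" using base by simp
      have "(\<Sum>j<length as. c j) = 1"
      proof -
        have "(\<Sum>j<length as. count_list xs j) = length xs" if "set xs \<subseteq> {..<length as}" for xs
          using sum_count_set[OF that] by simp
        from this[OF ks(2)] this[OF js] ks(1) show ?thesis
          by (simp add: c_def sum_subtractf flip: of_nat_sum)
      qed
      moreover have "- int n \<le> c j" if "s j = of_nat n" for j n
        using count[OF that] by (simp add: c_def)
      moreover have "ell as c i \<le> int n" if "ell as s i = - of_nat (Suc n)" for i n
      proof -
        have "ell as c i = (\<Sum>j\<leftarrow>ks. int (expo as j i)) - (\<Sum>j\<leftarrow>js. int (expo as j i))"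
          unfolding sum_list_expo[OF js] sum_list_expo[OF ks(2)]
          by (simp add: ell_def c_def right_diff_distrib sum_subtractf)
        moreover have "(\<Sum>j\<leftarrow>ks. int (expo as j i)) = int (\<Sum>j\<leftarrow>ks. expo as j i)"
          by (induction ks) auto
        ultimately show ?thesis
          using u(2)[of i] ks(3)[of i] base.prems[OF that] by simp
      qed
      ultimately show False
        using assms(1) unfolding root_point_def by blast
    qed
  qed (simp add: theta_add)
next
  case (add p q)
  then show ?case by (simp add: theta_add)
next
  case (nabla q i)
  show ?case
  proof (cases "ell as s i + of_int (w i) + 1 = 0")
    case False
    have "(w(i := w i + 1)) l \<le> int n" if l: "ell as s l = - of_nat (Suc n)" for l n
    proof (cases "l = i")
      case True
      have "w i \<noteq> int n" using False l True by auto
      with nabla.prems[OF l] True show ?thesis by simp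
    qed (use nabla.prems[OF l] in simp)
    then show ?thesis using nabla.IH by (simp add: theta_nabla del: fun_upd_apply)
  qed (simp add: theta_nabla)
qed

text \<open>
  At \<open>w = 0\<close> the functional \<open>theta\<close> takes \<open>b (\<Sum> s\<^sub>j)\<close>, applied to 1, to its value at the point.
\<close>

theorem root_point_imp_root:
  assumes "root_point as s" "bs_equation (map xmonom as) b"
  shows "poly b (\<Sum>j<length as. s j) = 0"
proof -
  have "(0 :: 'a cpoly) \<noteq> xmonom u" for u
    by (metis single_eq_zero xmonom_def one_neq_zero)
  then have "0 \<notin> set (map (xmonom :: _ \<Rightarrow> 'a cpoly) as)" by auto
  then have "b_act (map xmonom as) b \<in> vfilt (map xmonom as) 1"
    using assms(2) bs_equation_iff_vfilt by blast
  then have "theta as s (\<lambda>_. 0) (b_act (map xmonom as) b) = 0"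
    by (rule theta_vfilt[OF assms(1)]) simp
  then show ?thesis by (simp add: theta_b_act)
qed

section \<open>Polynomials that satisfy the functional equation\<close>

lemma b_eval_pCons:
  "poly (map_poly complex_const (pCons a p)) x = complex_const a + x * poly (map_poly complex_const p) x"
  by (simp add: map_poly_pCons)

lemma b_eval_add: "poly (map_poly complex_const (p + q)) x =
    poly (map_poly complex_const p) x + poly (map_poly complex_const q) x"
proof -
  have "map_poly complex_const (p + q) = map_poly complex_const p + (map_poly complex_const q :: 'a fs_module poly)"
    by (rule poly_eqI) (simp add: coeff_map_poly complex_const.coeff_add)
  then show ?thesis by simp
qed

lemma b_eval_mult: "poly (map_poly complex_const (p * q)) x =
    poly (map_poly complex_const p) x * poly (map_poly complex_const q) x"
proof (induction p)
  case (pCons a p)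
  have "map_poly complex_const (smult a q) = smult (complex_const a) (map_poly complex_const q :: 'a fs_module poly)"
    by (rule poly_eqI) (simp add: coeff_map_poly complex_const.coeff_mult)
  then have "poly (map_poly complex_const (smult a q)) x = complex_const a * poly (map_poly complex_const q) x"
    by simp
  with pCons show ?case
    by (simp only: mult_pCons_left b_eval_add b_eval_pCons) (simp add: algebra_simps)
qed simp

lemma bs_equation_add: "bs_equation fs p \<Longrightarrow> bs_equation fs q \<Longrightarrow> bs_equation fs (p + q)"
  by (simp add: bs_equation_iff_bs_module b_eval_add bs_module_add)

text \<open>
  \<open>\<Sum> s\<^sub>i\<close> is the sum of the operators \<open>s\<^sub>i\<^sub>i\<close>, so the polynomials \<open>b\<close> form an ideal.
\<close>

lemma bs_equation_mult:
  assumes "0 \<notin> set fs" "bs_equation fs q"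
  shows "bs_equation fs (p * q)"
proof -
  have "poly (map_poly complex_const p) (\<Sum>i<length fs. s_var i) * y \<in> bs_module fs"
    if "y \<in> bs_module fs" for y
  proof (induction p)
    case (pCons a p)
    have "(\<Sum>i<length fs. s_var i) * (poly (map_poly complex_const p) (\<Sum>i<length fs. s_var i) * y)
        \<in> bs_module fs"
      unfolding sum_distrib_right using pCons
      by (intro bs_module_sum bs_module_s_var assms(1)) auto
    moreover have "complex_const a * y \<in> bs_module fs"
      using that by (simp add: complex_const_eq bs_module_poly_const)
    ultimately show ?case
      by (simp add: b_eval_pCons distrib_right mult.assoc bs_module_add)
  qed simp
  with assms(2) show ?thesis by (simp add: bs_equation_iff_bs_module b_eval_mult)
qed

text \<open>
  If the vanishing of one factor of each product always forces \<open>h\<close> to be a number in \<open>R\<close>, then \<open>h\<close> is a root of a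
  polynomial with roots in \<open>R\<close> modulo the ideal of the products. This replaces the Nullstellensatz: factors are
  adjoined one product at a time, and \<open>p \<in> T + (x)\<close> and \<open>q \<in> T + (y)\<close> imply \<open>p q \<in> T + (x y)\<close>.
\<close>

lemma ideal_product_elimination:
  fixes T R :: "'a::comm_ring_1 set"
  assumes "ring_self.subspace T" "\<And>C. C \<in> set Cs \<Longrightarrow> prod_list C \<in> T"
    and "\<And>T'. \<lbrakk>ring_self.subspace T'; T \<subseteq> T'; \<And>C. C \<in> set Cs \<Longrightarrow> \<exists>x\<in>set C. x \<in> T'\<rbrakk>
      \<Longrightarrow> \<exists>\<alpha>\<in>R. h - \<alpha> \<in> T'"
  shows "\<exists>\<alpha>s. set \<alpha>s \<subseteq> R \<and> prod_list (map (\<lambda>\<alpha>. h - \<alpha>) \<alpha>s) \<in> T"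
  using assms
proof (induction Cs arbitrary: T)
  case Nil
  then obtain \<alpha> where "\<alpha> \<in> R" "h - \<alpha> \<in> T" by auto
  then show ?case by (intro exI[of _ "[\<alpha>]"]) simp
next
  case (Cons C Cs)
  note sub = Cons.prems(1) and products = Cons.prems(2) and hits = Cons.prems(3) and IH = Cons.IH
  have "\<exists>\<alpha>s. set \<alpha>s \<subseteq> R \<and> (\<exists>a. prod_list (map (\<lambda>\<alpha>. h - \<alpha>) \<alpha>s) - a * prod_list D \<in> T)"
    if "set D \<subseteq> set C" for D
    using that
  proof (induction D)
    case Nil
    have "prod_list (map (\<lambda>\<alpha>. h - \<alpha>) []) - 1 * prod_list [] \<in> T"
      using sub by (simp add: ring_self.subspace_0)
    then show ?case by (metis empty_subsetI list.set(1))
  next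
    case (Cons x D)
    then obtain \<alpha>s a where a: "set \<alpha>s \<subseteq> R" "prod_list (map (\<lambda>\<alpha>. h - \<alpha>) \<alpha>s) - a * prod_list D \<in> T"
      by auto
    let ?T = "{y. \<exists>a. y - a * x \<in> T}"
    have subT: "ring_self.subspace ?T"
    proof (rule ring_self.subspaceI)
      show "0 \<in> ?T" using sub by (auto simp: ring_self.subspace_0 intro!: exI[of _ 0])
    next
      fix y z assume "y \<in> ?T" "z \<in> ?T"
      then obtain a b where "y - a * x \<in> T" "z - b * x \<in> T" by blast
      then have "(y - a * x) + (z - b * x) \<in> T" using sub by (rule ring_self.subspace_add[rotated])
      then show "y + z \<in> ?T" by (auto simp: algebra_simps intro!: exI[of _ "a + b"])
    next
      fix c y assume "y \<in> ?T"
      then obtain a where "y - a * x \<in> T" by blast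
      then have "c * (y - a * x) \<in> T" by (rule ring_self.subspace_scale[OF sub])
      then show "c * y \<in> ?T" by (auto simp: algebra_simps intro!: exI[of _ "c * a"])
    qed
    have TT: "T \<subseteq> ?T" by (auto intro!: exI[of _ 0])
    have x: "x \<in> ?T" using sub by (auto simp: ring_self.subspace_0 intro!: exI[of _ 1])
    have hitsT: "\<exists>\<alpha>\<in>R. h - \<alpha> \<in> T'"
      if "ring_self.subspace T'" "?T \<subseteq> T'" "\<And>C. C \<in> set Cs \<Longrightarrow> \<exists>x\<in>set C. x \<in> T'" for T'
    proof (rule hits)
      show "T \<subseteq> T'" using TT that(2) by blast
      fix C' assume "C' \<in> set (C # Cs)"
      then show "\<exists>x\<in>set C'. x \<in> T'"
        using that(2,3) x Cons.prems by auto
    qed (fact that(1))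
    have "prod_list C' \<in> ?T" if "C' \<in> set Cs" for C'
      using products[of C'] that TT by (meson list.set_intros(2) subsetD)
    from IH[OF subT this hitsT]
    have "\<exists>\<beta>s. set \<beta>s \<subseteq> R \<and> prod_list (map (\<lambda>\<alpha>. h - \<alpha>) \<beta>s) \<in> ?T" .
    then obtain \<beta>s b where b: "set \<beta>s \<subseteq> R" "prod_list (map (\<lambda>\<alpha>. h - \<alpha>) \<beta>s) - b * x \<in> T"
      by blast
    let ?p = "prod_list (map (\<lambda>\<alpha>. h - \<alpha>) \<alpha>s)" and ?q = "prod_list (map (\<lambda>\<alpha>. h - \<alpha>) \<beta>s)"
    have "?p * (?q - b * x) + (b * x) * (?p - a * prod_list D) \<in> T"
      using a b sub by (intro ring_self.subspace_add ring_self.subspace_scale)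
    then have "?p * ?q - (a * b) * prod_list (x # D) \<in> T"
      by (simp add: algebra_simps)
    with a(1) b(1) show ?case
      by (intro exI[of _ "\<alpha>s @ \<beta>s"] conjI exI[of _ "a * b"]) auto
  qed
  then obtain \<alpha>s a where "set \<alpha>s \<subseteq> R" "prod_list (map (\<lambda>\<alpha>. h - \<alpha>) \<alpha>s) - a * prod_list C \<in> T"
    by blast
  moreover have "a * prod_list C \<in> T"
    using products sub by (intro ring_self.subspace_scale) auto
  ultimately have "(prod_list (map (\<lambda>\<alpha>. h - \<alpha>) \<alpha>s) - a * prod_list C) + a * prod_list C \<in> T"
    using sub by (intro ring_self.subspace_add)
  with \<open>set \<alpha>s \<subseteq> R\<close> show ?case by auto
qed

lemma xmonom_add: "xmonom (u + v) = xmonom u * xmonom v"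
  by (simp add: xmonom_def mult_single)

lemma xmonom_eq_prod:
  fixes u :: "'n::finite \<Rightarrow>\<^sub>0 nat"
  shows "xmonom u = (\<Prod>i\<in>UNIV. Var i ^ Poly_Mapping.lookup u i)"
proof (induction u rule: monomial_induct)
  case zero
  then show ?case by (simp add: xmonom_def)
next
  case (add_var v m)
  have "(\<Prod>i\<in>UNIV. Var i ^ Poly_Mapping.lookup (Poly_Mapping.single v 1) i) =
      (\<Prod>i\<in>UNIV. if i = v then Var v else 1 :: 'n cpoly)"
    by (intro prod.cong) (auto simp: lookup_single when_def)
  then have "(\<Prod>i\<in>UNIV. Var i ^ Poly_Mapping.lookup (Poly_Mapping.single v 1) i) = (Var v :: 'n cpoly)"
    by simp
  with add_var show ?case
    by (simp add: xmonom_add lookup_add power_add prod.distrib) (simp add: xmonom_def Var_def)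
qed

lemma Var_mult_mpderiv_xmonom:
  "Var i * mpderiv i (xmonom u) = of_nat (Poly_Mapping.lookup u i) * xmonom u"
proof (cases "Poly_Mapping.lookup u i = 0")
  case False
  then have "Poly_Mapping.single i 1 + (u - Poly_Mapping.single i 1) = u"
    by (intro poly_mapping_eqI) (auto simp: lookup_add lookup_minus lookup_single when_def)
  then show ?thesis
    by (simp add: xmonom_def mpderiv_single Cst_Var_mult_single) (simp flip: Cst_of_nat add: Cst_Var_mult_single)
qed (simp add: xmonom_def mpderiv_single)

lemma prod_xmonom_eq:
  fixes as :: "('n::finite \<Rightarrow>\<^sub>0 nat) list"
  shows "(\<Prod>j<length as. xmonom (as ! j) ^ \<mu> j) = (\<Prod>i\<in>UNIV. Var i ^ (\<Sum>j<length as. \<mu> j * expo as j i))"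
proof -
  have "(\<Prod>j<length as. xmonom (as ! j) ^ \<mu> j) =
      (\<Prod>j<length as. \<Prod>i\<in>UNIV. Var i ^ (\<mu> j * expo as j i))"
    by (intro prod.cong)
       (auto simp: xmonom_eq_prod expo_def prod_power_distrib power_mult[symmetric] mult.commute)
  also have "\<dots> = (\<Prod>i\<in>UNIV. \<Prod>j<length as. Var i ^ (\<mu> j * expo as j i))"
    by (rule prod.swap)
  finally show ?thesis by (simp add: power_sum)
qed

lemma prod_power_in_ideal_power:
  assumes "n \<le> length gs"
  shows "(\<Prod>j<n. (gs ! j) ^ \<mu> j) \<in> ideal_power (ideal_gen (set gs)) (\<Sum>j<n. \<mu> j)"
  using assms
proof (induction n)
  case (Suc n)
  note assms' = Suc.prems
  have "gs ! n ^ k * (\<Prod>j<n. (gs ! j) ^ \<mu> j) \<in> ideal_power (ideal_gen (set gs)) (k + (\<Sum>j<n. \<mu> j))" for k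
  proof (induction k)
    case (Suc k)
    have "gs ! n \<in> ideal_gen (set gs)"
      unfolding ideal_gen_eq_span using Suc_le_lessD[OF assms'] by (intro ring_self.span_base nth_mem)
    from ideal_power_mult[OF this Suc.IH] show ?case by (simp add: mult.assoc)
  qed (use Suc in simp)
  from this[of "\<mu> n"] show ?case by (simp add: mult.commute add.commute)
qed simp

lemma s_shift_fall_other:
  assumes "i \<noteq> j"
  shows "s_shift j c (fall F i n) = fall F i n"
  using assms by (simp add: fall_def s_shift_prod s_shift_mult s_shift_diff s_shift_s_var)

lemma mellin_prod_tau:
  "mellin F (xlift m * (\<Prod>j<n. tau j ^ \<nu> j)) = poly_const m * (\<Prod>j<n. fall F j (\<nu> j))"
proof (induction n)
  case (Suc n)
  let ?h = "poly_const m * (\<Prod>j<n. fall F j (\<nu> j))"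
  have inv: "s_shift n (-1) ?h = ?h"
    by (simp add: s_shift_mult s_shift_prod s_shift_fall_other)
  have "mellin F (tau n ^ k * (xlift m * (\<Prod>j<n. tau j ^ \<nu> j))) = fall F n k * ?h" for k
  proof (induction k)
    case 0
    then show ?case using Suc.IH by (simp add: fall_def)
  next
    case (Suc k)
    then show ?case by (simp add: mult.assoc tau_op_fall_mult[OF inv])
  qed
  from this[of "\<nu> n"] show ?case by (simp add: mult_ac)
qed simp

lemma prod_tau_eq_tmon:
  "\<exists>js. tmon js = (\<Prod>j<n. (tau j :: 'n tpoly) ^ \<nu> j) \<and> length js = (\<Sum>j<n. \<nu> j) \<and> set js \<subseteq> {..<n}"
proof (induction n)
  case (Suc n)
  then obtain js where "tmon js = (\<Prod>j<n. (tau j :: 'n tpoly) ^ \<nu> j)" "length js = (\<Sum>j<n. \<nu> j)" "set js \<subseteq> {..<n}"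
    by blast
  moreover have "tmon (replicate k n) = (tau n :: 'n tpoly) ^ k" for k
    by (simp add: tmon_def)
  ultimately show ?case by (intro exI[of _ "js @ replicate (\<nu> n) n"]) auto
qed (auto intro: exI[of _ "[]"])

lemma poly_const_power_mult_fall:
  assumes "F j \<noteq> 0"
  shows "poly_const (F j) ^ n * fall F j n = (\<Prod>v<n. of_nat v - s_var j)"
proof -
  have "poly_const (F j) ^ n * fall F j n =
      (\<Prod>v<n. poly_const (F j) * ((of_nat v - s_var j) * rat_const (Fract 1 (F j))))"
    by (simp add: fall_def prod.distrib)
  also have "\<dots> = (\<Prod>v<n. of_nat v - s_var j)"
    by (intro prod.cong) (use poly_const_times_inverse[OF assms] in \<open>auto simp: mult.left_commute\<close>)
  finally show ?thesis .
qed

lemma monomial_gens_nonzero: "0 \<notin> set (map xmonom as)"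
  by (auto simp: xmonom_def) (metis single_eq_zero one_neq_zero)

lemma poly_const_of_nat: "poly_const (of_nat n) = of_nat n"
  by (induction n) (simp_all add: poly_const.coeff_add)

lemma poly_const_prod: "poly_const (prod f A) = (\<Prod>a\<in>A. poly_const (f a))"
  by (induction A rule: infinite_finite_induct) (auto simp: poly_const.coeff_mult)

lemma poly_const_power: "poly_const (p ^ n) = poly_const p ^ n"
  by (induction n) (auto simp: poly_const.coeff_mult)

text \<open>
  The left-hand side is the Mellin transform of \<open>x\<^sup>\<beta> f\<^sup>\<nu> \<tau>\<^sup>\<nu>\<close>, and \<open>x\<^sup>\<beta> f\<^sup>\<nu>\<close> is divisible by \<open>f\<^sup>\<mu>\<close>.
\<close>

lemma monomial_times_falling_in_bs_module:
  fixes as :: "('n::{finite,linorder} \<Rightarrow>\<^sub>0 nat) list"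
  assumes "(\<Sum>j<length as. \<mu> j) = Suc (\<Sum>j<length as. \<nu> j)"
    and "\<And>i. (\<Sum>j<length as. \<mu> j * expo as j i) \<le> \<beta> i + (\<Sum>j<length as. \<nu> j * expo as j i)"
  shows "poly_const (\<Prod>i\<in>UNIV. Var i ^ \<beta> i) * (\<Prod>j<length as. \<Prod>v<\<nu> j. of_nat v - s_var j)
    \<in> bs_module (map xmonom as)"
proof -
  let ?gs = "map xmonom as :: 'n cpoly list"
  let ?r = "length as"
  define m where "m = (\<Prod>i\<in>UNIV. Var i ^ \<beta> i) * (\<Prod>j<?r. (?gs ! j) ^ \<nu> j)"
  have gs: "(\<Prod>j<?r. (?gs ! j) ^ \<kappa> j) = (\<Prod>i\<in>UNIV. Var i ^ (\<Sum>j<?r. \<kappa> j * expo as j i))" for \<kappa>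
    using prod_xmonom_eq[of as \<kappa>] by simp
  have "m = (\<Prod>i\<in>UNIV. Var i ^ (\<beta> i + (\<Sum>j<?r. \<nu> j * expo as j i)))"
    unfolding m_def gs by (simp add: power_add prod.distrib)
  also have "\<dots> = (\<Prod>i\<in>UNIV. Var i ^ (\<beta> i + (\<Sum>j<?r. \<nu> j * expo as j i) - (\<Sum>j<?r. \<mu> j * expo as j i)))
      * (\<Prod>j<?r. (?gs ! j) ^ \<mu> j)"
    unfolding gs prod.distrib[symmetric] power_add[symmetric] using assms(2) by simp
  finally have "m \<in> ideal_power (ideal_gen (set ?gs)) (Suc (\<Sum>j<?r. \<nu> j))"
    using prod_power_in_ideal_power[of ?r ?gs \<mu>] assms(1) by (simp add: ideal_power_mult_left)
  moreover obtain js where js: "tmon js = (\<Prod>j<?r. (tau j :: 'n tpoly) ^ \<nu> j)" "length js = (\<Sum>j<?r. \<nu> j)"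
    "set js \<subseteq> {..<?r}"
    using prod_tau_eq_tmon by blast
  ultimately have "mellin (pad ?gs) (xlift m * tmon js) \<in> bs_module ?gs"
    by (intro mellin_monomial_in_bs_module monomial_gens_nonzero) auto
  then have "poly_const m * (\<Prod>j<?r. fall (pad ?gs) j (\<nu> j)) \<in> bs_module ?gs"
    unfolding js(1) mellin_prod_tau .
  also have "poly_const m * (\<Prod>j<?r. fall (pad ?gs) j (\<nu> j)) =
      poly_const (\<Prod>i\<in>UNIV. Var i ^ \<beta> i) * (\<Prod>j<?r. poly_const (pad ?gs j) ^ \<nu> j * fall (pad ?gs) j (\<nu> j))"
    unfolding m_def by (simp add: poly_const.coeff_mult poly_const_prod poly_const_power pad_def
        prod.distrib mult.assoc)
  also have "\<dots> = poly_const (\<Prod>i\<in>UNIV. Var i ^ \<beta> i) * (\<Prod>j<?r. \<Prod>v<\<nu> j. of_nat v - s_var j)"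
    by (simp add: poly_const_power_mult_fall pad_nonzero[OF monomial_gens_nonzero])
  finally show ?thesis .
qed

lemma deriv_op_monomial:
  fixes H :: "'n::linorder fs_module"
  assumes "coeff_deriv i H = 0"
  shows "deriv_op (map xmonom as) i (poly_const (Var i) ^ Suc b * H) =
    poly_const (Var i) ^ b * ((ell as s_var i + of_nat (Suc b)) * H)"
proof -
  let ?X = "poly_const (Var i) :: 'n fs_module"
  have power: "coeff_deriv i (?X ^ Suc b) = of_nat (Suc b) * ?X ^ b"
    by (induction b) (auto simp: coeff_deriv_mult mpderiv_Var algebra_simps)
  have 1: "?X * (s_var j * rat_const (Fract (mpderiv i (xmonom (as ! j))) (xmonom (as ! j)))) =
      of_nat (expo as j i) * s_var j" if j: "j < length as" for j
  proof -
    have "xmonom (as ! j) \<noteq> 0" by (simp add: xmonom_def single_eq_zero)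
    then have inv: "poly_const (xmonom (as ! j)) * rat_const (Fract 1 (xmonom (as ! j))) = 1"
      by (rule poly_const_times_inverse)
    have X: "?X * poly_const (mpderiv i (xmonom (as ! j))) =
        of_nat (expo as j i) * poly_const (xmonom (as ! j))"
      unfolding poly_const.coeff_mult[symmetric] Var_mult_mpderiv_xmonom
      using j by (simp add: poly_const.coeff_mult expo_def poly_const_of_nat)
    have "rat_const (Fract (mpderiv i (xmonom (as ! j))) (xmonom (as ! j))) =
        poly_const (mpderiv i (xmonom (as ! j))) * rat_const (Fract 1 (xmonom (as ! j)))"
      by (simp add: poly_const_def rat_const_def mult_single)
    then have "?X * (s_var j * rat_const (Fract (mpderiv i (xmonom (as ! j))) (xmonom (as ! j)))) =
        s_var j * ((?X * poly_const (mpderiv i (xmonom (as ! j)))) * rat_const (Fract 1 (xmonom (as ! j))))"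
      by (simp add: mult_ac)
    also have "\<dots> = of_nat (expo as j i) * s_var j"
      unfolding X mult.assoc[of "of_nat (expo as j i)"] inv by (simp add: mult.commute)
    finally show ?thesis .
  qed
  have "deriv_op (map xmonom as) i (?X ^ Suc b * H) = of_nat (Suc b) * ?X ^ b * H
      + ?X ^ b * H * (\<Sum>j<length as. ?X * (s_var j * rat_const (Fract (mpderiv i (xmonom (as ! j))) (xmonom (as ! j)))))"
    unfolding deriv_op_eq coeff_deriv_mult power assms
    by (simp add: sum_distrib_left sum_distrib_right mult_ac)
  also have "(\<Sum>j<length as. ?X * (s_var j * rat_const (Fract (mpderiv i (xmonom (as ! j))) (xmonom (as ! j)))))
      = ell as s_var i"
    unfolding ell_def by (intro sum.cong) (simp_all add: 1)
  finally show ?thesis by (simp add: algebra_simps)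
qed

lemma coeff_deriv_prod_zero:
  "(\<And>a. a \<in> A \<Longrightarrow> coeff_deriv i (f a) = 0) \<Longrightarrow> coeff_deriv i (prod f A) = 0"
  by (induction A rule: infinite_finite_induct) (auto simp: coeff_deriv_mult)

lemma coeff_deriv_power_zero: "coeff_deriv i h = 0 \<Longrightarrow> coeff_deriv i (h ^ n) = 0"
  by (induction n) (auto simp: coeff_deriv_mult)

lemma coeff_deriv_of_nat [simp]: "coeff_deriv i (of_nat n) = 0"
  by (metis coeff_deriv_of_int of_int_of_nat_eq)

lemma coeff_deriv_diff: "coeff_deriv i (g - h) = coeff_deriv i g - coeff_deriv i h"
  using coeff_deriv_add[of i g "- h"] by (simp add: coeff_deriv_uminus)

lemma coeff_deriv_sum: "coeff_deriv i (sum f A) = (\<Sum>a\<in>A. coeff_deriv i (f a))"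
  by (induction A rule: infinite_finite_induct) (auto simp: coeff_deriv_add)

lemma coeff_deriv_ell [simp]: "coeff_deriv i (ell as s_var l) = 0"
  by (simp add: ell_def coeff_deriv_sum coeff_deriv_mult)

text \<open>
  Differentiate \<open>b\<close> times with respect to \<open>x\<^sub>i\<close>.
\<close>

lemma bs_module_replace_power:
  assumes "poly_const (Var i) ^ b * H \<in> bs_module (map xmonom as)" "coeff_deriv i H = 0"
  shows "(\<Prod>w<b. ell as s_var i + of_nat (Suc w)) * H \<in> bs_module (map xmonom as)"
  using assms
proof (induction b arbitrary: H)
  case (Suc b)
  have "poly_const (Var i) ^ b * ((ell as s_var i + of_nat (Suc b)) * H) \<in> bs_module (map xmonom as)"
    using bs_module_op[OF Suc.prems(1) deriv_op_in_bs_ops] deriv_op_monomial[OF Suc.prems(2)] by metis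
  moreover have "coeff_deriv i ((ell as s_var i + of_nat (Suc b)) * H) = 0"
    by (simp add: coeff_deriv_mult coeff_deriv_add Suc.prems(2) del: of_nat_Suc)
  ultimately have "(\<Prod>w<b. ell as s_var i + of_nat (Suc w)) * ((ell as s_var i + of_nat (Suc b)) * H)
      \<in> bs_module (map xmonom as)"
    by (rule Suc.IH)
  then show ?case by (simp add: mult.assoc)
qed simp

text \<open>
  The powers of the \<open>x\<^sub>i\<close> in \<open>monomial_times_falling_in_bs_module\<close> are traded for linear factors, one variable at a
  time.
\<close>

lemma binomial_products_in_bs_module:
  fixes as :: "('n::{finite,linorder} \<Rightarrow>\<^sub>0 nat) list"
  assumes "(\<Sum>j<length as. \<mu> j) = Suc (\<Sum>j<length as. \<nu> j)"
    and "\<And>i. (\<Sum>j<length as. \<mu> j * expo as j i) \<le> \<beta> i + (\<Sum>j<length as. \<nu> j * expo as j i)"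
  shows "(\<Prod>i\<in>UNIV. \<Prod>w<\<beta> i. ell as s_var i + of_nat (Suc w)) *
    (\<Prod>j<length as. \<Prod>v<\<nu> j. of_nat v - s_var j) \<in> bs_module (map xmonom as)"
proof -
  let ?S = "\<Prod>j<length as. \<Prod>v<\<nu> j. of_nat v - s_var j :: 'n fs_module"
  let ?L = "\<lambda>i. \<Prod>w<\<beta> i. ell as s_var i + of_nat (Suc w) :: 'n fs_module"
  let ?X = "\<lambda>i. poly_const (Var i) ^ \<beta> i :: 'n fs_module"
  have "(\<Prod>i\<in>A. ?L i) * (\<Prod>i\<in>- A. ?X i) * ?S \<in> bs_module (map xmonom as)" for A :: "'n set"
  proof (induction A rule: infinite_finite_induct)
    case empty
    then show ?case
      using monomial_times_falling_in_bs_module[OF assms] by (simp add: poly_const_prod poly_const_power)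
  next
    case (insert i A)
    let ?H = "(\<Prod>l\<in>A. ?L l) * (\<Prod>l\<in>- insert i A. ?X l) * ?S"
    have "- A = insert i (- insert i A)" using insert by auto
    then have "(\<Prod>l\<in>- A. ?X l) = ?X i * (\<Prod>l\<in>- insert i A. ?X l)"
      by (metis (no_types, lifting) ComplD finite insertI1 prod.insert)
    with insert.IH have "?X i * ?H \<in> bs_module (map xmonom as)"
      by (simp add: mult_ac)
    moreover have "coeff_deriv i ?H = 0"
    proof -
      have "coeff_deriv i (\<Prod>l\<in>A. ?L l) = 0"
        by (intro coeff_deriv_prod_zero) (simp add: coeff_deriv_add del: of_nat_Suc)
      moreover have "coeff_deriv i (\<Prod>l\<in>- insert i A. ?X l) = 0"
        by (intro coeff_deriv_prod_zero coeff_deriv_power_zero) (auto simp: mpderiv_Var)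
      moreover have "coeff_deriv i ?S = 0"
        by (intro coeff_deriv_prod_zero) (simp add: coeff_deriv_diff)
      ultimately show ?thesis by (simp add: coeff_deriv_mult)
    qed
    ultimately have "?L i * ?H \<in> bs_module (map xmonom as)"
      by (rule bs_module_replace_power)
    then show ?case using insert by (simp add: mult_ac)
  qed simp
  from this[of UNIV] show ?thesis by simp
qed

text \<open>
  The elimination takes place in the polynomial ring \<open>\<complex>[s]\<close>, whose variables beyond the list of generators are
  sent to 0, because only the other ones preserve the right-hand sides of the functional equation.
\<close>

definition to_module :: "nat \<Rightarrow> nat cpoly \<Rightarrow> 'n::linorder fs_module" where
  "to_module r = poly_subst complex_const (\<lambda>j. if j < r then s_var j else 0)"

lemma to_module_simps [simp]: "to_module r 0 = 0" "to_module r 1 = 1"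
    "to_module r (Cst c) = complex_const c" "to_module r (of_nat n) = of_nat n"
    "to_module r (Var j) = (if j < r then s_var j else 0)"
  and to_module_add: "to_module r (p + q) = to_module r p + to_module r q"
  and to_module_diff: "to_module r (p - q) = to_module r p - to_module r q"
  and to_module_mult: "to_module r (p * q) = to_module r p * to_module r q"
  and to_module_sum: "to_module r (sum f A) = (\<Sum>a\<in>A. to_module r (f a))"
  and to_module_prod: "to_module r (prod f A) = (\<Prod>a\<in>A. to_module r (f a))"
  and to_module_prod_list: "to_module r (prod_list xs) = prod_list (map (to_module r) xs)"
  by (simp_all add: to_module_def complex_const.poly_subst_add complex_const.poly_subst_mult
      complex_const.poly_subst_diff complex_const.poly_subst_sum complex_const.poly_subst_prod
      complex_const.poly_subst_prod_list)

lemma subspace_to_module_bs_module: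
  assumes "0 \<notin> set fs"
  shows "ring_self.subspace {p. to_module (length fs) p \<in> bs_module fs}"
proof -
  have "to_module (length fs) p * y \<in> bs_module fs" if "y \<in> bs_module fs" for p y
    using that
  proof (induction p rule: mpoly_induct)
    case (Cst c)
    then show ?case by (simp add: complex_const_eq bs_module_poly_const)
  next
    case (Var j p)
    then show ?case by (simp add: to_module_mult mult.assoc bs_module_s_var[OF assms])
  next
    case (add p q)
    then show ?case by (simp add: to_module_add distrib_right bs_module_add)
  qed
  then show ?thesis
    by (intro ring_self.subspaceI) (auto simp: to_module_add to_module_mult bs_module_add)
qed

lemma to_module_ell: "to_module (length as) (ell as Var i) = ell as s_var i"
  by (simp add: ell_def to_module_sum to_module_mult)

lemma poly_prod_linear_factors:
  "poly (map_poly complex_const (\<Prod>\<alpha>\<leftarrow>\<alpha>s. [:- \<alpha>, 1:])) x = (\<Prod>\<alpha>\<leftarrow>\<alpha>s. x - complex_const \<alpha>)"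
proof (induction \<alpha>s)
  case (Cons \<alpha> \<alpha>s)
  have "poly (map_poly complex_const [:- \<alpha>, 1:]) x = x - complex_const \<alpha>"
    using complex_const.coeff_add[of \<alpha> "- \<alpha>"]
    by (simp only: b_eval_pCons) (simp add: eq_neg_iff_add_eq_0 add.commute)
  with Cons show ?case by (simp only: list.map prod_list.Cons b_eval_mult)
qed simp

text \<open>
  The linear factors of the product \<open>G\<^sub>c\<close> of the introduction.
\<close>

definition factors :: "('n::{finite,linorder} \<Rightarrow>\<^sub>0 nat) list \<Rightarrow> (nat \<Rightarrow> int) \<Rightarrow> nat cpoly list" where
  "factors as c =
     concat (map (\<lambda>i. map (\<lambda>w. ell as Var i + of_nat (Suc w)) [0..<nat (ell as c i)])
       (sorted_list_of_set UNIV)) @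
     concat (map (\<lambda>j. map (\<lambda>v. of_nat v - Var j) [0..<nat (- c j)]) [0..<length as])"

lemma factors_cases:
  assumes "x \<in> set (factors as c)"
  obtains i w where "x = ell as Var i + of_nat (Suc w)" "0 < ell as c i"
    | j v where "x = of_nat v - Var j" "j < length as" "c j < 0"
  using assms by (auto simp: factors_def zless_nat_eq_int_zless)

lemma prod_list_concat: "prod_list (concat xss) = prod_list (map prod_list xss)"
  by (induction xss) auto

lemma prod_list_factors: "prod_list (factors as c) =
    (\<Prod>i\<in>UNIV. \<Prod>w<nat (ell as c i). ell as Var i + of_nat (Suc w)) *
    (\<Prod>j<length as. \<Prod>v<nat (- c j). of_nat v - Var j)"
proof -
  have "prod_list (map f [0..<n]) = (\<Prod>i<n. f i)" for f :: "nat \<Rightarrow> nat cpoly" and n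
    by (induction n) (auto simp: mult.commute)
  moreover have "prod_list (map f (sorted_list_of_set UNIV)) = (\<Prod>i\<in>UNIV. f i)" for f :: "'a \<Rightarrow> nat cpoly"
    using prod.distinct_set_conv_list[of "sorted_list_of_set UNIV" f] by simp
  ultimately show ?thesis
    by (simp only: factors_def prod_list.append prod_list_concat map_map o_def)
qed

text \<open>
  Apply \<open>binomial_products_in_bs_module\<close> to the positive part \<open>\<mu>\<close> and the negative part \<open>\<nu>\<close> of \<open>c\<close>.
\<close>

lemma factors_in_bs_module:
  fixes as :: "('n::{finite,linorder} \<Rightarrow>\<^sub>0 nat) list"
  assumes "(\<Sum>j<length as. c j) = 1"
  shows "(to_module (length as) (prod_list (factors as c)) :: 'n fs_module) \<in> bs_module (map xmonom as)"
proof -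
  let ?r = "length as"
  have split: "c j = int (nat (c j)) - int (nat (- c j))" for j by simp
  have "int (\<Sum>j<?r. nat (c j)) - int (\<Sum>j<?r. nat (- c j)) = (\<Sum>j<?r. c j)"
    by (subst (3) split) (simp add: sum_subtractf)
  then have 1: "(\<Sum>j<?r. nat (c j)) = Suc (\<Sum>j<?r. nat (- c j))" using assms by linarith
  have 2: "(\<Sum>j<?r. nat (c j) * expo as j i) \<le> nat (ell as c i) + (\<Sum>j<?r. nat (- c j) * expo as j i)" for i
  proof -
    have "ell as c i = (\<Sum>j<?r. int (expo as j i) * (int (nat (c j)) - int (nat (- c j))))"
      unfolding ell_def using split by (intro sum.cong) auto
    also have "\<dots> = int (\<Sum>j<?r. nat (c j) * expo as j i) - int (\<Sum>j<?r. nat (- c j) * expo as j i)"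
      by (simp add: right_diff_distrib sum_subtractf mult.commute)
    finally show ?thesis by linarith
  qed
  have "(to_module ?r (prod_list (factors as c)) :: 'n fs_module) =
      (\<Prod>i\<in>UNIV. \<Prod>w<nat (ell as c i). ell as s_var i + of_nat (Suc w)) *
      (\<Prod>j<?r. \<Prod>v<nat (- c j). of_nat v - s_var j)"
    unfolding prod_list_factors to_module_mult to_module_prod to_module_add to_module_ell
      to_module_diff to_module_simps
    by (intro arg_cong2[of _ _ _ _ "(*)"] prod.cong refl) auto
  then show ?thesis
    using binomial_products_in_bs_module[OF 1 2] by simp
qed

text \<open>
  For an ideal that contains a factor of each \<open>G\<^sub>c\<close>, the sets \<open>J\<close> and \<open>I\<close> consist of the indices of all factors that
  it contains. The coefficients \<open>\<mu>\<close> express \<open>\<Sum> s\<^sub>j\<close> through the \<open>l\<^sub>i(s)\<close> with \<open>i \<in> I\<close> and the \<open>s\<^sub>j\<close> with \<open>j \<in> J\<close>, which are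
  congruent to the numbers \<open>- w\<^sub>i\<close> and \<open>v\<^sub>j\<close> modulo the ideal.
\<close>

theorem bs_equation_from_directions:
  fixes as :: "('n::{finite,linorder} \<Rightarrow>\<^sub>0 nat) list" and Cs :: "(nat \<Rightarrow> int) list" and R :: "complex set"
  assumes "\<And>c. c \<in> set Cs \<Longrightarrow> (\<Sum>j<length as. c j) = 1"
    and relation: "\<And>J I. \<lbrakk>\<And>c. c \<in> set Cs \<Longrightarrow> (\<exists>j\<in>J. j < length as \<and> c j < 0) \<or> (\<exists>i\<in>I. ell as c i > 0)\<rbrakk> \<Longrightarrow>
      \<exists>\<mu>. (\<forall>i. i \<notin> I \<longrightarrow> \<mu> i = 0) \<and>
        (\<forall>j<length as. j \<notin> J \<longrightarrow> (\<Sum>i\<in>UNIV. \<mu> i * of_nat (expo as j i)) = 1) \<and>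
        (\<forall>v w. - (\<Sum>i\<in>UNIV. \<mu> i * of_nat (w i))
          - (\<Sum>j<length as. ((\<Sum>i\<in>UNIV. \<mu> i * of_nat (expo as j i)) - 1) * of_nat (v j)) \<in> R)"
  shows "\<exists>\<alpha>s. set \<alpha>s \<subseteq> R \<and> bs_equation (map xmonom as) (\<Prod>\<alpha>\<leftarrow>\<alpha>s. [:- \<alpha>, 1:])"
proof -
  let ?r = "length as" and ?gs = "map xmonom as :: 'n cpoly list"
  define h where "h = (\<Sum>j<?r. Var j :: nat cpoly)"
  let ?T = "{p. to_module ?r p \<in> bs_module ?gs}"
  have "\<exists>\<alpha>s. set \<alpha>s \<subseteq> Cst ` R \<and> prod_list (map (\<lambda>\<alpha>. h - \<alpha>) \<alpha>s) \<in> ?T"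
  proof (rule ideal_product_elimination[where Cs = "map (factors as) Cs"])
    show "ring_self.subspace ?T"
      using subspace_to_module_bs_module[OF monomial_gens_nonzero, of as] by simp
    show "prod_list C \<in> ?T" if "C \<in> set (map (factors as) Cs)" for C
      using that assms(1) factors_in_bs_module by auto
    fix T' assume sub: "ring_self.subspace T'"
      and hits: "\<And>C. C \<in> set (map (factors as) Cs) \<Longrightarrow> \<exists>x\<in>set C. x \<in> T'"
    define J where "J = {j. \<exists>v. of_nat v - Var j \<in> T'}"
    define I where "I = {i. \<exists>w. ell as Var i + of_nat (Suc w) \<in> T'}"
    define v where "v j = (SOME v. of_nat v - Var j \<in> T')" for j
    define w where "w i = (SOME w. ell as Var i + of_nat w \<in> T')" for i
    have v: "of_nat (v j) - Var j \<in> T'" if "j \<in> J" for j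
      using that unfolding J_def v_def by (auto intro: someI_ex)
    have w: "ell as Var i + of_nat (w i) \<in> T'" if "i \<in> I" for i
      using that unfolding I_def w_def mem_Collect_eq by (metis (mono_tags, lifting) someI_ex)
    have "(\<exists>j\<in>J. j < ?r \<and> c j < 0) \<or> (\<exists>i\<in>I. ell as c i > 0)" if c: "c \<in> set Cs" for c
    proof -
      obtain x where x: "x \<in> set (factors as c)" "x \<in> T'" using hits[of "factors as c"] c by auto
      from x(1) show ?thesis
      proof (cases rule: factors_cases)
        case (1 i w)
        then have "i \<in> I" using x(2) unfolding I_def by auto
        with 1 show ?thesis by blast
      next
        case (2 j v)
        then have "j \<in> J" using x(2) unfolding J_def by auto
        with 2 show ?thesis by blast
      qed
    qed
    from relation[OF this] obtain \<mu> :: "'n \<Rightarrow> complex" where \<mu>: "\<And>i. i \<notin> I \<Longrightarrow> \<mu> i = 0"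
      "\<And>j. j < ?r \<Longrightarrow> j \<notin> J \<Longrightarrow> (\<Sum>i\<in>UNIV. \<mu> i * of_nat (expo as j i)) = 1"
      and R: "\<And>v w. - (\<Sum>i\<in>UNIV. \<mu> i * of_nat (w i))
          - (\<Sum>j<?r. ((\<Sum>i\<in>UNIV. \<mu> i * of_nat (expo as j i)) - 1) * of_nat (v j)) \<in> R"
      by blast
    define \<kappa> where "\<kappa> j = (\<Sum>i\<in>UNIV. \<mu> i * of_nat (expo as j i)) - 1" for j
    define \<alpha> where "\<alpha> = - (\<Sum>i\<in>UNIV. \<mu> i * of_nat (w i)) - (\<Sum>j<?r. \<kappa> j * of_nat (v j))"
    have "(\<Sum>i\<in>UNIV. Cst (\<mu> i) * ell as Var i) = (\<Sum>j<?r. Cst (\<kappa> j + 1) * Var j)"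
      unfolding ell_def \<kappa>_def sum_distrib_left
      by (subst sum.swap) (simp add: Cst_sum Cst_mult sum_distrib_right mult.assoc)
    then have "h - Cst \<alpha> = (\<Sum>i\<in>UNIV. Cst (\<mu> i) * (ell as Var i + of_nat (w i)))
        + (\<Sum>j<?r. Cst (\<kappa> j) * (of_nat (v j) - Var j))"
      by (simp add: \<alpha>_def h_def Cst_add Cst_uminus Cst_diff Cst_sum Cst_mult distrib_left distrib_right
          right_diff_distrib sum.distrib sum_subtractf)
    moreover have "Cst (\<mu> i) * (ell as Var i + of_nat (w i)) \<in> T'" for i
      using \<mu>(1)[of i] w[of i] sub
      by (cases "i \<in> I") (auto simp: ring_self.subspace_0 intro: ring_self.subspace_scale)
    moreover have "Cst (\<kappa> j) * (of_nat (v j) - Var j) \<in> T'" if "j < ?r" for j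
      using \<mu>(2)[OF that] v[of j] sub
      by (cases "j \<in> J") (auto simp: \<kappa>_def ring_self.subspace_0 intro: ring_self.subspace_scale)
    ultimately have "h - Cst \<alpha> \<in> T'"
      using sub by (auto intro!: ring_self.subspace_add ring_self.subspace_sum)
    moreover have "\<alpha> \<in> R" unfolding \<alpha>_def \<kappa>_def by (rule R)
    ultimately show "\<exists>\<beta>\<in>Cst ` R. h - \<beta> \<in> T'" by blast
  qed
  then obtain \<beta>s where \<beta>s: "set \<beta>s \<subseteq> Cst ` R" "prod_list (map (\<lambda>\<alpha>. h - \<alpha>) \<beta>s) \<in> ?T" by blast
  from \<beta>s(1) have "\<exists>\<alpha>s. set \<alpha>s \<subseteq> R \<and> \<beta>s = map Cst \<alpha>s"
  proof (induction \<beta>s)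
    case (Cons \<beta> \<beta>s)
    then obtain \<alpha> \<alpha>s where "\<beta> = Cst \<alpha>" "\<alpha> \<in> R" "set \<alpha>s \<subseteq> R" "\<beta>s = map Cst \<alpha>s" by auto
    then show ?case by (intro exI[of _ "\<alpha> # \<alpha>s"]) simp
  qed simp
  then obtain \<alpha>s where \<alpha>s: "set \<alpha>s \<subseteq> R" "\<beta>s = map Cst \<alpha>s" by blast
  have "(to_module ?r h :: 'n fs_module) = (\<Sum>j<?r. s_var j)" by (simp add: h_def to_module_sum)
  then have "(\<Prod>\<alpha>\<leftarrow>\<alpha>s. (\<Sum>j<?r. s_var j) - complex_const \<alpha>) \<in> bs_module ?gs"
    using \<beta>s(2) by (simp add: \<alpha>s(2) to_module_prod_list to_module_diff o_def)
  then have "bs_equation ?gs (\<Prod>\<alpha>\<leftarrow>\<alpha>s. [:- \<alpha>, 1:])"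
    by (simp add: bs_equation_iff_bs_module poly_prod_linear_factors)
  with \<alpha>s(1) show ?thesis by blast
qed

section \<open>Linear inequalities over the rationals\<close>

text \<open>
  The consequences \<open>a \<bullet> x \<le> b\<close> of a system of inequalities that are nonnegative combinations of its members. The
  inductive form lets one extract certificates by rule induction.
\<close>

inductive_set farkas_cone :: "(('i \<Rightarrow> 'a) \<times> 'a) set \<Rightarrow> (('i \<Rightarrow> 'a) \<times> 'a::linordered_field) set"
  for C :: "(('i \<Rightarrow> 'a) \<times> 'a) set" where
  zero: "(\<lambda>_. 0, 0) \<in> farkas_cone C"
| gen: "(a, b) \<in> C \<Longrightarrow> 0 \<le> c \<Longrightarrow> (\<lambda>i. c * a i, c * b) \<in> farkas_cone C"
| add: "(a, b) \<in> farkas_cone C \<Longrightarrow> (a', b') \<in> farkas_cone C \<Longrightarrow>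
    (\<lambda>i. a i + a' i, b + b') \<in> farkas_cone C"

lemma farkas_cone_scale:
  "(a, b) \<in> farkas_cone C \<Longrightarrow> 0 \<le> c \<Longrightarrow> (\<lambda>i. c * a i, c * b) \<in> farkas_cone C"
proof (induction rule: farkas_cone.induct)
  case (gen a b d)
  then show ?case using farkas_cone.gen[of a b C "c * d"] by (simp add: mult.assoc)
next
  case (add a b a' b')
  then show ?case using farkas_cone.add[of "\<lambda>i. c * a i" "c * b" C] by (simp add: distrib_left)
qed (simp add: farkas_cone.zero)

lemma farkas_cone_subset:
  assumes "C' \<subseteq> farkas_cone C"
  shows "farkas_cone C' \<subseteq> farkas_cone C"
proof (rule subrelI)
  fix a b assume "(a, b) \<in> farkas_cone C'"
  then show "(a, b) \<in> farkas_cone C"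
    by (induction rule: farkas_cone.induct)
       (use assms in \<open>auto intro: farkas_cone.zero farkas_cone.add farkas_cone_scale\<close>)
qed

lemma exists_between_finite:
  fixes L U :: "'a::linordered_field set"
  assumes "finite L" "finite U" "\<And>l u. l \<in> L \<Longrightarrow> u \<in> U \<Longrightarrow> l \<le> u"
  shows "\<exists>z. (\<forall>l\<in>L. l \<le> z) \<and> (\<forall>u\<in>U. z \<le> u)"
proof (cases "L = {}")
  case True
  show ?thesis
  proof (cases "U = {}")
    case False
    with True assms show ?thesis by (intro exI[of _ "Min U"]) auto
  qed (use True in auto)
next
  case False
  with assms show ?thesis by (intro exI[of _ "Max L"]) auto
qed

text \<open>
  Fourier-Motzkin elimination of one variable after the other, which works over any ordered field. Below, the field
  of rational numbers matters, because integral vectors are made from the certificates.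
\<close>

theorem farkas:
  fixes C :: "(('i \<Rightarrow> 'a) \<times> 'a::linordered_field) set"
  assumes "finite A" "finite C" "\<And>a b i. (a, b) \<in> C \<Longrightarrow> i \<notin> A \<Longrightarrow> a i = 0"
    and "\<And>b. (\<lambda>_. 0, b) \<in> farkas_cone C \<Longrightarrow> 0 \<le> b"
  shows "\<exists>x. \<forall>(a, b)\<in>C. (\<Sum>i\<in>A. a i * x i) \<le> b"
  using assms
proof (induction A arbitrary: C rule: finite_induct)
  case empty
  have "0 \<le> b" if "(a, b) \<in> C" for a b
  proof -
    have "a = (\<lambda>_. 0)" using empty.prems(2)[OF that] by auto
    with farkas_cone.gen[OF that, of 1] show ?thesis using empty.prems(3)[of b] by simp
  qed
  then show ?case by auto
next
  case (insert k A)
  define P where "P = {p \<in> C. fst p k > 0}"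
  define N where "N = {p \<in> C. fst p k < 0}"
  define comb where "comb p n =
    (\<lambda>i. fst p k * fst n i + - fst n k * fst p i, fst p k * snd n + - fst n k * snd p)"
    for p n :: "('i \<Rightarrow> 'a) \<times> 'a"
  define C' where "C' = {p \<in> C. fst p k = 0} \<union> (\<lambda>(p, n). comb p n) ` (P \<times> N)"
  have fin: "finite P" "finite N" using insert.prems(1) by (auto simp: P_def N_def)
  have comb_cone: "comb p n \<in> farkas_cone C" if "p \<in> P" "n \<in> N" for p n
    using farkas_cone.add[OF farkas_cone.gen[of "fst n" "snd n" C "fst p k"]
        farkas_cone.gen[of "fst p" "snd p" C "- fst n k"]] that
    by (simp add: comb_def P_def N_def)
  have C'_cone: "C' \<subseteq> farkas_cone C"
  proof
    fix p assume "p \<in> C'"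
    then consider "p \<in> C" | p' n where "p = comb p' n" "p' \<in> P" "n \<in> N"
      by (auto simp: C'_def)
    then show "p \<in> farkas_cone C"
    proof cases
      case 1
      then show ?thesis using farkas_cone.gen[of "fst p" "snd p" C 1] by simp
    qed (simp add: comb_cone)
  qed
  have "\<exists>x. \<forall>(a, b)\<in>C'. (\<Sum>i\<in>A. a i * x i) \<le> b"
  proof (rule insert.IH)
    show "finite C'" using fin insert.prems(1) by (auto simp: C'_def)
    show "a i = 0" if ab: "(a, b) \<in> C'" and i: "i \<notin> A" for a b i
    proof (cases "i = k")
      case True
      with ab show ?thesis by (auto simp: C'_def comb_def mult.commute)
    next
      case False
      then have zero: "a i = 0" if "(a, b) \<in> C" for a b
        using insert.prems(2)[OF that, of i] i by auto
      have "fst p i = 0" if "p \<in> C'" for p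
        using that
        by (cases p) (auto simp: C'_def comb_def P_def N_def dest: zero, metis mult_zero_right zero)
      from this[OF ab] show ?thesis by simp
    qed
    show "0 \<le> b" if "(\<lambda>_. 0, b) \<in> farkas_cone C'" for b
      using that farkas_cone_subset[OF C'_cone] insert.prems(3) by blast
  qed
  then obtain x where x: "\<And>p. p \<in> C' \<Longrightarrow> (\<Sum>i\<in>A. fst p i * x i) \<le> snd p" by fastforce
  define val where "val p = (\<Sum>i\<in>A. fst p i * x i)" for p :: "('i \<Rightarrow> 'a) \<times> 'a"
  have le: "(snd n - val n) / fst n k \<le> (snd p - val p) / fst p k" if "p \<in> P" "n \<in> N" for p n
  proof -
    have pos: "fst p k > 0" "fst n k < 0" using that by (auto simp: P_def N_def)
    have "comb p n \<in> C'" using that by (auto simp: C'_def)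
    from x[OF this] have "fst p k * val n + - fst n k * val p \<le> fst p k * snd n + - fst n k * snd p"
      by (simp add: comb_def val_def sum_distrib_left sum.distrib sum_subtractf sum_negf algebra_simps)
    then have "- fst n k * (val p - snd p) \<le> fst p k * (snd n - val n)" by (simp add: algebra_simps)
    then show ?thesis using pos by (simp add: field_simps)
  qed
  let ?L = "(\<lambda>n. (snd n - val n) / fst n k) ` N" and ?U = "(\<lambda>p. (snd p - val p) / fst p k) ` P"
  have "finite ?L" "finite ?U" "\<And>l u. l \<in> ?L \<Longrightarrow> u \<in> ?U \<Longrightarrow> l \<le> u"
    using fin le by auto
  then obtain z where "\<forall>l\<in>?L. l \<le> z" "\<forall>u\<in>?U. z \<le> u"
    using exists_between_finite[of ?L ?U] by blast
  then have z: "\<And>n. n \<in> N \<Longrightarrow> (snd n - val n) / fst n k \<le> z"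
    "\<And>p. p \<in> P \<Longrightarrow> z \<le> (snd p - val p) / fst p k" by blast+
  have "(\<Sum>i\<in>insert k A. fst p i * (x(k := z)) i) \<le> snd p" if p: "p \<in> C" for p
  proof -
    have "(\<Sum>i\<in>A. fst p i * (x(k := z)) i) = val p"
      unfolding val_def by (intro sum.cong) (use insert.hyps in auto)
    then have eq: "(\<Sum>i\<in>insert k A. fst p i * (x(k := z)) i) = fst p k * z + val p"
      using insert.hyps by simp
    consider "fst p k = 0" | "p \<in> P" | "p \<in> N" 
      using p linorder_less_linear[of "fst p k" 0] unfolding P_def N_def by blast
    then show ?thesis
    proof cases
      case 1
      then have "p \<in> C'" using p by (simp add: C'_def)
      with x[of p] 1 show ?thesis unfolding eq val_def by simp
    next
      case 2
      with z(2)[OF 2] show ?thesis unfolding eq by (simp add: P_def field_simps)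
    next
      case 3
      with z(1)[OF 3] show ?thesis unfolding eq by (simp add: N_def field_simps)
    qed
  qed
  then show ?case by (intro exI[of _ "x(k := z)"]) auto
qed

text \<open>
  Every nonnegative combination of the equations and their negatives still holds at the real solution.
\<close>

lemma rational_solution:
  fixes E :: "(('n::finite \<Rightarrow> rat) \<times> rat) set" and x :: "'n \<Rightarrow> real"
  assumes "finite E" "\<And>a b. (a, b) \<in> E \<Longrightarrow> (\<Sum>i\<in>UNIV. of_rat (a i) * x i) = of_rat b"
  shows "\<exists>y :: 'n \<Rightarrow> rat. \<forall>(a, b)\<in>E. (\<Sum>i\<in>UNIV. a i * y i) = b"
proof -
  let ?C = "E \<union> (\<lambda>(a, b). (\<lambda>i. - a i, - b)) ` E"
  have "\<exists>y. \<forall>(a, b)\<in>?C. (\<Sum>i\<in>UNIV. a i * y i) \<le> b"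
  proof (rule farkas)
    have "(\<Sum>i\<in>UNIV. of_rat (a i) * x i) = of_rat b" if "(a, b) \<in> farkas_cone ?C" for a b
      using that
    proof (induction rule: farkas_cone.induct)
      case (gen a b c)
      then have "(\<Sum>i\<in>UNIV. of_rat (a i) * x i) = of_rat b"
        using assms(2) by (auto simp: of_rat_minus sum_negf)
      then show ?case by (simp add: of_rat_mult mult.assoc flip: sum_distrib_left)
    qed (simp_all add: of_rat_add distrib_right sum.distrib)
    from this[of "\<lambda>_. 0" b for b] show "0 \<le> b" if "(\<lambda>_. 0, b) \<in> farkas_cone ?C" for b
      using that by force
  qed (use assms(1) in auto)
  then obtain y where y: "\<And>a b. (a, b) \<in> ?C \<Longrightarrow> (\<Sum>i\<in>UNIV. a i * y i) \<le> b" by blast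
  have "(\<Sum>i\<in>UNIV. a i * y i) = b" if "(a, b) \<in> E" for a b
    using y[of a b] y[of "\<lambda>i. - a i" "- b"] that by (force simp: sum_negf)
  then show ?thesis by blast
qed

lemma common_denominator:
  fixes d :: "'i \<Rightarrow> rat"
  assumes "finite A"
  obtains K where "K > 0" "\<And>j. j \<in> A \<Longrightarrow> of_int K * d j \<in> \<int>"
proof -
  have "\<exists>K>0. \<forall>j\<in>A. of_int K * d j \<in> \<int>"
    using assms
  proof induction
    case (insert i A)
    then obtain K where K: "K > 0" "\<forall>j\<in>A. of_int K * d j \<in> \<int>" by blast
    obtain p q where q: "quotient_of (d i) = (p, q)" by fastforce
    then have "q > 0" "d i = of_int p / of_int q"
      by (simp_all add: quotient_of_denom_pos quotient_of_div)
    then have "of_int (K * q) * d i = of_int (K * p)" by simp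
    then have "of_int (K * q) * d i \<in> \<int>" by (metis Ints_of_int)
    moreover have "of_int (K * q) * d j \<in> \<int>" if "j \<in> A" for j
      using Ints_mult[OF Ints_of_int[of q], of "of_int K * d j"] K(2) that by (simp add: mult_ac)
    ultimately show ?case
      using K(1) \<open>q > 0\<close> by (intro exI[of _ "K * q"]) auto
  qed (auto intro: exI[of _ 1])
  with that show thesis by blast
qed

lemma ell_add: "ell as (\<lambda>j. c j + d j) i = ell as c i + ell as d i"
  by (simp add: ell_def distrib_left sum.distrib)

text \<open>
  Since all exponents are nonnegative, lowering a positive coordinate of \<open>D\<close> preserves the inequalities, and it lowers
  the sum by one. This is why clearing denominators does no harm.
\<close>

lemma direction_sum_one:
  fixes D :: "nat \<Rightarrow> int"
  assumes "(\<Sum>j<length as. D j) \<ge> 1" "\<And>j. j \<in> J \<Longrightarrow> j < length as \<Longrightarrow> 0 \<le> D j" "\<And>i. i \<in> I \<Longrightarrow> ell as D i \<le> 0"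
  shows "\<exists>c :: nat \<Rightarrow> int. (\<Sum>j<length as. c j) = 1 \<and> (\<forall>j\<in>J. j < length as \<longrightarrow> 0 \<le> c j) \<and>
    (\<forall>i\<in>I. ell as c i \<le> 0)"
  using assms
proof (induction "nat (\<Sum>j<length as. D j)" arbitrary: D rule: less_induct)
  case less
  show ?case
  proof (cases "(\<Sum>j<length as. D j) = 1")
    case False
    have "\<exists>k<length as. D k > 0"
    proof (rule ccontr)
      assume "\<not> (\<exists>k<length as. D k > 0)"
      then have "(\<Sum>j<length as. D j) \<le> 0" by (intro sum_nonpos) force
      with less.prems(1) show False by simp
    qed
    then obtain k where k: "k < length as" "D k > 0" by blast
    let ?D = "D(k := D k - 1)"
    have "(\<Sum>j<length as. ?D j) = (\<Sum>j<length as. D j - (if j = k then 1 else 0))"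
      by (intro sum.cong) auto
    then have sum: "(\<Sum>j<length as. ?D j) = (\<Sum>j<length as. D j) - 1"
      using k by (simp add: sum_subtractf)
    show ?thesis
    proof (rule less.hyps)
      show "nat (\<Sum>j<length as. ?D j) < nat (\<Sum>j<length as. D j)" "(\<Sum>j<length as. ?D j) \<ge> 1"
        using sum less.prems(1) False by linarith+
      show "0 \<le> ?D j" if "j \<in> J" "j < length as" for j
        using less.prems(2)[OF that] k by auto
      show "ell as ?D i \<le> 0" if "i \<in> I" for i
        using less.prems(3)[OF that] ell_upd[OF k(1), of D i] by simp
    qed
  qed (use less.prems in \<open>intro exI[of _ D], auto\<close>)
qed

text \<open>
  A rational point of the face of the dual polyhedron is sought by \<open>farkas\<close>. A certificate of infeasibility contains
  a vector \<open>d\<close> of multipliers of the constraints for the \<open>a(j)\<close>, with the signs that are required of \<open>c\<close>.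
\<close>

theorem direction_or_dual_point:
  fixes as :: "('n::finite \<Rightarrow>\<^sub>0 nat) list" and J :: "nat set" and I :: "'n set"
  shows "(\<exists>c :: nat \<Rightarrow> int. (\<Sum>j<length as. c j) = 1 \<and> (\<forall>j\<in>J. j < length as \<longrightarrow> 0 \<le> c j) \<and>
      (\<forall>i\<in>I. ell as c i \<le> 0)) \<or>
    (\<exists>\<mu> :: 'n \<Rightarrow> rat. (\<forall>i. 0 \<le> \<mu> i) \<and> (\<forall>i. i \<notin> I \<longrightarrow> \<mu> i = 0) \<and>
      (\<forall>j<length as. 1 \<le> (\<Sum>i\<in>UNIV. of_nat (expo as j i) * \<mu> i) \<and>
        (j \<notin> J \<longrightarrow> (\<Sum>i\<in>UNIV. of_nat (expo as j i) * \<mu> i) = 1)))"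
proof -
  let ?r = "length as"
  let ?a = "\<lambda>j i. of_nat (expo as j i) :: rat"
  define C :: "(('n \<Rightarrow> rat) \<times> rat) set" where "C = (\<lambda>i. (\<lambda>l. if l = i then - 1 else 0, 0)) ` UNIV \<union>
    (\<lambda>i. (\<lambda>l. if l = i then 1 else 0, 0)) ` (- I) \<union>
    (\<lambda>j. (\<lambda>l. - ?a j l, - 1)) ` {..<?r} \<union> (\<lambda>j. (?a j, 1)) ` ({..<?r} - J)"
  show ?thesis
  proof (cases "\<forall>b. (\<lambda>_. 0, b) \<in> farkas_cone C \<longrightarrow> 0 \<le> b")
    case True
    then have "\<exists>x. \<forall>(a, b)\<in>C. (\<Sum>i\<in>UNIV. a i * x i) \<le> b"
      by (intro farkas) (auto simp: C_def)
    then obtain x where "\<And>a b. (a, b) \<in> C \<Longrightarrow> (\<Sum>i\<in>UNIV. a i * x i) \<le> b" by blast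
    note x = this[unfolded C_def]
    have "0 \<le> x i" for i
      using x[of "\<lambda>l. if l = i then - 1 else 0" 0]
      by (auto simp: if_distrib[of "\<lambda>y. y * _"] cong: if_cong)
    moreover have "x i \<le> 0" if "i \<notin> I" for i
      using x[of "\<lambda>l. if l = i then 1 else 0" 0] that
      by (auto simp: if_distrib[of "\<lambda>y. y * _"] cong: if_cong)
    moreover have "1 \<le> (\<Sum>i\<in>UNIV. ?a j i * x i)" if "j < ?r" for j
      using x[of "\<lambda>l. - ?a j l" "- 1"] that by (auto simp: sum_negf)
    moreover have "(\<Sum>i\<in>UNIV. ?a j i * x i) \<le> 1" if "j < ?r" "j \<notin> J" for j
      using x[of "?a j" 1] that by auto
    ultimately show ?thesis
      by (intro disjI2 exI[of _ x]) (auto intro: antisym)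
  next
    case False
    then obtain b where b: "(\<lambda>_. 0, b) \<in> farkas_cone C" "b < 0" by (auto simp: not_le)
    \<comment> \<open>The multipliers of the constraints for the \<open>a(j)\<close> make up \<open>d\<close>, those for the coordinates only enter the inequality.\<close>
    have "\<exists>d :: nat \<Rightarrow> rat. (\<forall>j\<in>J. 0 \<le> d j) \<and> b = - (\<Sum>j<?r. d j) \<and> (\<forall>i\<in>I. a i \<le> - ell as d i)"
      if "(a, b) \<in> farkas_cone C" for a b
      using that
    proof (induction rule: farkas_cone.induct)
      case zero
      show ?case by (intro exI[of _ "\<lambda>_. 0"]) (simp add: ell_def)
    next
      case (gen a b c)
      have unit: "(\<Sum>j<?r. if j = k then y else 0) = y" "ell as (\<lambda>j. if j = k then y else 0) i = ?a k i * y"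
        if "k < ?r" for k i and y :: rat
        using that by (simp_all add: ell_def if_distrib cong: if_cong)
      from gen(1) consider i where "a = (\<lambda>l. if l = i then - 1 else 0)" "b = 0"
        | i where "i \<notin> I" "a = (\<lambda>l. if l = i then 1 else 0)" "b = 0"
        | j where "j < ?r" "a = (\<lambda>l. - ?a j l)" "b = - 1"
        | j where "j < ?r" "j \<notin> J" "a = ?a j" "b = 1"
        unfolding C_def by auto
      then show ?case
      proof cases
        case 1
        then show ?thesis using gen(2) by (intro exI[of _ "\<lambda>_. 0"]) (auto simp: ell_def)
      next
        case 2
        then show ?thesis using gen(2) by (intro exI[of _ "\<lambda>_. 0"]) (auto simp: ell_def)
      next
        case (3 j)
        then show ?thesis
          using gen(2) by (intro exI[of _ "\<lambda>l. if l = j then c else 0"]) (auto simp: unit mult.commute)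
      next
        case (4 j)
        then show ?thesis
          using gen(2) by (intro exI[of _ "\<lambda>l. if l = j then - c else 0"]) (auto simp: unit mult.commute)
      qed
    next
      case (add a b a' b')
      then obtain d d' :: "nat \<Rightarrow> rat" where
        "\<forall>j\<in>J. 0 \<le> d j" "b = - (\<Sum>j<?r. d j)" "\<forall>i\<in>I. a i \<le> - ell as d i"
        "\<forall>j\<in>J. 0 \<le> d' j" "b' = - (\<Sum>j<?r. d' j)" "\<forall>i\<in>I. a' i \<le> - ell as d' i" by auto
      then show ?case
        by (intro exI[of _ "\<lambda>j. d j + d' j"]) (fastforce simp: ell_add sum.distrib)
    qed
    from this[OF b(1)] obtain d :: "nat \<Rightarrow> rat" where d: "\<And>j. j \<in> J \<Longrightarrow> 0 \<le> d j" "b = - (\<Sum>j<?r. d j)"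
      "\<And>i. i \<in> I \<Longrightarrow> ell as d i \<le> 0" by auto
    obtain K where K: "K > 0" "\<And>j. j < ?r \<Longrightarrow> of_int K * d j \<in> \<int>"
      using common_denominator[of "{..<?r}" d] by auto
    define D where "D j = \<lfloor>of_int K * d j\<rfloor>" for j
    have D: "of_int (D j) = of_int K * d j" if "j < ?r" for j
      using K(2)[OF that] by (auto simp: D_def elim: Ints_cases)
    have "of_int (\<Sum>j<?r. D j) = of_int K * (\<Sum>j<?r. d j)"
      by (simp add: D sum_distrib_left)
    also have "\<dots> > 0" using K(1) d(2) b(2) by simp
    finally have "(\<Sum>j<?r. D j) \<ge> 1" by (simp only: of_int_0_less_iff)
    moreover have "0 \<le> D j" if "j \<in> J" for j
      using d(1)[OF that] K(1) by (simp add: D_def)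
    moreover have "ell as D i \<le> 0" if "i \<in> I" for i
    proof -
      have "of_int (ell as D i) = of_int K * ell as d i"
        by (simp add: ell_def D sum_distrib_left mult.left_commute)
      also have "\<dots> \<le> 0" using K(1) d(3)[OF that] by (simp add: mult_le_0_iff)
      finally show ?thesis by (simp only: of_int_le_0_iff)
    qed
    ultimately show ?thesis using direction_sum_one[where as = as and D = D and J = J and I = I] by blast
  qed
qed

section \<open>Facets of the Newton polyhedron\<close>

definition expo_vec :: "('n::finite \<Rightarrow>\<^sub>0 nat) list \<Rightarrow> nat \<Rightarrow> real ^ 'n" where
  "expo_vec as j = (\<chi> i. real (expo as j i))"

definition tight :: "('n::finite \<Rightarrow>\<^sub>0 nat) list \<Rightarrow> real ^ 'n \<Rightarrow> (real ^ 'n) set" where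
  "tight as \<mu> = {expo_vec as j | j. j < length as \<and> \<mu> \<bullet> expo_vec as j = 1} \<union> {axis i 1 | i. \<mu> $ i = 0}"

text \<open>
  A point of the dual polyhedron is a vertex iff the constraints that are tight there span the whole space.
\<close>

definition dual_vertex :: "('n::finite \<Rightarrow>\<^sub>0 nat) list \<Rightarrow> real ^ 'n \<Rightarrow> bool" where
  "dual_vertex as \<mu> \<longleftrightarrow> (\<forall>i. 0 \<le> \<mu> $ i) \<and> (\<forall>j<length as. 1 \<le> \<mu> \<bullet> expo_vec as j) \<and>
     span (tight as \<mu>) = UNIV"

lemma orthogonal_spanning_set:
  fixes x y :: "'a::real_inner"
  assumes "span S = UNIV" "\<And>u. u \<in> S \<Longrightarrow> x \<bullet> u = y \<bullet> u"
  shows "x = y"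
proof -
  have "(x - y) \<bullet> u = 0" if "u \<in> span S" for u
    using that by (induction rule: span_induct_alt) (auto simp: inner_diff_left inner_add_right assms(2))
  from this[of "x - y"] assms(1) show ?thesis by simp
qed

text \<open>
  The tight constraints have integral coefficients and a unique solution.
\<close>

lemma dual_vertex_rational:
  fixes \<mu> :: "real ^ 'n::finite"
  assumes "dual_vertex as \<mu>"
  obtains q :: "'n \<Rightarrow> rat" where "\<And>i. \<mu> $ i = of_rat (q i)"
proof -
  let ?E = "(\<lambda>j. (\<lambda>i. of_nat (expo as j i), 1)) ` {j. j < length as \<and> \<mu> \<bullet> expo_vec as j = 1} \<union>
    (\<lambda>i. (\<lambda>l. if l = i then 1 else 0, 0)) ` {i. \<mu> $ i = 0} :: (('n \<Rightarrow> rat) \<times> rat) set"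
  have "\<exists>y :: 'n \<Rightarrow> rat. \<forall>(a, b)\<in>?E. (\<Sum>i\<in>UNIV. a i * y i) = b"
  proof (rule rational_solution[where x = "\<lambda>i. \<mu> $ i"])
    fix a :: "'n \<Rightarrow> rat" and b assume "(a, b) \<in> ?E"
    then consider j where "a = (\<lambda>i. of_nat (expo as j i))" "b = 1" "\<mu> \<bullet> expo_vec as j = 1"
      | i where "a = (\<lambda>l. if l = i then 1 else 0)" "b = 0" "\<mu> $ i = 0" by auto
    then show "(\<Sum>i\<in>UNIV. of_rat (a i) * \<mu> $ i) = of_rat b"
    proof cases
      case 1
      then show ?thesis by (simp add: inner_vec_def expo_vec_def mult.commute)
    next
      case (2 i)
      then have "(\<Sum>l\<in>UNIV. real_of_rat (a l) * \<mu> $ l) = 0" by (intro sum.neutral) auto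
      then show ?thesis using 2 by simp
    qed
  qed auto
  then obtain y :: "'n \<Rightarrow> rat" where yE: "\<forall>(a, b)\<in>?E. (\<Sum>i\<in>UNIV. a i * y i) = b" ..
  then have y: "(\<Sum>i\<in>UNIV. a i * y i) = b" if "(a, b) \<in> ?E" for a b
    using bspec[OF yE that] by simp
  have "\<mu> = (\<chi> i. of_rat (y i))"
  proof (rule orthogonal_spanning_set)
    show "span (tight as \<mu>) = UNIV" using assms by (simp add: dual_vertex_def)
    fix u assume "u \<in> tight as \<mu>"
    then consider j where "u = expo_vec as j" "j < length as" "\<mu> \<bullet> expo_vec as j = 1"
      | i where "u = axis i 1" "\<mu> $ i = 0" by (auto simp: tight_def)
    then show "\<mu> \<bullet> u = (\<chi> i. of_rat (y i)) \<bullet> u"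
    proof cases
      case (1 j)
      then have "(\<Sum>i\<in>UNIV. of_nat (expo as j i) * y i) = 1"
        by (intro y) auto
      then have "real_of_rat (\<Sum>i\<in>UNIV. of_nat (expo as j i) * y i) = 1" by simp
      then have "(\<Sum>i\<in>UNIV. real (expo as j i) * of_rat (y i)) = 1"
        by (simp add: of_rat_sum of_rat_mult)
      then show ?thesis using 1 by (simp add: inner_vec_def[of "vec_lambda _"] expo_vec_def mult.commute)
    next
      case (2 i)
      then have "(\<Sum>l\<in>UNIV. (if l = i then 1 else 0) * y l) = 0"
        by (intro y) auto
      then have "y i = 0" by (simp add: if_distrib[of "\<lambda>x. x * _"] cong: if_cong)
      then show ?thesis using 2 by (simp add: inner_axis)
    qed
  qed
  then have "\<mu> $ i = of_rat (y i)" for i by simp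
  with that show thesis .
qed

text \<open>
  Take a point of the face with as many tight constraints as possible. If they do not span, move in
  an orthogonal direction until a further constraint becomes tight. One does, because a suitable sign makes some
  coordinate decrease.
\<close>

lemma exists_dual_vertex:
  fixes \<mu> :: "real ^ 'n::finite"
  assumes "\<And>i. 0 \<le> \<mu> $ i" "\<And>i. i \<notin> I \<Longrightarrow> \<mu> $ i = 0"
    and "\<And>j. j < length as \<Longrightarrow> 1 \<le> \<mu> \<bullet> expo_vec as j"
    and "\<And>j. j < length as \<Longrightarrow> j \<notin> J \<Longrightarrow> \<mu> \<bullet> expo_vec as j = 1"
  obtains \<nu> where "dual_vertex as \<nu>" "\<And>i. i \<notin> I \<Longrightarrow> \<nu> $ i = 0"
    "\<And>j. j < length as \<Longrightarrow> j \<notin> J \<Longrightarrow> \<nu> \<bullet> expo_vec as j = 1"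
proof -
  define K :: "('n + nat) set" where "K = UNIV <+> {..<length as}"
  define E :: "('n + nat) set" where "E = (- I) <+> ({..<length as} - J)"
  define dir where "dir v k = (case k of Inl i \<Rightarrow> v $ i | Inr j \<Rightarrow> v \<bullet> expo_vec as j)"
    for v :: "real ^ 'n" and k
  define slack where "slack v k = (case k of Inl i \<Rightarrow> v $ i | Inr j \<Rightarrow> v \<bullet> expo_vec as j - 1)"
    for v :: "real ^ 'n" and k
  define feas where "feas v \<longleftrightarrow> (\<forall>k\<in>K. 0 \<le> slack v k) \<and> (\<forall>k\<in>E. slack v k = 0)" for v
  have fin: "finite K" by (simp add: K_def)
  have EK: "E \<subseteq> K" by (auto simp: E_def K_def)
  have "feas \<mu>" using assms by (auto simp: feas_def slack_def K_def E_def)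
  moreover have "card {k \<in> K. slack v k = 0} \<le> card K" for v
    using fin by (intro card_mono) auto
  ultimately have "\<exists>\<nu>. feas \<nu> \<and>
      (\<forall>v. feas v \<longrightarrow> card {k \<in> K. slack v k = 0} \<le> card {k \<in> K. slack \<nu> k = 0})"
    by (intro ex_has_greatest_nat[of feas \<mu> _ "Suc (card K)"]) (simp_all add: less_Suc_eq_le)
  then obtain \<nu> where \<nu>: "feas \<nu>"
    and max: "\<And>v. feas v \<Longrightarrow> card {k \<in> K. slack v k = 0} \<le> card {k \<in> K. slack \<nu> k = 0}"
    by blast
  have "span (tight as \<nu>) = UNIV"
  proof (rule ccontr)
    assume "span (tight as \<nu>) \<noteq> UNIV"
    then obtain u where u: "u \<noteq> 0" "\<And>x. x \<in> span (tight as \<nu>) \<Longrightarrow> u \<bullet> x = 0"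
      using span_not_UNIV_orthogonal by blast
    obtain l where l: "u $ l \<noteq> 0" using u(1) by (auto simp: vec_eq_iff)
    define v where "v = (if u $ l < 0 then u else - u)"
    have v: "v $ l < 0" "\<And>x. x \<in> span (tight as \<nu>) \<Longrightarrow> v \<bullet> x = 0"
      using l u(2) by (auto simp: v_def)
    have tight_dir: "dir v k = 0" if "k \<in> K" "slack \<nu> k = 0" for k
    proof (cases k)
      case (Inl i)
      then have "axis i 1 \<in> tight as \<nu>" using that(2) by (auto simp: slack_def tight_def)
      from v(2)[OF span_base[OF this]] show ?thesis by (simp add: Inl dir_def inner_axis)
    next
      case (Inr j)
      then have "expo_vec as j \<in> tight as \<nu>" using that by (auto simp: slack_def tight_def K_def)
      from v(2)[OF span_base[OF this]] show ?thesis by (simp add: Inr dir_def)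
    qed
    define D where "D = {k \<in> K. dir v k < 0}"
    have "Inl l \<in> D" using v(1) by (auto simp: D_def K_def dir_def)
    have D: "finite D" "D \<noteq> {}" using fin \<open>Inl l \<in> D\<close> by (auto simp: D_def)
    \<comment> \<open>The first time at which a constraint becomes tight.\<close>
    define t where "t = Min ((\<lambda>k. slack \<nu> k / - dir v k) ` D)"
    have t_le: "t \<le> slack \<nu> k / - dir v k" if "k \<in> D" for k
      using D that by (simp add: t_def)
    have "t \<in> (\<lambda>k. slack \<nu> k / - dir v k) ` D"
      unfolding t_def using D by (intro Min_in) auto
    then obtain k0 where k0: "k0 \<in> D" "t = slack \<nu> k0 / - dir v k0" by blast
    have "0 \<le> t" using k0 \<nu> by (auto simp: D_def feas_def intro!: divide_nonneg_neg)
    define w where "w = \<nu> + t *\<^sub>R v"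
    have w: "slack w k = slack \<nu> k + t * dir v k" for k
      by (cases k) (simp_all add: w_def slack_def dir_def inner_add_left)
    have "0 \<le> slack w k" if "k \<in> K" for k
    proof (cases "dir v k < 0")
      case True
      then have "t * - dir v k \<le> slack \<nu> k"
        using t_le[of k] that pos_le_divide_eq[of "- dir v k" t "slack \<nu> k"] by (simp add: D_def)
      then show ?thesis by (simp add: w)
    next
      case False
      then show ?thesis using \<nu> that \<open>0 \<le> t\<close> by (simp add: w feas_def)
    qed
    moreover have "slack w k = 0" if "k \<in> K" "slack \<nu> k = 0" for k
      using tight_dir[OF that] that by (simp add: w)
    ultimately have "feas w" using \<nu> EK by (auto simp: feas_def)
    have "slack w k0 = 0" using k0 by (simp add: w D_def)
    moreover have "slack \<nu> k0 \<noteq> 0" using tight_dir[of k0] k0(1) by (auto simp: D_def)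
    ultimately have "{k \<in> K. slack \<nu> k = 0} \<subset> {k \<in> K. slack w k = 0}"
      using \<open>\<And>k. k \<in> K \<Longrightarrow> slack \<nu> k = 0 \<Longrightarrow> slack w k = 0\<close> k0(1) by (auto simp: D_def)
    then have "card {k \<in> K. slack \<nu> k = 0} < card {k \<in> K. slack w k = 0}"
      using fin by (intro psubset_card_mono) auto
    with max[OF \<open>feas w\<close>] show False by simp
  qed
  moreover have "0 \<le> \<nu> $ i" for i
    using \<nu> by (auto simp: feas_def K_def slack_def dest!: bspec[of _ _ "Inl i"])
  moreover have "1 \<le> \<nu> \<bullet> expo_vec as j" if "j < length as" for j
    using \<nu> that by (auto simp: feas_def K_def slack_def dest!: bspec[of _ _ "Inr j"])
  ultimately have "dual_vertex as \<nu>" by (simp add: dual_vertex_def)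
  moreover have "\<nu> $ i = 0" if "i \<notin> I" for i
  proof -
    have "Inl i \<in> E" using that by (auto simp: E_def)
    then have "slack \<nu> (Inl i) = 0" using \<nu> unfolding feas_def by blast
    then show ?thesis by (simp add: slack_def)
  qed
  moreover have "\<nu> \<bullet> expo_vec as j = 1" if "j < length as" "j \<notin> J" for j
  proof -
    have "Inr j \<in> E" using that by (auto simp: E_def)
    then have "slack \<nu> (Inr j) = 0" using \<nu> unfolding feas_def by blast
    then show ?thesis by (simp add: slack_def)
  qed
  ultimately show thesis by (rule that)
qed

lemma exponents_monomial_ideal:
  "exponents (ideal_gen (xmonom ` set as)) =
    {\<chi> i. real (Poly_Mapping.lookup u i) | u. \<exists>j<length as. \<forall>i. expo as j i \<le> Poly_Mapping.lookup u i}"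
proof -
  have "xmonom u \<in> ideal_gen (xmonom ` set as) \<longleftrightarrow> (\<exists>j<length as. \<forall>i. expo as j i \<le> Poly_Mapping.lookup u i)"
    for u :: "'a \<Rightarrow>\<^sub>0 nat"
  proof
    assume "xmonom u \<in> ideal_gen (xmonom ` set as)"
    from keys_monomial_ideal[OF this, of u] obtain a where "a \<in> set as"
      "\<forall>i. Poly_Mapping.lookup a i \<le> Poly_Mapping.lookup u i" by (auto simp: xmonom_def)
    then show "\<exists>j<length as. \<forall>i. expo as j i \<le> Poly_Mapping.lookup u i"
      by (auto simp: expo_def in_set_conv_nth)
  next
    assume "\<exists>j<length as. \<forall>i. expo as j i \<le> Poly_Mapping.lookup u i"
    then obtain j where j: "j < length as" "\<And>i. Poly_Mapping.lookup (as ! j) i \<le> Poly_Mapping.lookup u i"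
      by (auto simp: expo_def)
    then have "u = (u - as ! j) + as ! j"
      by (intro poly_mapping_eqI) (auto simp: lookup_add lookup_minus)
    then have "xmonom u = xmonom (u - as ! j) * xmonom (as ! j)"
      by (metis xmonom_add)
    moreover have "xmonom (as ! j) \<in> ideal_gen (xmonom ` set as)"
      unfolding ideal_gen_eq_span using j(1) by (intro ring_self.span_base) auto
    ultimately show "xmonom u \<in> ideal_gen (xmonom ` set as)"
      unfolding ideal_gen_eq_span by (simp add: ring_self.span_scale)
  qed
  then show ?thesis by (auto simp: exponents_def)
qed

locale newton =
  fixes as :: "('n::finite \<Rightarrow>\<^sub>0 nat) list"
  assumes nonempty: "as \<noteq> []"
begin

abbreviation "exps \<equiv> exponents (ideal_gen (xmonom ` set as))"
abbreviation "NP \<equiv> newton_polyhedron (ideal_gen (xmonom ` set as))"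

lemma convex_NP: "convex NP"
  by (simp add: newton_polyhedron_def)

lemma exps_subset_NP: "exps \<subseteq> NP"
  by (simp add: newton_polyhedron_def hull_subset)

lemma exps_add_axis:
  assumes "x \<in> exps"
  shows "x + axis i (real N) \<in> exps"
proof -
  obtain u j where u: "x = (\<chi> i. real (Poly_Mapping.lookup u i))" "j < length as"
    "\<And>i. expo as j i \<le> Poly_Mapping.lookup u i"
    using assms unfolding exponents_monomial_ideal by blast
  have "x + axis i (real N) = (\<chi> l. real (Poly_Mapping.lookup (u + Poly_Mapping.single i N) l))"
    by (simp add: vec_eq_iff u(1) axis_def lookup_add lookup_single when_def)
  moreover have "\<forall>l. expo as j l \<le> Poly_Mapping.lookup (u + Poly_Mapping.single i N) l"
    using u(3) by (simp add: lookup_add trans_le_add1)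
  ultimately show ?thesis
    unfolding exponents_monomial_ideal using u(2) by blast
qed

lemma expo_vec_in_exps: "j < length as \<Longrightarrow> expo_vec as j \<in> exps"
  unfolding exponents_monomial_ideal by (auto simp: expo_vec_def expo_def)

text \<open>
  A point of the generating set stays in it when a natural number is added to a coordinate, and real numbers lie
  between two such steps.
\<close>

lemma NP_add_axis:
  assumes "x \<in> NP" "0 \<le> t"
  shows "x + axis i t \<in> NP"
proof -
  have "convex ((\<lambda>x. axis i t + x) -` NP)"
  proof (rule convexI)
    fix x y u v assume xy: "x \<in> (\<lambda>x. axis i t + x) -` NP" "y \<in> (\<lambda>x. axis i t + x) -` NP"
      and uv: "0 \<le> u" "0 \<le> v" "u + v = (1 :: real)"
    have "axis i t + (u *\<^sub>R x + v *\<^sub>R y) = (u + v) *\<^sub>R axis i t + (u *\<^sub>R x + v *\<^sub>R y)"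
      by (simp add: uv(3))
    also have "\<dots> = u *\<^sub>R (axis i t + x) + v *\<^sub>R (axis i t + y)"
      by (simp add: algebra_simps)
    also have "\<dots> \<in> NP"
      using xy uv by (intro convexD[OF convex_NP]) auto
    finally show "u *\<^sub>R x + v *\<^sub>R y \<in> (\<lambda>x. axis i t + x) -` NP" by simp
  qed
  moreover have "exps \<subseteq> (\<lambda>x. axis i t + x) -` NP"
  proof
    fix x assume x: "x \<in> exps"
    obtain N where N: "t \<le> real N" using real_arch_simple by blast
    show "x \<in> (\<lambda>x. axis i t + x) -` NP"
    proof (cases "N = 0")
      case True
      then have z: "axis i t = (0 :: real ^ 'n)" using N assms(2) by (simp add: axis_def vec_eq_iff)
      show ?thesis using subsetD[OF exps_subset_NP x] by (simp only: vimage_eq z add_0_left)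
    next
      case False
      have "(1 - t / N) *\<^sub>R x + (t / N) *\<^sub>R (x + axis i (real N)) \<in> NP"
        using x exps_add_axis[OF x] exps_subset_NP N assms(2) False
        by (intro convexD_alt[OF convex_NP]) auto
      moreover have "(1 - t / N) *\<^sub>R x + (t / N) *\<^sub>R (x + axis i (real N)) = axis i t + x"
        using False by (simp add: vec_eq_iff axis_def algebra_simps)
      ultimately show ?thesis by simp
    qed
  qed
  ultimately have "NP \<subseteq> (\<lambda>x. axis i t + x) -` NP"
    unfolding newton_polyhedron_def by (intro hull_minimal)
  with assms(1) show ?thesis by (auto simp: add.commute)
qed

lemma NP_upward_closed:
  assumes "x \<in> NP" "\<And>i. x $ i \<le> y $ i"
  shows "y \<in> NP"
proof -
  have "x + (\<Sum>i\<in>A. axis i ((y - x) $ i)) \<in> NP" if "finite A" for A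
    using that
  proof (induction A)
    case (insert i A)
    then show ?case
      using NP_add_axis[OF insert.IH, of "(y - x) $ i" i] assms(2)[of i] by (simp add: algebra_simps)
  qed (use assms in simp)
  from this[of UNIV] have "x + (\<Sum>i\<in>UNIV. axis i ((y - x) $ i)) \<in> NP" by simp
  moreover have "(\<Sum>i\<in>UNIV. axis i ((y - x) $ i)) = y - x"
    by (simp add: vec_eq_iff axis_def)
  ultimately show ?thesis by simp
qed

text \<open>
  The Newton polyhedron is the sum of the convex hull of the \<open>a(j)\<close> and the nonnegative orthant.
\<close>

lemma NP_dominates_combination:
  assumes "u \<in> NP"
  obtains \<alpha> :: "nat \<Rightarrow> real" where "\<And>j. 0 \<le> \<alpha> j" "(\<Sum>j<length as. \<alpha> j) = 1"
    "\<And>i. (\<Sum>j<length as. \<alpha> j *\<^sub>R expo_vec as j) $ i \<le> u $ i"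
proof -
  let ?Y = "{u. \<exists>\<alpha> :: nat \<Rightarrow> real. (\<forall>j. 0 \<le> \<alpha> j) \<and> (\<Sum>j<length as. \<alpha> j) = 1 \<and>
    (\<forall>i. (\<Sum>j<length as. \<alpha> j *\<^sub>R expo_vec as j) $ i \<le> u $ i)}"
  have "convex ?Y"
  proof (rule convexI)
    fix x y s t assume "x \<in> ?Y" "y \<in> ?Y" and st: "0 \<le> s" "0 \<le> t" "s + t = (1::real)"
    then obtain \<alpha> \<beta> :: "nat \<Rightarrow> real" where
      "\<forall>j. 0 \<le> \<alpha> j" "(\<Sum>j<length as. \<alpha> j) = 1" "\<forall>i. (\<Sum>j<length as. \<alpha> j *\<^sub>R expo_vec as j) $ i \<le> x $ i"
      "\<forall>j. 0 \<le> \<beta> j" "(\<Sum>j<length as. \<beta> j) = 1" "\<forall>i. (\<Sum>j<length as. \<beta> j *\<^sub>R expo_vec as j) $ i \<le> y $ i"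
      by blast
    moreover have "(\<Sum>j<length as. (s * \<alpha> j + t * \<beta> j) *\<^sub>R expo_vec as j) =
        s *\<^sub>R (\<Sum>j<length as. \<alpha> j *\<^sub>R expo_vec as j) + t *\<^sub>R (\<Sum>j<length as. \<beta> j *\<^sub>R expo_vec as j)"
      by (simp add: scaleR_add_left sum.distrib scaleR_sum_right)
    ultimately show "s *\<^sub>R x + t *\<^sub>R y \<in> ?Y"
      using st by (intro CollectI exI[of _ "\<lambda>j. s * \<alpha> j + t * \<beta> j"])
        (auto simp: sum.distrib simp flip: sum_distrib_left intro!: add_mono mult_left_mono)
  qed
  moreover have "exps \<subseteq> ?Y"
  proof
    fix x assume "x \<in> exps"
    then obtain u j where u: "x = (\<chi> i. real (Poly_Mapping.lookup u i))" "j < length as"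
      "\<And>i. expo as j i \<le> Poly_Mapping.lookup u i"
      unfolding exponents_monomial_ideal by blast
    have "(\<Sum>l<length as. (if l = j then 1 else 0) *\<^sub>R expo_vec as l) = expo_vec as j"
      using u(2) by (simp add: if_distrib[of "\<lambda>x. x *\<^sub>R _"] cong: if_cong)
    then show "x \<in> ?Y"
      using u by (intro CollectI exI[of _ "\<lambda>l. if l = j then 1 else 0"]) (auto simp: expo_vec_def)
  qed
  ultimately have "NP \<subseteq> ?Y"
    unfolding newton_polyhedron_def by (intro hull_minimal)
  with assms that show thesis by blast
qed

lemma NP_nonneg: "u \<in> NP \<Longrightarrow> 0 \<le> u $ i"
proof -
  assume "u \<in> NP"
  then obtain \<alpha> where \<alpha>: "\<And>j. 0 \<le> \<alpha> j" "\<And>i. (\<Sum>j<length as. \<alpha> j *\<^sub>R expo_vec as j) $ i \<le> u $ i"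
    by (metis NP_dominates_combination)
  have "0 \<le> (\<Sum>j<length as. \<alpha> j *\<^sub>R expo_vec as j) $ i"
    using \<alpha>(1) by (auto simp: expo_vec_def intro!: sum_nonneg)
  with \<alpha>(2)[of i] show ?thesis by simp
qed

text \<open>
  Write \<open>u\<close> as a convex combination of the \<open>a(j)\<close> plus a nonnegative vector. If \<open>\<mu> \<bullet> u = 1\<close>, then only tight \<open>a(j)\<close> and
  \<open>e\<^sub>i\<close> with \<open>\<mu>\<^sub>i = 0\<close> can occur.
\<close>

lemma NP_halfspace:
  assumes "\<And>i. 0 \<le> \<mu> $ i" "\<And>j. j < length as \<Longrightarrow> 1 \<le> \<mu> \<bullet> expo_vec as j" "u \<in> NP"
  shows "1 \<le> \<mu> \<bullet> u" and "\<mu> \<bullet> u = 1 \<Longrightarrow> u \<in> span (tight as \<mu>)"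
proof -
  obtain \<alpha> where \<alpha>: "\<And>j. 0 \<le> \<alpha> j" "(\<Sum>j<length as. \<alpha> j) = 1"
    "\<And>i. (\<Sum>j<length as. \<alpha> j *\<^sub>R expo_vec as j) $ i \<le> u $ i"
    using NP_dominates_combination[OF assms(3)] by metis
  define w where "w = u - (\<Sum>j<length as. \<alpha> j *\<^sub>R expo_vec as j)"
  have w: "0 \<le> w $ i" for i using \<alpha>(3)[of i] by (simp add: w_def)
  have "\<mu> \<bullet> u = (\<Sum>j<length as. \<alpha> j * (\<mu> \<bullet> expo_vec as j)) + \<mu> \<bullet> w"
    by (simp add: w_def inner_diff_right inner_sum_right)
  then have eq: "\<mu> \<bullet> u - 1 = (\<Sum>j<length as. \<alpha> j * (\<mu> \<bullet> expo_vec as j - 1)) + (\<Sum>i\<in>UNIV. \<mu> $ i * w $ i)"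
    using \<alpha>(2) by (simp add: right_diff_distrib sum_subtractf inner_vec_def)
  have nonneg: "0 \<le> \<alpha> j * (\<mu> \<bullet> expo_vec as j - 1)" if "j < length as" for j
    using \<alpha>(1)[of j] assms(2)[OF that] by simp
  have nonneg': "0 \<le> \<mu> $ i * w $ i" for i using assms(1) w by simp
  have s1: "0 \<le> (\<Sum>j<length as. \<alpha> j * (\<mu> \<bullet> expo_vec as j - 1))" using nonneg by (intro sum_nonneg) auto
  have s2: "0 \<le> (\<Sum>i\<in>UNIV. \<mu> $ i * w $ i)" using nonneg' by (intro sum_nonneg) auto
  show "1 \<le> \<mu> \<bullet> u" using eq s1 s2 by simp
  assume "\<mu> \<bullet> u = 1"
  with eq s1 s2 have z: "(\<Sum>j<length as. \<alpha> j * (\<mu> \<bullet> expo_vec as j - 1)) = 0" "(\<Sum>i\<in>UNIV. \<mu> $ i * w $ i) = 0"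
    by linarith+
  have "\<alpha> j *\<^sub>R expo_vec as j \<in> span (tight as \<mu>)" if j: "j < length as" for j
  proof (cases "\<alpha> j = 0")
    case False
    have "\<alpha> j * (\<mu> \<bullet> expo_vec as j - 1) = 0"
      using z(1) nonneg j by (subst (asm) sum_nonneg_eq_0_iff) auto
    with False have "expo_vec as j \<in> tight as \<mu>" using j by (auto simp: tight_def)
    then show ?thesis by (intro span_scale span_base)
  qed (simp add: span_zero)
  moreover have "w $ i *\<^sub>R axis i 1 \<in> span (tight as \<mu>)" for i
  proof (cases "w $ i = 0")
    case False
    have "\<mu> $ i * w $ i = 0"
      using z(2) nonneg' by (subst (asm) sum_nonneg_eq_0_iff) auto
    with False have "axis i 1 \<in> tight as \<mu>" by (auto simp: tight_def)
    then show ?thesis by (intro span_scale span_base)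
  qed (simp add: span_zero)
  moreover have "w = (\<Sum>i\<in>UNIV. w $ i *\<^sub>R axis i 1)"
    by (simp add: vec_eq_iff axis_def if_distrib cong: if_cong)
  moreover have "u = (\<Sum>j<length as. \<alpha> j *\<^sub>R expo_vec as j) + w" by (simp add: w_def)
  ultimately show "u \<in> span (tight as \<mu>)"
    by (metis (no_types, lifting) lessThan_iff span_add span_sum)
qed

lemma aff_dim_NP: "aff_dim NP = int CARD('n)"
proof -
  obtain a where a: "a \<in> NP" using expo_vec_in_exps[of 0] exps_subset_NP nonempty by auto
  have "box a (a + 1) \<subseteq> NP"
  proof
    fix x assume "x \<in> box a (a + 1)"
    then have "a $ i \<le> x $ i" for i by (auto simp: mem_box_cart intro: less_imp_le)
    then show "x \<in> NP" by (rule NP_upward_closed[OF a])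
  qed
  then have "box a (a + 1) \<subseteq> interior NP" by (simp add: interior_maximal open_box)
  moreover have "a + (1 / 2) *\<^sub>R 1 \<in> box a (a + 1)" by (simp add: mem_box_cart)
  ultimately have "interior NP \<noteq> {}" by blast
  then show ?thesis by (simp add: aff_dim_nonempty_interior)
qed

lemma facet_form_eq:
  fixes Q :: "(real ^ 'n) set"
  assumes "span Q = UNIV" "\<And>u. u \<in> Q \<Longrightarrow> \<mu> \<bullet> u = 1"
  shows "facet_form Q = (\<lambda>u. \<mu> \<bullet> u)"
  unfolding facet_form_def
proof (rule the_equality)
  show "linear (\<lambda>u. \<mu> \<bullet> u) \<and> (\<forall>u\<in>Q. \<mu> \<bullet> u = 1)"
    using assms(2) by (simp add: bounded_linear_inner_right bounded_linear.linear)
  fix L :: "real ^ 'n \<Rightarrow> real" assume L: "linear L \<and> (\<forall>u\<in>Q. L u = 1)"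
  show "L = (\<lambda>u. \<mu> \<bullet> u)"
  proof
    fix u
    show "L u = \<mu> \<bullet> u"
    proof (rule linear_eq_on_span[where f = L and g = "\<lambda>u. \<mu> \<bullet> u" and B = Q])
      show "linear (\<lambda>u. \<mu> \<bullet> u)" by (simp add: bounded_linear_inner_right bounded_linear.linear)
    qed (use L assms in simp_all)
  qed
qed

text \<open>
  The affine hull of \<open>Q\<close> misses the origin, so adjoining the origin raises the affine dimension by one.
\<close>

lemma span_eq_UNIV_iff_aff_dim:
  fixes Q :: "(real ^ 'n) set"
  assumes "\<And>u. u \<in> Q \<Longrightarrow> \<mu> \<bullet> u = 1"
  shows "span Q = UNIV \<longleftrightarrow> aff_dim Q = int CARD('n) - 1"
proof -
  have "affine hull Q \<subseteq> {u. \<mu> \<bullet> u = 1}"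
    using assms by (intro hull_minimal affine_hyperplane) auto
  then have "0 \<notin> affine hull Q" by auto
  then have "aff_dim (insert 0 Q) = aff_dim Q + 1" by (simp add: aff_dim_insert)
  moreover have "aff_dim (insert 0 Q) = int (dim (insert 0 Q))"
    by (intro aff_dim_zero hull_inc) simp
  moreover have "span Q = UNIV \<longleftrightarrow> dim (insert 0 Q) = CARD('n)"
    using dim_eq_full[of Q] by (simp add: dim_insert span_zero)
  ultimately show ?thesis by linarith
qed

text \<open>
  The face on which \<open>\<mu>\<close> takes the value 1 contains every tight \<open>a(j)\<close>, and together with \<open>a(j)\<close> also \<open>a(j) + e\<^sub>i\<close> if
  \<open>\<mu>\<^sub>i = 0\<close>. So it spans the whole space, hence it is a facet, and it is in no coordinate hyperplane.
\<close>

lemma dual_vertex_imp_facet: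
  assumes "dual_vertex as \<mu>"
  shows "\<exists>Q. Q facet_of NP \<and> \<not> in_coordinate_hyperplane Q \<and> facet_form Q = (\<lambda>u. \<mu> \<bullet> u)"
proof -
  define Q where "Q = NP \<inter> {u. \<mu> \<bullet> u = 1}"
  have \<mu>: "\<And>i. 0 \<le> \<mu> $ i" "\<And>j. j < length as \<Longrightarrow> 1 \<le> \<mu> \<bullet> expo_vec as j" "span (tight as \<mu>) = UNIV"
    using assms by (auto simp: dual_vertex_def)
  have vec_in_NP: "expo_vec as j \<in> NP" if "j < length as" for j
    using expo_vec_in_exps[OF that] exps_subset_NP by blast
  have "Q face_of NP"
    unfolding Q_def using NP_halfspace(1)[OF \<mu>(1,2)]
    by (intro face_of_Int_supporting_hyperplane_ge[OF convex_NP]) simp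
  have "\<exists>j<length as. \<mu> \<bullet> expo_vec as j = 1"
  proof (rule ccontr)
    assume no: "\<not> ?thesis"
    have "\<mu> = 0"
    proof (rule orthogonal_spanning_set[OF \<mu>(3)])
      fix u assume "u \<in> tight as \<mu>"
      then show "\<mu> \<bullet> u = 0 \<bullet> u" using no by (auto simp: tight_def inner_axis)
    qed
    with \<mu>(2)[of 0] nonempty show False by simp
  qed
  then obtain j0 where j0: "j0 < length as" "\<mu> \<bullet> expo_vec as j0 = 1" by blast
  have "tight as \<mu> \<subseteq> span Q"
  proof
    fix u assume "u \<in> tight as \<mu>"
    then consider j where "u = expo_vec as j" "j < length as" "\<mu> \<bullet> expo_vec as j = 1"
      | i where "u = axis i 1" "\<mu> $ i = 0" by (auto simp: tight_def)
    then show "u \<in> span Q"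
    proof cases
      case (1 j)
      then show ?thesis using vec_in_NP by (intro span_base) (auto simp: Q_def)
    next
      case (2 i)
      then have "expo_vec as j0 + axis i 1 \<in> Q" "expo_vec as j0 \<in> Q"
        using NP_add_axis[OF vec_in_NP[OF j0(1)], of 1 i] vec_in_NP[OF j0(1)] j0
        by (auto simp: Q_def inner_add_right inner_axis)
      then have "(expo_vec as j0 + axis i 1) - expo_vec as j0 \<in> span Q"
        by (intro span_diff span_base)
      then show ?thesis using 2 by simp
    qed
  qed
  then have span_Q: "span Q = UNIV"
    using \<mu>(3) by (metis span_mono span_span top.extremum_uniqueI)
  have Q: "\<And>u. u \<in> Q \<Longrightarrow> \<mu> \<bullet> u = 1" by (simp add: Q_def)
  have "aff_dim Q = int CARD('n) - 1"
    using span_eq_UNIV_iff_aff_dim[of Q \<mu>] Q span_Q by blast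
  moreover have "Q \<noteq> {}" using j0 vec_in_NP by (auto simp: Q_def)
  ultimately have "Q facet_of NP"
    using \<open>Q face_of NP\<close> by (simp add: facet_of_def aff_dim_NP)
  moreover have "\<not> in_coordinate_hyperplane Q"
  proof
    assume "in_coordinate_hyperplane Q"
    then obtain i where i: "Q \<subseteq> {u. u $ i = 0}" by (auto simp: in_coordinate_hyperplane_def)
    have "axis i 1 = (0 :: real ^ 'n)"
    proof (rule orthogonal_spanning_set[OF span_Q])
      fix u assume "u \<in> Q"
      then show "axis i 1 \<bullet> u = 0 \<bullet> u" using i by (auto simp: inner_axis')
    qed
    then show False by (simp add: axis_eq_0_iff)
  qed
  moreover have "facet_form Q = (\<lambda>u. \<mu> \<bullet> u)"
    by (rule facet_form_eq[OF span_Q Q])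
  ultimately show ?thesis by blast
qed

text \<open>
  A supporting hyperplane \<open>a \<bullet> y = a \<bullet> x\<close> at a relative interior point \<open>x\<close> of the facet contains the facet. Its normal \<open>a\<close> is
  nonnegative because the polyhedron is closed upwards, and \<open>a \<bullet> x = 0\<close> would put the facet into a coordinate
  hyperplane.
\<close>

lemma facet_imp_dual_vertex:
  assumes "Q facet_of NP" "\<not> in_coordinate_hyperplane Q"
  shows "\<exists>\<mu>. dual_vertex as \<mu> \<and> facet_form Q = (\<lambda>u. \<mu> \<bullet> u)"
proof -
  have face: "Q face_of NP" and ne: "Q \<noteq> {}" and dim: "aff_dim Q = int CARD('n) - 1"
    using assms(1) by (auto simp: facet_of_def aff_dim_NP)
  have QP: "Q \<subseteq> NP" using face by (rule face_of_imp_subset)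
  have "convex Q" using face by (rule face_of_imp_convex)
  then obtain x where x: "x \<in> rel_interior Q" using ne rel_interior_eq_empty by blast
  then have xQ: "x \<in> Q" using rel_interior_subset by blast
  have "Q \<noteq> NP" using dim aff_dim_NP by auto
  then have xr: "x \<notin> rel_interior NP"
    using face_of_disjoint_rel_interior[OF face] xQ by blast
  have "x \<in> NP" using xQ QP by blast
  from supporting_hyperplane_rel_boundary[OF convex_NP this xr]
  obtain a where a: "a \<noteq> 0" "\<And>y. y \<in> NP \<Longrightarrow> a \<bullet> x \<le> a \<bullet> y"
    by metis
  have face': "NP \<inter> {y. a \<bullet> y = a \<bullet> x} face_of NP"
    by (intro face_of_Int_supporting_hyperplane_ge convex_NP a)
  have "x \<in> (NP \<inter> {y. a \<bullet> y = a \<bullet> x}) \<inter> rel_interior Q" using \<open>x \<in> NP\<close> x by simp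
  then have Qa: "Q \<subseteq> NP \<inter> {y. a \<bullet> y = a \<bullet> x}"
    using subset_of_face_of[OF face' QP] by (auto simp: disjnt_def)
  have a_nonneg: "0 \<le> a $ i" for i
    using a(2)[OF NP_add_axis[of x 1 i]] xQ QP by (auto simp: inner_add_right inner_axis)
  have "a \<bullet> x \<noteq> 0"
  proof
    assume 0: "a \<bullet> x = 0"
    obtain i where i: "a $ i \<noteq> 0" using a(1) by (auto simp: vec_eq_iff)
    have "u $ i = 0" if "u \<in> Q" for u
    proof -
      have "a \<bullet> u = 0" using that Qa 0 by auto
      then have "(\<Sum>i\<in>UNIV. a $ i * u $ i) = 0" by (simp add: inner_vec_def)
      then have "a $ i * u $ i = 0"
        using a_nonneg NP_nonneg that QP by (subst (asm) sum_nonneg_eq_0_iff) auto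
      with i show ?thesis by simp
    qed
    with assms(2) show False by (auto simp: in_coordinate_hyperplane_def)
  qed
  moreover have "0 \<le> a \<bullet> x"
    using a_nonneg NP_nonneg xQ QP by (auto simp: inner_vec_def intro!: sum_nonneg mult_nonneg_nonneg)
  ultimately have pos: "0 < a \<bullet> x" by simp
  define \<mu> where "\<mu> = (1 / (a \<bullet> x)) *\<^sub>R a"
  have 1: "0 \<le> \<mu> $ i" for i using a_nonneg pos by (simp add: \<mu>_def)
  have 2: "1 \<le> \<mu> \<bullet> expo_vec as j" if "j < length as" for j
    using a(2)[of "expo_vec as j"] expo_vec_in_exps[OF that] exps_subset_NP pos by (auto simp: \<mu>_def)
  have Q: "\<mu> \<bullet> u = 1" if "u \<in> Q" for u using that Qa pos by (auto simp: \<mu>_def)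
  have span_Q: "span Q = UNIV"
    using span_eq_UNIV_iff_aff_dim[of Q \<mu>] Q dim by blast
  have "Q \<subseteq> span (tight as \<mu>)"
  proof
    fix u assume "u \<in> Q"
    then show "u \<in> span (tight as \<mu>)"
      using NP_halfspace(2)[of \<mu> u, OF 1 2] Q[of u] QP by auto
  qed
  then have "span (tight as \<mu>) = UNIV"
    using span_Q by (metis span_mono span_span top.extremum_uniqueI)
  with 1 2 have "dual_vertex as \<mu>" by (simp add: dual_vertex_def)
  with facet_form_eq[OF span_Q Q] show ?thesis by blast
qed

definition vertex_denom :: "real ^ 'n \<Rightarrow> nat" where
  "vertex_denom \<mu> = (LEAST m. 0 < m \<and> (\<forall>i. of_nat m * \<mu> $ i \<in> \<int>))"

theorem facet_denoms_eq:
  "facet_denom ` {Q. Q facet_of NP \<and> \<not> in_coordinate_hyperplane Q} = vertex_denom ` {\<mu>. dual_vertex as \<mu>}"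
proof -
  have eq: "facet_denom Q = vertex_denom \<mu>" if "facet_form Q = (\<lambda>u. \<mu> \<bullet> u)" for Q \<mu>
    using that by (simp add: facet_denom_def vertex_denom_def inner_axis)
  show ?thesis
    using dual_vertex_imp_facet facet_imp_dual_vertex eq by (auto simp: image_iff) metis+
qed

end

section \<open>Roots at the vertices of the dual polyhedron\<close>

context newton
begin

lemma vertex_denom:
  assumes "dual_vertex as \<mu>"
  shows "0 < vertex_denom \<mu>" and "of_nat (vertex_denom \<mu>) * \<mu> $ i \<in> \<int>"
    and "\<And>m. 0 < m \<Longrightarrow> (\<And>i. of_nat m * \<mu> $ i \<in> \<int>) \<Longrightarrow> vertex_denom \<mu> \<le> m"
proof -
  obtain q :: "'n \<Rightarrow> rat" where q: "\<And>i. \<mu> $ i = of_rat (q i)"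
    using dual_vertex_rational[OF assms] by metis
  obtain K where K: "K > 0" "\<And>i. of_int K * q i \<in> \<int>"
    using common_denominator[of UNIV q] by auto
  have "of_nat (nat K) * \<mu> $ i \<in> \<int>" for i
  proof -
    obtain z where "of_int K * q i = of_int z" using K(2)[of i] by (auto elim: Ints_cases)
    then have "real_of_rat (of_int K * q i) = of_int z" by simp
    then have "of_nat (nat K) * \<mu> $ i = of_int z" using K(1) by (simp add: q of_rat_mult)
    then show ?thesis by simp
  qed
  then have ex: "0 < nat K \<and> (\<forall>i. of_nat (nat K) * \<mu> $ i \<in> \<int>)" using K(1) by simp
  from LeastI[of "\<lambda>m. 0 < m \<and> (\<forall>i. of_nat m * \<mu> $ i \<in> \<int>)", OF ex]
  show "0 < vertex_denom \<mu>" "of_nat (vertex_denom \<mu>) * \<mu> $ i \<in> \<int>"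
    unfolding vertex_denom_def by auto
  show "vertex_denom \<mu> \<le> m" if "0 < m" "\<And>i. of_nat m * \<mu> $ i \<in> \<int>" for m
    unfolding vertex_denom_def using that by (intro Least_le) simp
qed

lemma finite_bezout:
  fixes f :: "'i \<Rightarrow> int"
  assumes "finite A"
  shows "\<exists>w. (\<Sum>i\<in>A. w i * f i) = Gcd (f ` A)"
  using assms
proof induction
  case (insert a A)
  then obtain w where w: "(\<Sum>i\<in>A. w i * f i) = Gcd (f ` A)" by blast
  obtain u v where uv: "u * f a + v * Gcd (f ` A) = gcd (f a) (Gcd (f ` A))"
    using bezout_int by blast
  have "(\<Sum>i\<in>A. (if i = a then u else v * w i) * f i) = (\<Sum>i\<in>A. v * (w i * f i))"
    using insert.hyps by (intro sum.cong) auto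
  then have "(\<Sum>i\<in>insert a A. (if i = a then u else v * w i) * f i) = Gcd (f ` insert a A)"
    using insert.hyps uv by (simp add: w flip: sum_distrib_left)
  then show ?case by (intro exI[of _ "\<lambda>i. if i = a then u else v * w i"])
qed simp

text \<open>
  The integers \<open>m\<close> and \<open>m \<mu>\<^sub>i\<close> are coprime by the minimality of \<open>m\<close>. In particular the \<open>\<mu>\<^sub>i\<close> generate \<open>(1/m) \<int>\<close> modulo \<open>\<int>\<close>.
\<close>

lemma vertex_denom_bezout:
  assumes "dual_vertex as \<mu>"
  obtains w :: "'n \<Rightarrow> int" and z :: int
  where "(\<Sum>i\<in>UNIV. \<mu> $ i * of_int (w i)) + of_int z = 1 / of_nat (vertex_denom \<mu>)"
proof -
  define m where "m = vertex_denom \<mu>"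
  note m = vertex_denom[OF assms, folded m_def]
  have "\<exists>k. of_nat m * \<mu> $ i = of_int k" for i using m(2)[of i] by (auto elim: Ints_cases)
  then obtain M where M: "\<And>i. of_nat m * \<mu> $ i = of_int (M i)" by metis
  define d where "d = gcd (int m) (Gcd (range M))"
  have "d > 0" using m(1) by (simp add: d_def)
  obtain m' where m': "int m = d * m'" unfolding d_def by (meson dvdE gcd_dvd1)
  then have "m' > 0" using m(1) \<open>d > 0\<close> by (metis of_nat_0_less_iff zero_less_mult_pos)
  have "of_nat (nat m') * \<mu> $ i \<in> \<int>" for i
  proof -
    have "d dvd M i" unfolding d_def by (meson Gcd_dvd dvd_trans gcd_dvd2 rangeI)
    then obtain k where "M i = d * k" by (rule dvdE)
    then have "of_int d * (of_int m' * \<mu> $ i) = of_int d * of_int k"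
      using M[of i] m' by (metis (mono_tags, lifting) mult.assoc of_int_mult of_int_of_nat_eq)
    then have "of_int m' * \<mu> $ i = of_int k" using \<open>d > 0\<close> by simp
    then show ?thesis using \<open>m' > 0\<close> by simp
  qed
  then have "m \<le> nat m'" using m(3) \<open>m' > 0\<close> by simp
  then have "d * m' \<le> m'" using m' \<open>m' > 0\<close> by linarith
  then have "d = 1" using \<open>m' > 0\<close> \<open>d > 0\<close> by (simp add: mult_le_cancel_right2)
  obtain w where w: "(\<Sum>i\<in>UNIV. w i * M i) = Gcd (range M)"
    using finite_bezout[of UNIV M] by auto
  obtain u v where "u * int m + v * Gcd (range M) = 1"
    using bezout_int[of "int m" "Gcd (range M)"] \<open>d = 1\<close> by (metis d_def)
  then have "of_int (u * int m + v * (\<Sum>i\<in>UNIV. w i * M i)) = (1 :: real)" by (simp add: w)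
  then have "of_nat m * ((\<Sum>i\<in>UNIV. \<mu> $ i * of_int (v * w i)) + of_int u) = 1"
    by (simp add: distrib_left sum_distrib_left mult_ac M[symmetric] add.commute)
  then have "(\<Sum>i\<in>UNIV. \<mu> $ i * of_int (v * w i)) + of_int u = 1 / of_nat m"
    using m(1) by (simp add: field_simps)
  then show thesis unfolding m_def by (rule that)
qed

text \<open>
  The unit vectors \<open>e\<^sub>i\<close> with \<open>\<mu>\<^sub>i = 0\<close> only change coordinates that are disregarded.
\<close>

lemma span_tight_coefficients:
  assumes "v \<in> span (tight as \<mu>)"
  shows "\<exists>s :: nat \<Rightarrow> real. (\<forall>j. s j \<noteq> 0 \<longrightarrow> j < length as \<and> \<mu> \<bullet> expo_vec as j = 1) \<and>
    (\<forall>i. \<mu> $ i \<noteq> 0 \<longrightarrow> v $ i = ell as s i)"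
  using assms
proof (induction rule: span_induct_alt)
  case base
  show ?case by (intro exI[of _ "\<lambda>_. 0"]) (simp add: ell_def)
next
  case (step c x y)
  then obtain s :: "nat \<Rightarrow> real" where s: "\<forall>j. s j \<noteq> 0 \<longrightarrow> j < length as \<and> \<mu> \<bullet> expo_vec as j = 1"
    "\<forall>i. \<mu> $ i \<noteq> 0 \<longrightarrow> y $ i = ell as s i" by blast
  from step.hyps(1) consider j where "x = expo_vec as j" "j < length as" "\<mu> \<bullet> expo_vec as j = 1"
    | i where "x = axis i 1" "\<mu> $ i = 0" by (auto simp: tight_def)
  then show ?case
  proof cases
    case (1 j)
    have "ell as (\<lambda>l. (if l = j then c else 0) + s l) i = real (expo as j i) * c + ell as s i" for i
      unfolding ell_add using 1(2) by (simp add: ell_def if_distrib cong: if_cong)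
    with 1 s show ?thesis
      by (intro exI[of _ "\<lambda>l. (if l = j then c else 0) + s l"]) (auto simp: expo_vec_def)
  next
    case (2 i)
    with s show ?thesis by (intro exI[of _ s]) (auto simp: axis_def)
  qed
qed

lemma inner_expo_vec: "\<mu> \<bullet> expo_vec as j = (\<Sum>i\<in>UNIV. \<mu> $ i * real (expo as j i))"
  by (simp add: inner_vec_def expo_vec_def)

text \<open>
  This identity holds for every \<open>\<mu>\<close>; at a vertex it makes \<open>\<Sum> s\<^sub>j\<close> a combination of the quantities with sign conditions.
\<close>

lemma sum_eq_dual_form:
  fixes s :: "nat \<Rightarrow> real"
  shows "(\<Sum>j<length as. s j) = (\<Sum>i\<in>UNIV. \<mu> $ i * ell as s i)
    - (\<Sum>j<length as. (\<mu> \<bullet> expo_vec as j - 1) * s j)"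
proof -
  have "(\<Sum>i\<in>UNIV. \<mu> $ i * ell as s i) = (\<Sum>j<length as. (\<mu> \<bullet> expo_vec as j) * s j)"
    unfolding ell_def inner_expo_vec sum_distrib_left sum_distrib_right
    by (subst sum.swap) (simp add: mult.assoc)
  then show ?thesis by (simp add: left_diff_distrib sum_subtractf)
qed

lemma ell_of_int: "ell as (\<lambda>j. of_int (c j)) i = of_int (ell as c i)"
  by (simp add: ell_def)

lemma ell_of_real: "ell as (\<lambda>j. of_real (s j)) i = of_real (ell as s i)"
  by (simp add: ell_def)

text \<open>
  The point \<open>s\<^sub>0\<close> is in the right class and satisfies the sign conditions. The integer vectors \<open>c\<close> that keep them have
  bounded sum, and for a maximal one \<open>s\<^sub>0 + c\<close> admits no further step of sum 1.
\<close>

theorem dual_vertex_root_point: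
  assumes "dual_vertex as \<mu>"
  shows "\<exists>s t. root_point as s \<and>
    (\<Sum>j<length as. s j) = of_real (of_int k / of_nat (vertex_denom \<mu>) + of_int t)"
proof -
  let ?r = "length as"
  have \<mu>: "\<And>i. 0 \<le> \<mu> $ i" "\<And>j. j < ?r \<Longrightarrow> 1 \<le> \<mu> \<bullet> expo_vec as j" "span (tight as \<mu>) = UNIV"
    using assms by (auto simp: dual_vertex_def)
  define m where "m = vertex_denom \<mu>"
  note m = vertex_denom[OF assms, folded m_def]
  obtain w0 :: "'n \<Rightarrow> int" and z where w0: "(\<Sum>i\<in>UNIV. \<mu> $ i * of_int (w0 i)) + of_int z = 1 / of_nat m"
    using vertex_denom_bezout[OF assms] unfolding m_def by metis
  \<comment> \<open>A multiple of \<open>m\<close> makes all \<open>w i\<close> positive and changes \<open>\<Sum> \<mu>\<^sub>i w\<^sub>i\<close> by an integer.\<close>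
  define N where "N = 1 + (\<Sum>i\<in>UNIV. \<bar>k * w0 i\<bar>)"
  define w where "w i = int m * N - k * w0 i" for i
  have w_pos: "1 \<le> w i" for i
  proof -
    have "\<bar>k * w0 i\<bar> \<le> (\<Sum>i\<in>UNIV. \<bar>k * w0 i\<bar>)" by (rule member_le_sum) auto
    then have "1 + k * w0 i \<le> N" "1 \<le> N" by (auto simp: N_def)
    moreover have "1 * N \<le> int m * N" using m(1) \<open>1 \<le> N\<close> by (intro mult_right_mono) auto
    ultimately show ?thesis unfolding w_def by linarith
  qed
  have "(\<chi> i. - of_int (w i)) \<in> span (tight as \<mu>)" using \<mu>(3) by simp
  from span_tight_coefficients[OF this] obtain s0 :: "nat \<Rightarrow> real" where
    s0': "\<forall>j. s0 j \<noteq> 0 \<longrightarrow> j < ?r \<and> \<mu> \<bullet> expo_vec as j = 1"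
    "\<forall>i. \<mu> $ i \<noteq> 0 \<longrightarrow> (\<chi> i. - of_int (w i)) $ i = ell as s0 i" by blast
  have s0: "\<And>j. s0 j \<noteq> 0 \<Longrightarrow> j < ?r \<and> \<mu> \<bullet> expo_vec as j = 1"
    "\<And>i. \<mu> $ i \<noteq> 0 \<Longrightarrow> ell as s0 i = - of_int (w i)"
    using s0' by auto
  have "\<exists>n. (\<Sum>i\<in>UNIV. of_nat m * \<mu> $ i) = of_int n"
    using Ints_sum[of UNIV "\<lambda>i. of_nat m * \<mu> $ i"] m(2) by (auto elim: Ints_cases)
  then obtain n where n: "(\<Sum>i\<in>UNIV. of_nat m * \<mu> $ i) = of_int n" by blast
  have "(\<Sum>j<?r. (\<mu> \<bullet> expo_vec as j - 1) * s0 j) = 0"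
    using s0(1) by (intro sum.neutral) force
  then have "(\<Sum>j<?r. s0 j) = (\<Sum>i\<in>UNIV. \<mu> $ i * ell as s0 i)"
    using sum_eq_dual_form[of s0 \<mu>] by simp
  also have "\<dots> = (\<Sum>i\<in>UNIV. \<mu> $ i * - of_int (w i))"
  proof (intro sum.cong refl)
    fix i
    show "\<mu> $ i * ell as s0 i = \<mu> $ i * - of_int (w i)"
      by (cases "\<mu> $ i = 0") (simp_all add: s0(2))
  qed
  also have "\<dots> = (\<Sum>i\<in>UNIV. of_int k * (\<mu> $ i * of_int (w0 i)) - of_int N * (of_nat m * \<mu> $ i))"
    by (intro sum.cong) (auto simp: w_def algebra_simps)
  also have "\<dots> = of_int k * (1 / of_nat m - of_int z) - of_int N * of_int n"
  proof -
    have "1 / of_nat m - of_int z = (\<Sum>i\<in>UNIV. \<mu> $ i * of_int (w0 i))" using w0 by simp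
    then show ?thesis by (simp only: sum_subtractf n[symmetric] sum_distrib_left)
  qed
  finally have sum_s0: "(\<Sum>j<?r. s0 j) = of_int k / of_nat m + of_int (- k * z - N * n)"
    by (simp add: algebra_simps)
  \<comment> \<open>The steps \<open>c\<close> for which \<open>s\<^sub>0 + c\<close> keeps \<open>s\<^sub>j \<ge> 0\<close> where \<open>\<mu> \<bullet> a(j) > 1\<close> and \<open>l\<^sub>i(s) \<le> - 1\<close> where \<open>\<mu>\<^sub>i > 0\<close>.\<close>
  define valid where "valid c \<longleftrightarrow> (\<forall>j<?r. \<mu> \<bullet> expo_vec as j \<noteq> 1 \<longrightarrow> 0 \<le> c j) \<and>
    (\<forall>i. \<mu> $ i \<noteq> 0 \<longrightarrow> ell as c i \<le> w i - 1)" for c :: "nat \<Rightarrow> int"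
  have bound: "(\<Sum>j<?r. c j) \<le> \<lceil>- (\<Sum>j<?r. s0 j)\<rceil>" if c: "valid c" for c
  proof -
    have "(\<Sum>j<?r. s0 j + of_int (c j)) \<le> 0"
    proof -
      have 1: "\<mu> $ i * ell as (\<lambda>j. s0 j + of_int (c j)) i \<le> 0" for i
      proof (cases "\<mu> $ i = 0")
        case False
        then have "ell as c i \<le> w i - 1" using c by (simp add: valid_def)
        then have "of_int (ell as c i) \<le> (of_int (w i - 1) :: real)" by (simp only: of_int_le_iff)
        then have "ell as (\<lambda>j. s0 j + of_int (c j)) i \<le> 0"
          using s0(2)[OF False] by (simp add: ell_add ell_of_int)
        then show ?thesis using \<mu>(1)[of i] by (simp add: mult_nonneg_nonpos)
      qed simp
      have 2: "0 \<le> (\<mu> \<bullet> expo_vec as j - 1) * (s0 j + of_int (c j))" if j: "j < ?r" for j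
      proof (cases "\<mu> \<bullet> expo_vec as j = 1")
        case False
        then have "s0 j = 0" "0 \<le> c j" using s0(1)[of j] c j by (auto simp: valid_def)
        then show ?thesis using \<mu>(2)[OF j] by simp
      qed simp
      have "(\<Sum>i\<in>UNIV. \<mu> $ i * ell as (\<lambda>j. s0 j + of_int (c j)) i) \<le> 0"
        using 1 by (intro sum_nonpos) auto
      moreover have "0 \<le> (\<Sum>j<?r. (\<mu> \<bullet> expo_vec as j - 1) * (s0 j + of_int (c j)))"
        using 2 by (intro sum_nonneg) auto
      ultimately show ?thesis
        using sum_eq_dual_form[of "\<lambda>j. s0 j + of_int (c j)" \<mu>] by linarith
    qed
    then have "of_int (\<Sum>j<?r. c j) \<le> - (\<Sum>j<?r. s0 j)" by (simp add: sum.distrib)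
    then show ?thesis by (meson le_of_int_ceiling of_int_le_iff order_trans)
  qed
  have "valid (\<lambda>_. 0)" 
    using w_pos by (auto simp: valid_def ell_def intro: less_le_trans[OF zero_less_one])
  from ex_has_least_nat[of valid, OF this, of "\<lambda>c. nat (\<lceil>- (\<Sum>j<?r. s0 j)\<rceil> - (\<Sum>j<?r. c j))"]
  obtain c where c: "valid c" and max: "\<And>c'. valid c' \<Longrightarrow>
      nat (\<lceil>- (\<Sum>j<?r. s0 j)\<rceil> - (\<Sum>j<?r. c j)) \<le> nat (\<lceil>- (\<Sum>j<?r. s0 j)\<rceil> - (\<Sum>j<?r. c' j))"
    by blast
  have max: "(\<Sum>j<?r. c' j) \<le> (\<Sum>j<?r. c j)" if "valid c'" for c'
    using max[OF that] bound[OF that] bound[OF c] by linarith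
  define s :: "nat \<Rightarrow> complex" where "s j = of_real (s0 j + of_int (c j))" for j
  have ell_s: "ell as s i = of_real (ell as s0 i + of_int (ell as c i))" for i
    unfolding s_def ell_of_real by (simp add: ell_add ell_of_int)
  have "root_point as s"
    unfolding root_point_def
  proof
    assume "\<exists>d :: nat \<Rightarrow> int. (\<Sum>j<?r. d j) = 1 \<and>
     (\<forall>j<?r. \<forall>n. s j = of_nat n \<longrightarrow> - int n \<le> d j) \<and>
     (\<forall>i n. ell as s i = - of_nat (Suc n) \<longrightarrow> ell as d i \<le> int n)"
    then obtain d :: "nat \<Rightarrow> int" where d: "(\<Sum>j<?r. d j) = 1"
      "\<And>j n. j < ?r \<Longrightarrow> s j = of_nat n \<Longrightarrow> - int n \<le> d j"
      "\<And>i n. ell as s i = - of_nat (Suc n) \<Longrightarrow> ell as d i \<le> int n" by blast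
    have "valid (\<lambda>j. c j + d j)"
      unfolding valid_def
    proof (intro conjI allI impI)
      fix j assume j: "j < ?r" "\<mu> \<bullet> expo_vec as j \<noteq> 1"
      then have "s0 j = 0" "0 \<le> c j" using s0(1)[of j] c by (auto simp: valid_def)
      then have "s j = of_nat (nat (c j))" by (simp add: s_def)
      from d(2)[OF j(1) this] \<open>0 \<le> c j\<close> show "0 \<le> c j + d j" by simp
    next
      fix i assume i: "\<mu> $ i \<noteq> 0"
      define l where "l = nat (w i - 1 - ell as c i)"
      have "ell as c i \<le> w i - 1" using c i by (simp add: valid_def)
      then have l: "int l = w i - 1 - ell as c i" by (simp add: l_def)
      have "ell as s i = of_int (- (1 + int l))"
        unfolding ell_s s0(2)[OF i] l by simp
      then have "ell as s i = - of_nat (Suc l)" by simp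
      from d(3)[OF this] show "ell as (\<lambda>j. c j + d j) i \<le> w i - 1"
        by (simp add: ell_add l)
    qed
    from max[OF this] d(1) show False by (simp add: sum.distrib)
  qed
  moreover have "(\<Sum>j<?r. s j) = of_real ((\<Sum>j<?r. s0 j) + of_int (\<Sum>j<?r. c j))"
    by (simp add: s_def sum.distrib)
  then have "(\<Sum>j<?r. s j) = of_real (of_int k / of_nat m + of_int (- k * z - N * n + (\<Sum>j<?r. c j)))"
    unfolding sum_s0 by (simp only: of_int_add add.assoc)
  ultimately show ?thesis unfolding m_def by blast
qed

end

section \<open>The minimal polynomial and the group of rational numbers modulo the integers\<close>

text \<open>
  For each pair \<open>J\<close>, \<open>I\<close> that admits an integral direction one such direction is put into the list; the
  remaining pairs have a dual vertex.
\<close>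

lemma bs_equation_upper_bound:
  fixes as :: "('n::{finite,linorder} \<Rightarrow>\<^sub>0 nat) list"
  assumes "as \<noteq> []"
  obtains \<alpha>s where "bs_equation (map xmonom as) (\<Prod>\<alpha>\<leftarrow>\<alpha>s. [:- \<alpha>, 1:])"
    "\<And>\<alpha>. \<alpha> \<in> set \<alpha>s \<Longrightarrow>
      \<exists>\<mu> k. dual_vertex as \<mu> \<and> \<alpha> = of_real (of_int k / of_nat (newton.vertex_denom \<mu>))"
proof -
  interpret newton as by unfold_locales (fact assms)
  let ?r = "length as"
  define dirs :: "nat set \<Rightarrow> 'n set \<Rightarrow> (nat \<Rightarrow> int) \<Rightarrow> bool" where "dirs J I c \<longleftrightarrow>
    (\<Sum>j<?r. c j) = 1 \<and> (\<forall>j\<in>J. j < ?r \<longrightarrow> 0 \<le> c j) \<and> (\<forall>i\<in>I. ell as c i \<le> 0)" for J I c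
  define R where "R = {of_real (of_int k / of_nat (vertex_denom \<mu>)) :: complex | k \<mu>. dual_vertex as \<mu>}"
  let ?C = "(\<lambda>(J, I). SOME c. dirs J I c) ` {(J, I). J \<subseteq> {..<?r} \<and> Ex (dirs J I)}"
  have "finite {(J, I :: 'n set). J \<subseteq> {..<?r} \<and> Ex (dirs J I)}"
    by (rule finite_subset[of _ "Pow {..<?r} \<times> UNIV"]) auto
  then obtain Cs where Cs: "set Cs = ?C" using finite_list[of ?C] by blast
  have someC: "dirs J I (SOME c. dirs J I c)" if "Ex (dirs J I)" for J I
    using that by (rule someI_ex)
  have "\<exists>\<alpha>s. set \<alpha>s \<subseteq> R \<and> bs_equation (map xmonom as) (\<Prod>\<alpha>\<leftarrow>\<alpha>s. [:- \<alpha>, 1:])"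
  proof (rule bs_equation_from_directions[of Cs])
    show "(\<Sum>j<?r. c j) = 1" if c: "c \<in> set Cs" for c
    proof -
      obtain J I where "Ex (dirs J I)" "c = (SOME c. dirs J I c)" using c unfolding Cs by auto
      then have "dirs J I c" using someC by metis
      then show ?thesis by (simp add: dirs_def)
    qed
    fix J I
    assume hits: "\<And>c. c \<in> set Cs \<Longrightarrow> (\<exists>j\<in>J. j < ?r \<and> c j < 0) \<or> (\<exists>i\<in>I. ell as c i > 0)"
    have "\<not> Ex (dirs (J \<inter> {..<?r}) I)"
    proof
      assume ex: "Ex (dirs (J \<inter> {..<?r}) I)"
      let ?c = "SOME c. dirs (J \<inter> {..<?r}) I c"
      have "?c \<in> set Cs" unfolding Cs using ex by (intro image_eqI[of _ _ "(J \<inter> {..<?r}, I)"]) auto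
      moreover have False if "c \<in> set Cs" "dirs (J \<inter> {..<?r}) I c" for c
        using hits[OF that(1)] that(2) unfolding dirs_def by (metis IntI lessThan_iff not_le)
      ultimately show False using someC[OF ex] by blast
    qed
    then have "\<nexists>c. dirs (J \<inter> {..<?r}) I c" .
    then obtain q :: "'n \<Rightarrow> rat" where q': "\<forall>i. 0 \<le> q i" "\<forall>i. i \<notin> I \<longrightarrow> q i = 0"
      "\<forall>j<?r. 1 \<le> (\<Sum>i\<in>UNIV. of_nat (expo as j i) * q i) \<and>
        (j \<notin> J \<inter> {..<?r} \<longrightarrow> (\<Sum>i\<in>UNIV. of_nat (expo as j i) * q i) = 1)"
      using direction_or_dual_point[of as "J \<inter> {..<?r}" I] unfolding dirs_def by meson
    then have q: "\<And>i. 0 \<le> q i" "\<And>i. i \<notin> I \<Longrightarrow> q i = 0"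
      "\<And>j. j < ?r \<Longrightarrow> 1 \<le> (\<Sum>i\<in>UNIV. of_nat (expo as j i) * q i)"
      "\<And>j. j < ?r \<Longrightarrow> j \<notin> J \<Longrightarrow> (\<Sum>i\<in>UNIV. of_nat (expo as j i) * q i) = 1"
      by auto
    have inner: "(\<chi> i. of_rat (q i)) \<bullet> expo_vec as j = real_of_rat (\<Sum>i\<in>UNIV. of_nat (expo as j i) * q i)" for j
      by (simp add: inner_expo_vec of_rat_sum of_rat_mult mult.commute)
    obtain \<nu> where \<nu>: "dual_vertex as \<nu>" "\<And>i. i \<notin> I \<Longrightarrow> \<nu> $ i = 0"
      "\<And>j. j < ?r \<Longrightarrow> j \<notin> J \<Longrightarrow> \<nu> \<bullet> expo_vec as j = 1"
    proof (rule exists_dual_vertex[of "\<chi> i. of_rat (q i)" I as J])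
      show "1 \<le> (\<chi> i. of_rat (q i)) \<bullet> expo_vec as j" if "j < ?r" for j
        unfolding inner using q(3)[OF that] by simp
      show "(\<chi> i. of_rat (q i)) \<bullet> expo_vec as j = 1" if "j < ?r" "j \<notin> J" for j
        unfolding inner using q(4)[OF that] by simp
    qed (use q in auto)
    let ?\<mu> = "\<lambda>i. complex_of_real (\<nu> $ i)"
    have sum: "(\<Sum>i\<in>UNIV. ?\<mu> i * of_nat (expo as j i)) = of_real (\<nu> \<bullet> expo_vec as j)" for j
      by (simp add: inner_expo_vec)
    have "- (\<Sum>i\<in>UNIV. ?\<mu> i * of_nat (w i))
        - (\<Sum>j<?r. ((\<Sum>i\<in>UNIV. ?\<mu> i * of_nat (expo as j i)) - 1) * of_nat (v j)) \<in> R" for v w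
    proof -
      define m where "m = vertex_denom \<nu>"
      note m = vertex_denom[OF \<nu>(1), folded m_def]
      define x where "x = - (\<Sum>i\<in>UNIV. \<nu> $ i * of_nat (w i)) - (\<Sum>j<?r. (\<nu> \<bullet> expo_vec as j - 1) * of_nat (v j))"
      have "of_nat m * x = - (\<Sum>i\<in>UNIV. (of_nat m * \<nu> $ i) * of_nat (w i))
          - (\<Sum>j<?r. ((\<Sum>i\<in>UNIV. (of_nat m * \<nu> $ i) * of_nat (expo as j i)) - of_nat m) * of_nat (v j))"
        by (simp add: x_def inner_expo_vec right_diff_distrib left_diff_distrib sum_subtractf
            sum_distrib_left sum_distrib_right mult.assoc)
      also have "\<dots> \<in> \<int>"
        by (intro Ints_diff Ints_minus Ints_sum Ints_mult m(2) Ints_of_nat)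
      finally obtain k where "of_nat m * x = of_int k" by (elim Ints_cases)
      then have "x = of_int k / of_nat m" using m(1) by (simp add: field_simps)
      moreover have "- (\<Sum>i\<in>UNIV. ?\<mu> i * of_nat (w i))
        - (\<Sum>j<?r. ((\<Sum>i\<in>UNIV. ?\<mu> i * of_nat (expo as j i)) - 1) * of_nat (v j)) = of_real x"
        unfolding sum by (simp add: x_def)
      ultimately show ?thesis using \<nu>(1) unfolding R_def m_def by blast
    qed
    then show "\<exists>\<mu>. (\<forall>i. i \<notin> I \<longrightarrow> \<mu> i = 0) \<and>
        (\<forall>j<?r. j \<notin> J \<longrightarrow> (\<Sum>i\<in>UNIV. \<mu> i * of_nat (expo as j i)) = 1) \<and>
        (\<forall>v w. - (\<Sum>i\<in>UNIV. \<mu> i * of_nat (w i))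
          - (\<Sum>j<?r. ((\<Sum>i\<in>UNIV. \<mu> i * of_nat (expo as j i)) - 1) * of_nat (v j)) \<in> R)"
      using \<nu> by (intro exI[of _ ?\<mu>]) (auto simp: sum)
  qed
  then obtain \<alpha>s where "set \<alpha>s \<subseteq> R" "bs_equation (map xmonom as) (\<Prod>\<alpha>\<leftarrow>\<alpha>s. [:- \<alpha>, 1:])" by blast
  moreover from this(1) have "\<exists>\<mu> k. dual_vertex as \<mu> \<and> \<alpha> = of_real (of_int k / of_nat (vertex_denom \<mu>))"
    if "\<alpha> \<in> set \<alpha>s" for \<alpha>
    using that unfolding R_def by blast
  ultimately show thesis by (intro that[of \<alpha>s])
qed

lemma lead_coeff_linear_factors: "lead_coeff (\<Prod>\<alpha>\<leftarrow>\<alpha>s. [:- \<alpha>, 1 :: complex:]) = 1"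
  by (induction \<alpha>s) (simp_all add: lead_coeff_mult del: mult_pCons_left)

text \<open>
  Division with remainder: the polynomials that satisfy the functional equation form an ideal.
\<close>

lemma bernstein_sato_poly_minimal:
  assumes "0 \<notin> set fs" "lead_coeff b1 = 1" "bs_equation fs b1"
  shows "bs_equation fs (bernstein_sato_poly fs)"
    and "bs_equation fs c \<Longrightarrow> bernstein_sato_poly fs dvd c"
proof -
  let ?ok = "\<lambda>b. lead_coeff b = 1 \<and> bs_equation fs b"
  from ex_has_least_nat[of ?ok b1 degree] assms(2,3)
  obtain b where b: "?ok b" and least: "\<And>c. ?ok c \<Longrightarrow> degree b \<le> degree c" by blast
  have "b \<noteq> 0" using b by auto
  have dvd: "b dvd c" if c: "bs_equation fs c" for c
  proof (rule ccontr)
    assume "\<not> b dvd c"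
    then have r: "c mod b \<noteq> 0" by (simp add: dvd_eq_mod_eq_0)
    let ?l = "lead_coeff (c mod b)"
    have "bs_equation fs (c + (- (c div b)) * b)"
      using b by (intro bs_equation_add c bs_equation_mult assms(1)) blast
    moreover have "c + (- (c div b)) * b = c mod b"
      by (simp add: minus_div_mult_eq_mod)
    ultimately have "bs_equation fs ([:inverse ?l:] * (c mod b))"
      using bs_equation_mult[OF assms(1)] by metis
    moreover have "lead_coeff ([:inverse ?l:] * (c mod b)) = 1" using r by simp
    ultimately have "degree b \<le> degree ([:inverse ?l:] * (c mod b))" by (intro least) blast
    also have "\<dots> = degree (c mod b)" using r by simp
    also have "\<dots> < degree b"
    proof (cases "degree b = 0")
      case True
      then have "is_unit b" using \<open>b \<noteq> 0\<close> by (simp add: is_unit_iff_degree)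
      then have "c mod b = 0" by (simp add: unit_imp_mod_eq_0)
      with r show ?thesis by simp
    next
      case False
      then show ?thesis using degree_mod_less'[OF \<open>b \<noteq> 0\<close> r] by simp
    qed
    finally show False by simp
  qed
  have "bernstein_sato_poly fs = b"
    unfolding bernstein_sato_poly_def
  proof (rule the_equality)
    show "lead_coeff b = 1 \<and> bs_equation fs b \<and> (\<forall>c. lead_coeff c = 1 \<and> bs_equation fs c \<longrightarrow> degree b \<le> degree c)"
      using b least by blast
    fix b' assume b': "lead_coeff b' = 1 \<and> bs_equation fs b' \<and>
      (\<forall>c. lead_coeff c = 1 \<and> bs_equation fs c \<longrightarrow> degree b' \<le> degree c)"
    then obtain d where d: "b' = b * d" using dvd by (meson dvdE)
    have "b' \<noteq> 0" using b' by auto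
    then have "d \<noteq> 0" using d by auto
    have "degree b' = degree b" using b b' least by (meson le_antisym)
    then have "degree d = 0" using d \<open>b \<noteq> 0\<close> \<open>d \<noteq> 0\<close> by (simp add: degree_mult_eq)
    then obtain a where a: "d = [:a:]" by (rule degree_eq_zeroE)
    have "lead_coeff d = 1" using b b' d by (simp add: lead_coeff_mult)
    with a d show "b' = b" by simp
  qed
  with b dvd show "bs_equation fs (bernstein_sato_poly fs)"
    "bs_equation fs c \<Longrightarrow> bernstein_sato_poly fs dvd c" by auto
qed

lemma rat_group_comm_group: "comm_group rat_group"
proof (rule comm_groupI)
  fix x assume "x \<in> carrier rat_group"
  have "- x \<otimes>\<^bsub>rat_group\<^esub> x = \<one>\<^bsub>rat_group\<^esub>" by (simp add: rat_group_def)
  then show "\<exists>y\<in>carrier rat_group. y \<otimes>\<^bsub>rat_group\<^esub> x = \<one>\<^bsub>rat_group\<^esub>"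
    by (intro bexI[of _ "- x"]) (auto simp: rat_group_def)
qed (auto simp: rat_group_def)

lemma rat_group_simps [simp]: "carrier rat_group = UNIV" "x \<otimes>\<^bsub>rat_group\<^esub> y = x + y" "\<one>\<^bsub>rat_group\<^esub> = 0"
  by (simp_all add: rat_group_def)

lemma rat_group_inv [simp]: "inv\<^bsub>rat_group\<^esub> x = - x"
  using comm_group.axioms(2)[OF rat_group_comm_group]
  by (intro group.inv_equality) (auto simp: rat_group_def)

lemma Ints_normal: "\<int> \<lhd> rat_group"
proof -
  have "subgroup \<int> rat_group"
    using comm_group.axioms(2)[OF rat_group_comm_group]
    by (intro subgroup.intro) auto
  then show ?thesis
    using comm_group.subgroup_imp_normal[OF rat_group_comm_group] by blast
qed

lemma QZ_class_eq_iff: "QZ_class p = QZ_class q \<longleftrightarrow> p - q \<in> \<int>"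
proof -
  have mem: "x \<in> QZ_class q \<longleftrightarrow> x - q \<in> \<int>" for x q
    by (auto simp: QZ_class_def r_coset_def rat_group_def intro: bexI[of _ "x - q"])
  show ?thesis
  proof
    assume "QZ_class p = QZ_class q"
    then have "p \<in> QZ_class q" using mem[of p p] by simp
    then show "p - q \<in> \<int>" by (simp add: mem)
  next
    assume pq: "p - q \<in> \<int>"
    have "x - p \<in> \<int> \<longleftrightarrow> x - q \<in> \<int>" for x
      using Ints_add[OF _ pq, of "x - p"] Ints_diff[OF _ pq, of "x - q"] by auto
    then show "QZ_class p = QZ_class q" by (auto simp: mem)
  qed
qed

lemma QZ_group: "group QZ"
  unfolding QZ_def by (rule normal.factorgroup_is_group[OF Ints_normal])

lemma QZ_class_carrier: "QZ_class q \<in> carrier QZ"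
  by (auto simp: QZ_def QZ_class_def FactGroup_def RCOSETS_def rat_group_def)

lemma QZ_mult: "QZ_class p \<otimes>\<^bsub>QZ\<^esub> QZ_class q = QZ_class (p + q)"
  using normal.rcos_sum[OF Ints_normal, of p q]
  by (simp add: QZ_def QZ_class_def FactGroup_def)

lemma QZ_one: "\<one>\<^bsub>QZ\<^esub> = QZ_class 0"
  by (auto simp: QZ_def QZ_class_def FactGroup_def r_coset_def rat_group_def)

lemma QZ_inv: "inv\<^bsub>QZ\<^esub> QZ_class q = QZ_class (- q)"
  by (rule group.inv_equality[OF QZ_group]) (simp_all add: QZ_mult QZ_one QZ_class_carrier)

lemma generate_QZ: "generate QZ {QZ_class q} = {QZ_class (of_int k * q) | k. True}"
proof (intro equalityI subsetI)
  fix x assume "x \<in> generate QZ {QZ_class q}"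
  then show "x \<in> {QZ_class (of_int k * q) | k. True}"
  proof (induction rule: generate.induct)
    case one
    show ?case by (auto simp: QZ_one intro: exI[of _ 0])
  next
    case (incl h)
    then show ?case by (auto intro: exI[of _ 1])
  next
    case (inv h)
    then show ?case by (auto simp: QZ_inv intro: exI[of _ "- 1"])
  next
    case (eng h1 h2)
    then obtain k l where "h1 = QZ_class (of_int k * q)" "h2 = QZ_class (of_int l * q)" by auto
    then show ?case by (auto simp: QZ_mult distrib_right intro!: exI[of _ "k + l"])
  qed
next
  fix x assume "x \<in> {QZ_class (of_int k * q) | k. True}"
  then obtain k where x: "x = QZ_class (of_int k * q)" by blast
  have nat: "QZ_class (of_nat n * q) \<in> generate QZ {QZ_class q}"
    "QZ_class (- of_nat n * q) \<in> generate QZ {QZ_class q}" for n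
  proof (induction n)
    case 0
    show "QZ_class (of_nat 0 * q) \<in> generate QZ {QZ_class q}"
      "QZ_class (- of_nat 0 * q) \<in> generate QZ {QZ_class q}"
      using generate.one[of QZ "{QZ_class q}"] by (simp_all add: QZ_one)
  next
    case (Suc n)
    have "QZ_class q \<in> generate QZ {QZ_class q}" "QZ_class (- q) \<in> generate QZ {QZ_class q}"
      using generate.incl[of "QZ_class q" "{QZ_class q}" QZ] generate.inv[of "QZ_class q" "{QZ_class q}" QZ]
      by (simp_all add: QZ_inv)
    from generate.eng[OF this(1) Suc(1)] generate.eng[OF this(2) Suc(2)]
    show "QZ_class (of_nat (Suc n) * q) \<in> generate QZ {QZ_class q}"
      "QZ_class (- of_nat (Suc n) * q) \<in> generate QZ {QZ_class q}"
      by (simp_all add: QZ_mult algebra_simps)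
  qed
  show "x \<in> generate QZ {QZ_class q}"
    unfolding x using nat by (cases k rule: int_cases2) auto
qed

text \<open>
  The monomials that occur in the given generators belong to the ideal and generate it, which yields a finite list
  of monomial generators.
\<close>

lemma monomial_ideal_obtain:
  fixes fs :: "'n cpoly list"
  assumes "monomial_ideal \<aa>" "\<aa> \<noteq> {0}" "ideal_gen (set fs) = \<aa>"
  obtains as where "as \<noteq> []" "\<aa> = ideal_gen (xmonom ` set as)"
proof -
  obtain U where U: "\<aa> = ideal_gen (xmonom ` U)" using assms(1) by (auto simp: monomial_ideal_def)
  have "finite (\<Union>f\<in>set fs. Poly_Mapping.keys f)" by simp
  then obtain as where as: "set as = (\<Union>f\<in>set fs. Poly_Mapping.keys f)" using finite_list by blast
  have "ideal_gen (set fs) \<subseteq> ideal_gen (xmonom ` set as)"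
    unfolding ideal_gen_eq_span
  proof (rule ring_self.span_minimal)
    show "set fs \<subseteq> ring_self.span (xmonom ` set as)"
    proof
      fix f assume f: "f \<in> set fs"
      have "(\<Sum>u\<in>Poly_Mapping.keys f. Cst (Poly_Mapping.lookup f u) * xmonom u) \<in> ring_self.span (xmonom ` set as)"
        using f as by (intro ring_self.span_sum ring_self.span_scale ring_self.span_base) auto
      moreover have "f = (\<Sum>u\<in>Poly_Mapping.keys f. Cst (Poly_Mapping.lookup f u) * xmonom u)"
        using mpoly_eq_sum_single[of f] by (simp add: xmonom_def Cst_Var_mult_single)
      ultimately show "f \<in> ring_self.span (xmonom ` set as)" by simp
    qed
  qed (rule ring_self.subspace_span)
  moreover have "ideal_gen (xmonom ` set as) \<subseteq> \<aa>"
    unfolding ideal_gen_eq_span U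
  proof (rule ring_self.span_minimal)
    show "xmonom ` set as \<subseteq> ring_self.span (xmonom ` U)"
    proof
      fix x assume "x \<in> xmonom ` set as"
      then obtain f u where fu: "f \<in> set fs" "u \<in> Poly_Mapping.keys f" "x = xmonom u" using as by auto
      have "f \<in> ideal_gen (xmonom ` U)"
        using fu(1) assms(3) U by (metis ideal_gen_eq_span ring_self.span_base)
      from keys_monomial_ideal[OF this fu(2)] obtain a where a: "a \<in> U"
        "\<And>i. Poly_Mapping.lookup a i \<le> Poly_Mapping.lookup u i" by blast
      then have "u = (u - a) + a" by (intro poly_mapping_eqI) (auto simp: lookup_add lookup_minus)
      then have "x = xmonom (u - a) * xmonom a" using fu(3) by (metis xmonom_add)
      then show "x \<in> ring_self.span (xmonom ` U)"
        using a(1) by (simp add: ring_self.span_scale ring_self.span_base)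
    qed
  qed (rule ring_self.subspace_span)
  ultimately have "\<aa> = ideal_gen (xmonom ` set as)" using assms(3) by auto
  moreover have "as \<noteq> []"
    using calculation assms(2) by (auto simp: ideal_gen_eq_span)
  ultimately show thesis using that by blast
qed

theorem theorem1p2:
  fixes \<aa> :: "('n::{finite,linorder}) cpoly set"
    and fs :: "'n cpoly list"
  assumes "monomial_ideal \<aa>"
    and "\<aa> \<noteq> {0}"
    and "0 \<notin> set fs"
    and "ideal_gen (set fs) = \<aa>"
  shows "(\<forall>z. poly (bernstein_sato_poly fs) z = 0 \<longrightarrow> z \<in> \<rat>) \<and>
    QZ_class ` {q. poly (bernstein_sato_poly fs) (of_rat q) = 0} =
      (\<Union>Q \<in> {Q. Q facet_of newton_polyhedron \<aa> \<and> \<not> in_coordinate_hyperplane Q}.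
         generate QZ {QZ_class (1 / of_nat (facet_denom Q))})"
proof -
  obtain as where as: "as \<noteq> []" "\<aa> = ideal_gen (xmonom ` set as)"
    using monomial_ideal_obtain[OF assms(1,2,4)] by metis
  interpret newton as by unfold_locales (fact as(1))
  have bs_iff: "bs_equation fs b \<longleftrightarrow> bs_equation (map xmonom as) b" for b
    using assms(3,4) as(2) by (intro bs_equation_independent monomial_gens_nonzero) simp_all
  obtain \<alpha>s where \<alpha>s: "bs_equation fs (\<Prod>\<alpha>\<leftarrow>\<alpha>s. [:- \<alpha>, 1:])"
    "\<And>\<alpha>. \<alpha> \<in> set \<alpha>s \<Longrightarrow> \<exists>\<mu> k. dual_vertex as \<mu> \<and> \<alpha> = of_real (of_int k / of_nat (vertex_denom \<mu>))"
    using bs_equation_upper_bound[OF as(1)] unfolding bs_iff by metis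
  let ?b = "bernstein_sato_poly fs"
  note minimal = bernstein_sato_poly_minimal[OF assms(3) lead_coeff_linear_factors \<alpha>s(1)]
  have root: "\<exists>\<mu> k. dual_vertex as \<mu> \<and> z = of_rat (of_int k / of_nat (vertex_denom \<mu>))"
    if "poly ?b z = 0" for z
  proof -
    have "?b dvd (\<Prod>\<alpha>\<leftarrow>\<alpha>s. [:- \<alpha>, 1:])" using minimal(2) \<alpha>s(1) by blast
    then have "poly (\<Prod>\<alpha>\<leftarrow>\<alpha>s. [:- \<alpha>, 1:]) z = 0" using that by (metis dvdE mult_eq_0_iff poly_mult)
    then have "z \<in> set \<alpha>s" by (induction \<alpha>s) auto
    from \<alpha>s(2)[OF this] show ?thesis by (simp add: of_rat_divide)
  qed
  have denoms: "(\<Union>Q \<in> {Q. Q facet_of newton_polyhedron \<aa> \<and> \<not> in_coordinate_hyperplane Q}.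
         generate QZ {QZ_class (1 / of_nat (facet_denom Q))}) =
      {QZ_class (of_int k / of_nat (vertex_denom \<mu>)) | k \<mu>. dual_vertex as \<mu>}"
  proof -
    have "(\<Union>Q \<in> {Q. Q facet_of newton_polyhedron \<aa> \<and> \<not> in_coordinate_hyperplane Q}.
         generate QZ {QZ_class (1 / of_nat (facet_denom Q))}) =
      (\<Union>m \<in> facet_denom ` {Q. Q facet_of newton_polyhedron \<aa> \<and> \<not> in_coordinate_hyperplane Q}.
         generate QZ {QZ_class (1 / of_nat m)})" by simp
    also have "\<dots> = (\<Union>m \<in> vertex_denom ` {\<mu>. dual_vertex as \<mu>}. generate QZ {QZ_class (1 / of_nat m)})"
      unfolding as(2) facet_denoms_eq ..
    finally show ?thesis by (auto simp: generate_QZ)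
  qed
  have "QZ_class ` {q. poly ?b (of_rat q) = 0} =
      {QZ_class (of_int k / of_nat (vertex_denom \<mu>)) | k \<mu>. dual_vertex as \<mu>}"
  proof (intro equalityI subsetI)
    fix x assume "x \<in> QZ_class ` {q. poly ?b (of_rat q) = 0}"
    then obtain q where "x = QZ_class q" "poly ?b (of_rat q) = 0" by blast
    with root[of "of_rat q"] show "x \<in> {QZ_class (of_int k / of_nat (vertex_denom \<mu>)) | k \<mu>. dual_vertex as \<mu>}"
      by (auto simp only: of_rat_eq_iff)
  next
    fix x assume "x \<in> {QZ_class (of_int k / of_nat (vertex_denom \<mu>)) | k \<mu>. dual_vertex as \<mu>}"
    then obtain k \<mu> where x: "x = QZ_class (of_int k / of_nat (vertex_denom \<mu>))" "dual_vertex as \<mu>" by blast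
    from dual_vertex_root_point[OF x(2), of k] obtain s t where s: "root_point as s"
      "(\<Sum>j<length as. s j) = of_real (of_int k / of_nat (vertex_denom \<mu>) + of_int t)" by blast
    have "poly ?b (\<Sum>j<length as. s j) = 0"
      using root_point_imp_root[OF s(1)] minimal(1) by (simp add: bs_iff)
    also have "(\<Sum>j<length as. s j) = of_rat (of_int k / of_nat (vertex_denom \<mu>) + of_int t)"
      unfolding s(2) by (simp add: of_rat_add of_rat_divide)
    finally have "poly ?b (of_rat (of_int k / of_nat (vertex_denom \<mu>) + of_int t)) = 0" .
    moreover have "x = QZ_class (of_int k / of_nat (vertex_denom \<mu>) + of_int t)"
      unfolding x(1) QZ_class_eq_iff by simp
    ultimately show "x \<in> QZ_class ` {q. poly ?b (of_rat q) = 0}" by blast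
  qed
  with root denoms show ?thesis by (auto simp: Rats_def)
qed

end
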